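(* Let $G$ be a finite group and let $p$ be a prime. If $\mathrm{acd}_{p'}(G) < \dfrac{2(p+1)}{p+3}$, then $G$ is $p$-nilpotent.
   Context: $\mathrm{Irr}(G)$ denotes the set of irreducible complex characters of the finite group $G$. For a prime $p$, $\mathrm{Irr}_{p'}(G)$ is the set of $\chi\in\mathrm{Irr}(G)$ whose degree $\chi(1)$ is not divisible by $p$, and $\mathrm{acd}_{p'}(G)=\frac{1}{|\mathrm{Irr}_{p'}(G)|}\sum_{\chi\in\mathrm{Irr}_{p'}(G)}\chi(1)$ is the average degree of these characters. $G$ is $p$-nilpotent if it has a normal $p$-complement, i.e. a normal subgroup of order prime to $p$ and of index a power of $p$. *)

theory Defs
  imports
    "HOL-Algebra.Algebra"
    "HOL-Computational_Algebra.Primes"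
    "Jordan_Normal_Form.VS_Connect"
begin

definition general_linear :: "nat \<Rightarrow> complex mat monoid" where
  "general_linear n = units_of (ring_mat TYPE(complex) n ())"

definition is_representation ::
    "('a, 'b) monoid_scheme \<Rightarrow> nat \<Rightarrow> ('a \<Rightarrow> complex mat) \<Rightarrow> bool" where
  "is_representation G n \<rho> \<longleftrightarrow> \<rho> \<in> hom G (general_linear n)"

definition is_irreducible_representation ::
    "('a, 'b) monoid_scheme \<Rightarrow> nat \<Rightarrow> ('a \<Rightarrow> complex mat) \<Rightarrow> bool" where
  "is_irreducible_representation G n \<rho> \<longleftrightarrow>
     is_representation G n \<rho> \<and> n > 0 \<and>
     (\<forall>W. VectorSpace.subspace class_ring W (module_vec TYPE(complex) n) \<longrightarrow>
          (\<forall>g \<in> carrier G. \<forall>w \<in> W. \<rho> g *\<^sub>v w \<in> W) \<longrightarrow>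
          W = {0\<^sub>v n} \<or> W = carrier_vec n)"

definition mat_trace :: "complex mat \<Rightarrow> complex" where
  "mat_trace A = (\<Sum>i<dim_row A. A $$ (i, i))"

text \<open>Characters are restricted to the carrier, so that representations that agree on the
  group have the same character and \<open>irr_chars G\<close> has the right cardinality.\<close>

definition character_of ::
    "('a, 'b) monoid_scheme \<Rightarrow> ('a \<Rightarrow> complex mat) \<Rightarrow> 'a \<Rightarrow> complex" where
  "character_of G \<rho> = restrict (\<lambda>g. mat_trace (\<rho> g)) (carrier G)"

definition irr_chars :: "('a, 'b) monoid_scheme \<Rightarrow> ('a \<Rightarrow> complex) set" where
  "irr_chars G = {character_of G \<rho> | n \<rho>. is_irreducible_representation G n \<rho>}"

text \<open>The value at the identity, as a natural number: for a character it is the dimension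
  of any representation affording it.\<close>

definition char_degree :: "('a, 'b) monoid_scheme \<Rightarrow> ('a \<Rightarrow> complex) \<Rightarrow> nat" where
  "char_degree G \<chi> = (THE d. \<chi> \<one>\<^bsub>G\<^esub> = of_nat d)"

definition irr_chars_p' :: "nat \<Rightarrow> ('a, 'b) monoid_scheme \<Rightarrow> ('a \<Rightarrow> complex) set" where
  "irr_chars_p' p G = {\<chi> \<in> irr_chars G. \<not> p dvd char_degree G \<chi>}"

definition acd_p' :: "nat \<Rightarrow> ('a, 'b) monoid_scheme \<Rightarrow> real" where
  "acd_p' p G =
     (1 / real (card (irr_chars_p' p G))) * (\<Sum>\<chi>\<in>irr_chars_p' p G. real (char_degree G \<chi>))"

definition p_nilpotent :: "nat \<Rightarrow> ('a, 'b) monoid_scheme \<Rightarrow> bool" where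
  "p_nilpotent p G \<longleftrightarrow>
     (\<exists>N. N \<lhd> G \<and> coprime (card N) p \<and> (\<exists>k. card (rcosets\<^bsub>G\<^esub> N) = p ^ k))"

end

theory Submission
  imports Defs "Jordan_Normal_Form.Schur_Decomposition"
begin

text \<open>Put \<open>w(d) = (p + 3) d - 2 (p + 1)\<close>, so that \<open>w(1) = - (p - 1)\<close> and the bound on the average
  degree says that the sum of \<open>w(\<chi>(1))\<close> over the irreducible characters of \<open>p'\<close>-degree is negative.
  Suppose that \<open>G\<close> is not \<open>p\<close>-nilpotent, let \<open>P\<close> be a Sylow \<open>p\<close>-subgroup with normalizer \<open>N\<close>, and let
  \<open>R\<close> be the common kernel on \<open>P\<close> of the group \<open>L\<close> of linear characters of \<open>G\<close>. By Tate's theorem some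
  linear character of \<open>P\<close> is nontrivial on \<open>R\<close>, so the set \<open>\<Omega>\<close> of nontrivial restrictions to \<open>R\<close> of
  linear characters of \<open>P\<close> has at least \<open>p - 1\<close> elements.

  Let \<open>\<eta> \<in> \<Omega>\<close> have \<open>N\<close>-orbit of size \<open>h\<close> and stabilizer \<open>T \<supseteq> P\<close>. By transfer, \<open>\<eta>\<close> extends to \<open>T\<close>, and
  multiplying by \<open>L\<close> gives at least \<open>|L| / h\<close> extensions \<open>\<gamma>\<close>. As \<open>|G : T|\<close> is prime to \<open>p\<close>, the
  character induced from \<open>\<gamma>\<close> has an irreducible constituent of \<open>p'\<close>-degree, which is nonlinear because
  \<open>\<gamma>\<close> is nontrivial on \<open>R\<close>. Conversely, an irreducible \<open>\<chi>\<close> of degree \<open>d > 1\<close> lies over at most \<open>d\<close>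
  such \<open>\<gamma>\<close>, and it satisfies \<open>d \<ge> h\<close>, hence \<open>w(d) \<ge> d min(h, p - 1)\<close>, when it lies over one of
  them. Counting pairs shows that the nonlinear part of the sum is at least
  \<open>|L| (\<Sum>\<eta>\<in>\<Omega>. min(1, (p - 1) / h)) \<ge> (p - 1) |L|\<close>, which outweighs the linear part.\<close>

section \<open>Traces and idempotent matrices\<close>

text \<open>For odd \<open>p\<close> the constant is the best possible: the dihedral group of order
  \<open>2 p\<close> is not \<open>p\<close>-nilpotent, has two linear characters and
  \<open>(p - 1) / 2\<close> of degree 2, and so has average exactly
  \<open>2 (p + 1) / (p + 3)\<close>. There \<open>d = h = 2\<close> and \<open>w(d) = d h\<close>,
  so the estimates must not lose anything in that case.

  The obstacle is that \<open>L\<close> may be large, so that one nonlinear character for each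
  element of \<open>\<Omega>\<close> does not balance the linear ones. Twisting by \<open>L\<close>
  supplies the missing factor \<open>|L|\<close>. It identifies members of \<open>L\<close> that
  agree on \<open>T\<close>; the Frattini argument and orthogonality show that at most
  \<open>|N : T| = h\<close> of them agree with a given one. The choice of \<open>R\<close> as a
  common kernel has two effects: twisting leaves \<open>\<eta>\<close> unchanged, and no linear
  character of \<open>G\<close> lies over \<open>\<eta>\<close>.

  Multiplicities are ranks of explicit idempotent matrices. Distinct pairs
  \<open>(\<eta>, \<gamma>)\<close> give orthogonal idempotents even when the groups
  \<open>T\<close> differ, which is why a character of degree \<open>d\<close> lies over at most
  \<open>d\<close> of them.\<close>

lemma mat_trace_eq: "A \<in> carrier_mat n m \<Longrightarrow> mat_trace A = (\<Sum>i<n. A $$ (i, i))"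
  by (auto simp: mat_trace_def)

lemma mat_trace_add:
  "A \<in> carrier_mat n n \<Longrightarrow> B \<in> carrier_mat n n \<Longrightarrow> mat_trace (A + B) = mat_trace A + mat_trace B"
  by (auto simp: mat_trace_def sum.distrib)

lemma mat_trace_minus:
  "A \<in> carrier_mat n n \<Longrightarrow> B \<in> carrier_mat n n \<Longrightarrow> mat_trace (A - B) = mat_trace A - mat_trace B"
  by (auto simp: mat_trace_def sum_subtractf)

lemma mat_trace_one: "mat_trace (1\<^sub>m n) = of_nat n"
  by (simp add: mat_trace_def)

lemma mat_trace_zero: "mat_trace (0\<^sub>m n n) = 0"
  by (simp add: mat_trace_def)

lemma mat_trace_mult_comm:
  assumes A: "A \<in> carrier_mat n m" and B: "B \<in> carrier_mat m n"
  shows "mat_trace (A * B) = mat_trace (B * A)"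
proof -
  have "mat_trace (A * B) = (\<Sum>i<n. \<Sum>j<m. A $$ (i, j) * B $$ (j, i))"
    using A B by (auto simp: mat_trace_def scalar_prod_def lessThan_atLeast0 intro!: sum.cong)
  also have "\<dots> = (\<Sum>j<m. \<Sum>i<n. A $$ (i, j) * B $$ (j, i))"
    by (rule sum.swap)
  also have "\<dots> = mat_trace (B * A)"
    using A B
    by (auto simp: mat_trace_def scalar_prod_def lessThan_atLeast0 mult.commute intro!: sum.cong)
  finally show ?thesis .
qed

text \<open>A Schur form carries the eigenvalues with multiplicity on its diagonal, and similarity
  preserves the trace.\<close>

lemma mat_trace_eigenvalues:
  assumes A: "A \<in> carrier_mat n n"
  obtains es where "length es = n" "mat_trace A = sum_list es"
    "\<And>e. e \<in> set es \<longleftrightarrow> eigenvalue A e"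
proof -
  obtain es where es: "char_poly A = (\<Prod>a\<leftarrow>es. [:- a, 1:])" "length es = n"
    using char_poly_factorized[OF A] by blast
  obtain B P Q where "schur_decomposition A es = (B, P, Q)"
    by (cases "schur_decomposition A es")
  from schur_decomposition[OF A es(1) this]
  have sim: "similar_mat_wit A B P Q" and diag: "diag_mat B = es" by auto
  note D = similar_mat_witD2[OF A sim]
  have "mat_trace A = mat_trace (Q * (P * B))"
    using D mat_trace_mult_comm[of "P * B" n n Q] by simp
  also have "Q * (P * B) = B"
    using D assoc_mult_mat[of Q n n P n B n] by simp
  also have "mat_trace B = sum_list (diag_mat B)"
    using D(5)
    by (simp add: mat_trace_def diag_mat_def interv_sum_list_conv_sum_set_nat lessThan_atLeast0)
  finally have "mat_trace A = sum_list es" using diag by simp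
  moreover have "e \<in> set es \<longleftrightarrow> eigenvalue A e" for e
    unfolding eigenvalue_root_char_poly[OF A] es(1)
    by (simp add: poly_prod_list prod_list_zero_iff image_iff)
  ultimately show ?thesis using that es(2) by blast
qed

lemma eigenvalue_vecE:
  assumes "A \<in> carrier_mat n n" "eigenvalue A e"
  obtains v where "v \<in> carrier_vec n" "v \<noteq> 0\<^sub>v n" "A *\<^sub>v v = e \<cdot>\<^sub>v v"
  using assms unfolding eigenvalue_def eigenvector_def by auto

definition idempotent_mat :: "nat \<Rightarrow> complex mat \<Rightarrow> bool" where
  "idempotent_mat n E \<longleftrightarrow> E \<in> carrier_mat n n \<and> E * E = E"

lemma idempotent_matD: "idempotent_mat n E \<Longrightarrow> E \<in> carrier_mat n n"
  "idempotent_mat n E \<Longrightarrow> E * E = E"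
  by (auto simp: idempotent_mat_def)

lemma minus_idempotent_mat:
  assumes "idempotent_mat n E"
  shows "idempotent_mat n (1\<^sub>m n - E)"
proof -
  have E: "E \<in> carrier_mat n n" "E * E = E" using assms by (auto simp: idempotent_mat_def)
  have "(1\<^sub>m n - E) * (1\<^sub>m n - E) = 1\<^sub>m n * (1\<^sub>m n - E) - E * (1\<^sub>m n - E)"
    by (rule minus_mult_distrib_mat) (use E in auto)
  also have "E * (1\<^sub>m n - E) = E * 1\<^sub>m n - E * E"
    by (rule mult_minus_distrib_mat) (use E in auto)
  also have "\<dots> = 0\<^sub>m n n" using E by simp
  finally have "(1\<^sub>m n - E) * (1\<^sub>m n - E) = 1\<^sub>m n - E" using E by auto
  then show ?thesis using E by (auto simp: idempotent_mat_def)
qed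

text \<open>Eigenvalues of an idempotent are 0 or 1, so the trace counts the ones. A nonzero column
  of \<open>E\<close> is fixed by \<open>E\<close>, which puts 1 among the eigenvalues.\<close>

lemma idempotent_mat_trace_nat:
  assumes "idempotent_mat n E"
  obtains k where "mat_trace E = of_nat k" "E \<noteq> 0\<^sub>m n n \<Longrightarrow> k > 0"
proof -
  have E: "E \<in> carrier_mat n n" "E * E = E" using assms by (auto simp: idempotent_mat_def)
  obtain es where es: "mat_trace E = sum_list es" "\<And>e. e \<in> set es \<longleftrightarrow> eigenvalue E e"
    using mat_trace_eigenvalues[OF E(1)] by metis
  have 01: "e = 0 \<or> e = 1" if "e \<in> set es" for e
  proof -
    have "eigenvalue E e" using es(2) that by simp
    then obtain v where v: "v \<in> carrier_vec n" "v \<noteq> 0\<^sub>v n" "E *\<^sub>v v = e \<cdot>\<^sub>v v"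
      by (rule eigenvalue_vecE[OF E(1)])
    have "e \<cdot>\<^sub>v v = E *\<^sub>v (E *\<^sub>v v)"
      using v E by (metis assoc_mult_mat_vec)
    also have "\<dots> = e \<cdot>\<^sub>v (e \<cdot>\<^sub>v v)"
      using v E by (simp add: mult_mat_vec)
    finally have eq: "e \<cdot>\<^sub>v v = (e * e) \<cdot>\<^sub>v v" by (simp add: smult_smult_assoc)
    obtain i where i: "i < n" "v $ i \<noteq> 0"
      using v by (metis carrier_vecD eq_vecI index_zero_vec)
    have "e * v $ i = (e * e) * v $ i"
      using arg_cong[OF eq, of "\<lambda>u. u $ i"] i v(1) by simp
    then show ?thesis using i by simp
  qed
  define k where "k = length (filter (\<lambda>e. e = 1) es)"
  have "sum_list es = of_nat (length (filter (\<lambda>e. e = 1) es))"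
    using 01 by (induction es) auto
  then have k: "mat_trace E = of_nat k" using es k_def by simp
  moreover have "k > 0" if "E \<noteq> 0\<^sub>m n n"
  proof -
    have "\<exists>i<n. \<exists>j<n. E $$ (i, j) \<noteq> 0"
    proof (rule ccontr)
      assume "\<not> ?thesis"
      then have "E = 0\<^sub>m n n" using E(1) by (intro eq_matI) auto
      with that show False by simp
    qed
    then obtain i j where ij: "i < n" "j < n" "E $$ (i, j) \<noteq> 0" by blast
    define v where "v = col E j"
    have "v $ i \<noteq> 0" using ij E by (simp add: v_def)
    then have "v \<noteq> 0\<^sub>v n" using ij by auto
    moreover have "E *\<^sub>v v = v"
      using col_mult2[OF E(1) E(1) ij(2)] E(2) by (simp add: v_def)
    moreover have "v \<in> carrier_vec n" unfolding v_def by (rule carrier_vecI) (use carrier_matD(1)[OF E(1)] in simp)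
    ultimately have "eigenvector E v 1"
      using E(1) by (simp add: eigenvector_def)
    then have "eigenvalue E 1" unfolding eigenvalue_def by blast
    then have "1 \<in> set es" using es by blast
    then have "filter (\<lambda>e. e = 1) es \<noteq> []" by (auto simp: filter_empty_conv)
    then show ?thesis by (simp add: k_def)
  qed
  ultimately show ?thesis using that by blast
qed

text \<open>The trace serves as the dimension of the image: additivity and invariance under cyclic
  permutation then settle every dimension count.\<close>

definition idempotent_rank :: "complex mat \<Rightarrow> nat" where
  "idempotent_rank E = (THE k. mat_trace E = of_nat k)"

lemma idempotent_rankI: "mat_trace E = of_nat k \<Longrightarrow> idempotent_rank E = k"
  unfolding idempotent_rank_def by (rule the_equality) auto

lemma idempotent_rank:
  assumes "idempotent_mat n E"
  shows "mat_trace E = of_nat (idempotent_rank E)"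
  using idempotent_mat_trace_nat[OF assms] idempotent_rankI by metis

lemma idempotent_rank_pos:
  assumes "idempotent_mat n E" "E \<noteq> 0\<^sub>m n n"
  shows "idempotent_rank E > 0"
  using idempotent_mat_trace_nat[OF assms(1)] idempotent_rankI assms(2) by metis

lemma idempotent_rank_compl:
  assumes "idempotent_mat n E"
  shows "idempotent_rank E + idempotent_rank (1\<^sub>m n - E) = n"
proof -
  have "mat_trace (1\<^sub>m n - E) = of_nat n - mat_trace E"
    using assms by (simp add: mat_trace_minus[of _ n] mat_trace_one idempotent_mat_def)
  then have "(of_nat (idempotent_rank (1\<^sub>m n - E)) :: complex) = of_nat n - of_nat (idempotent_rank E)"
    using idempotent_rank[OF assms] idempotent_rank[OF minus_idempotent_mat[OF assms]] by simp
  then have "(of_nat (idempotent_rank E + idempotent_rank (1\<^sub>m n - E)) :: complex) = of_nat n"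
    by simp
  then show ?thesis by (simp only: of_nat_eq_iff)
qed

lemma idempotent_rank_le: "idempotent_mat n E \<Longrightarrow> idempotent_rank E \<le> n"
  using idempotent_rank_compl by fastforce

text \<open>Dividing a coordinate by a nonzero entry of \<open>u\<close> gives a functional with
  value 1 at \<open>u\<close>. It is written as a row so that column times row is a rank-one
  matrix.\<close>

lemma dual_vector:
  fixes u :: "complex vec"
  assumes "u \<in> carrier_vec n" "u \<noteq> 0\<^sub>v n"
  obtains c where "c \<in> carrier_mat 1 n" "c * mat_of_cols n [u] = 1\<^sub>m 1"
proof -
  obtain i where i: "i < n" "u $ i \<noteq> 0"
    using assms by (metis carrier_vecD eq_vecI index_zero_vec)
  define c where "c = mat 1 n (\<lambda>(_, j). if j = i then 1 / u $ i else 0)"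
  have c: "c \<in> carrier_mat 1 n" by (simp add: c_def)
  have "c * mat_of_cols n [u] = 1\<^sub>m 1"
  proof (rule eq_matI)
    fix a b assume "a < dim_row (1\<^sub>m 1 :: complex mat)" "b < dim_col (1\<^sub>m 1 :: complex mat)"
    then have ab: "a = 0" "b = 0" by auto
    have "(c * mat_of_cols n [u]) $$ (0, 0) = (\<Sum>j\<in>{0..<n}. (if j = i then 1 / u $ i else 0) * u $ j)"
      using assms(1) by (auto simp: scalar_prod_def c_def mat_of_cols_def intro!: sum.cong)
    also have "\<dots> = (\<Sum>j\<in>{0..<n}. if j = i then 1 else 0)"
      by (rule sum.cong) (use i in auto)
    also have "\<dots> = 1" using i by simp
    finally show "(c * mat_of_cols n [u]) $$ (a, b) = 1\<^sub>m 1 $$ (a, b)"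
      using ab by simp
  qed (use c in auto)
  then show ?thesis using that c by blast
qed

section \<open>Finite sums of matrices\<close>

lemma mat_mult_index:
  "A \<in> carrier_mat n k \<Longrightarrow> B \<in> carrier_mat k m \<Longrightarrow> i < n \<Longrightarrow> j < m \<Longrightarrow>
    (A * B) $$ (i, j) = (\<Sum>l<k. A $$ (i, l) * B $$ (l, j))"
  by (auto simp: scalar_prod_def lessThan_atLeast0 intro!: sum.cong)

text \<open>All sizes share the type of matrices, so the dimensions are parameters; the empty sum is
  then the zero matrix of the intended size.\<close>

definition sum_mats :: "nat \<Rightarrow> nat \<Rightarrow> 'b set \<Rightarrow> ('b \<Rightarrow> complex mat) \<Rightarrow> complex mat" where
  "sum_mats n m T F = mat n m (\<lambda>ij. \<Sum>t\<in>T. F t $$ ij)"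

lemma sum_mats_carrier [simp]: "sum_mats n m T F \<in> carrier_mat n m"
  by (simp add: sum_mats_def)

lemma sum_mats_index: "i < n \<Longrightarrow> j < m \<Longrightarrow> sum_mats n m T F $$ (i, j) = (\<Sum>t\<in>T. F t $$ (i, j))"
  by (simp add: sum_mats_def)

lemma sum_mats_cong:
  "(\<And>t. t \<in> T \<Longrightarrow> F t = F' t) \<Longrightarrow> sum_mats n m T F = sum_mats n m T F'"
  by (simp add: sum_mats_def cong: sum.cong)

lemma mult_sum_mats:
  assumes "A \<in> carrier_mat k n" "\<And>t. t \<in> T \<Longrightarrow> F t \<in> carrier_mat n m"
  shows "A * sum_mats n m T F = sum_mats k m T (\<lambda>t. A * F t)"
proof (rule eq_matI)
  fix i j assume "i < dim_row (sum_mats k m T (\<lambda>t. A * F t))"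
    "j < dim_col (sum_mats k m T (\<lambda>t. A * F t))"
  then have ij: "i < k" "j < m" by (auto simp: sum_mats_def)
  have "(A * sum_mats n m T F) $$ (i, j) = (\<Sum>l<n. \<Sum>t\<in>T. A $$ (i, l) * F t $$ (l, j))"
    using ij by (simp add: mat_mult_index[OF assms(1) sum_mats_carrier] sum_mats_index sum_distrib_left)
  also have "\<dots> = (\<Sum>t\<in>T. \<Sum>l<n. A $$ (i, l) * F t $$ (l, j))"
    by (rule sum.swap)
  also have "\<dots> = (\<Sum>t\<in>T. (A * F t) $$ (i, j))"
    by (rule sum.cong) (use mat_mult_index[OF assms(1) assms(2)] ij in auto)
  finally show "(A * sum_mats n m T F) $$ (i, j) = sum_mats k m T (\<lambda>t. A * F t) $$ (i, j)"
    using ij by (simp add: sum_mats_index)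
qed (use assms in \<open>auto simp: sum_mats_def\<close>)

lemma sum_mats_mult:
  assumes "A \<in> carrier_mat m k" "\<And>t. t \<in> T \<Longrightarrow> F t \<in> carrier_mat n m"
  shows "sum_mats n m T F * A = sum_mats n k T (\<lambda>t. F t * A)"
proof (rule eq_matI)
  fix i j assume "i < dim_row (sum_mats n k T (\<lambda>t. F t * A))"
    "j < dim_col (sum_mats n k T (\<lambda>t. F t * A))"
  then have ij: "i < n" "j < k" by (auto simp: sum_mats_def)
  have "(sum_mats n m T F * A) $$ (i, j) = (\<Sum>l<m. \<Sum>t\<in>T. F t $$ (i, l) * A $$ (l, j))"
    using ij by (simp add: mat_mult_index[OF sum_mats_carrier assms(1)] sum_mats_index sum_distrib_right)
  also have "\<dots> = (\<Sum>t\<in>T. \<Sum>l<m. F t $$ (i, l) * A $$ (l, j))"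
    by (rule sum.swap)
  also have "\<dots> = (\<Sum>t\<in>T. (F t * A) $$ (i, j))"
    by (rule sum.cong) (use mat_mult_index[OF assms(2) assms(1)] ij in auto)
  finally show "(sum_mats n m T F * A) $$ (i, j) = sum_mats n k T (\<lambda>t. F t * A) $$ (i, j)"
    using ij by (simp add: sum_mats_index)
qed (use assms in \<open>auto simp: sum_mats_def\<close>)

lemma smult_sum_mats:
  assumes "\<And>t. t \<in> T \<Longrightarrow> F t \<in> carrier_mat n m"
  shows "c \<cdot>\<^sub>m sum_mats n m T F = sum_mats n m T (\<lambda>t. c \<cdot>\<^sub>m F t)"
proof (rule eq_matI)
  fix i j assume "i < dim_row (sum_mats n m T (\<lambda>t. c \<cdot>\<^sub>m F t))"
    "j < dim_col (sum_mats n m T (\<lambda>t. c \<cdot>\<^sub>m F t))"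
  then have ij: "i < n" "j < m" by (auto simp: sum_mats_def)
  then have "\<And>t. t \<in> T \<Longrightarrow> (c \<cdot>\<^sub>m F t) $$ (i, j) = c * F t $$ (i, j)"
    using assms by (metis carrier_matD index_smult_mat(1))
  then show "(c \<cdot>\<^sub>m sum_mats n m T F) $$ (i, j) = sum_mats n m T (\<lambda>t. c \<cdot>\<^sub>m F t) $$ (i, j)"
    using ij by (simp add: sum_mats_def sum_distrib_left)
qed (auto simp: sum_mats_def)

lemma sum_mats_const:
  assumes "finite T" "F \<in> carrier_mat n m"
  shows "sum_mats n m T (\<lambda>t. F) = of_nat (card T) \<cdot>\<^sub>m F"
  by (rule eq_matI) (use assms in \<open>auto simp: sum_mats_def\<close>)

lemma sum_mats_reindex:
  assumes "bij_betw h S T"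
  shows "sum_mats n m T F = sum_mats n m S (\<lambda>s. F (h s))"
  unfolding sum_mats_def using sum.reindex_bij_betw[OF assms, of "\<lambda>t. F t $$ _"]
  by (intro cong_mat) auto

lemma mat_trace_sum_mats:
  assumes "\<And>t. t \<in> T \<Longrightarrow> F t \<in> carrier_mat n n"
  shows "mat_trace (sum_mats n n T F) = (\<Sum>t\<in>T. mat_trace (F t))"
proof -
  have "mat_trace (sum_mats n n T F) = (\<Sum>i<n. \<Sum>t\<in>T. F t $$ (i, i))"
    by (simp add: mat_trace_def sum_mats_def)
  also have "\<dots> = (\<Sum>t\<in>T. \<Sum>i<n. F t $$ (i, i))" by (rule sum.swap)
  also have "\<dots> = (\<Sum>t\<in>T. mat_trace (F t))"
    by (rule sum.cong) (use mat_trace_eq[OF assms] in auto)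
  finally show ?thesis .
qed

lemma mat_trace_smult: "A \<in> carrier_mat n n \<Longrightarrow> mat_trace (c \<cdot>\<^sub>m A) = c * mat_trace A"
  by (auto simp: mat_trace_def sum_distrib_left)

text \<open>An idempotent \<open>F\<close> of maximal rank with image in \<open>W\<close> has image \<open>W\<close>: otherwise some
  \<open>u \<in> W\<close> with \<open>F u = 0\<close> and a functional \<open>c\<close> with \<open>c u = 1\<close> enlarge it to
  \<open>F + u c (1 - F)\<close>.\<close>

lemma exists_projection:
  fixes W :: "complex vec set"
  assumes W: "W \<subseteq> carrier_vec n" "0\<^sub>v n \<in> W"
    and add: "\<And>v w. v \<in> W \<Longrightarrow> w \<in> W \<Longrightarrow> v + w \<in> W"
    and smult: "\<And>c w. w \<in> W \<Longrightarrow> c \<cdot>\<^sub>v w \<in> W"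
  obtains F where "idempotent_mat n F" "\<And>v. v \<in> carrier_vec n \<Longrightarrow> F *\<^sub>v v \<in> W"
    "\<And>w. w \<in> W \<Longrightarrow> F *\<^sub>v w = w"
proof -
  define S where "S = {F. idempotent_mat n F \<and> (\<forall>v \<in> carrier_vec n. F *\<^sub>v v \<in> W)}"
  have "0\<^sub>m n n *\<^sub>v v = 0\<^sub>v n" if "v \<in> carrier_vec n" for v :: "complex vec"
    using that by (intro eq_vecI) (simp_all add: scalar_prod_def)
  then have "0\<^sub>m n n \<in> S"
    using W(2) by (auto simp: S_def idempotent_mat_def)
  moreover have "\<forall>F. F \<in> S \<longrightarrow> idempotent_rank F < Suc n"
    by (auto simp: S_def less_Suc_eq_le idempotent_rank_le)
  ultimately have "\<exists>F. F \<in> S \<and> (\<forall>F'. F' \<in> S \<longrightarrow> idempotent_rank F' \<le> idempotent_rank F)"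
    by (rule ex_has_greatest_nat)
  then obtain F where F: "F \<in> S" "\<And>F'. F' \<in> S \<Longrightarrow> idempotent_rank F' \<le> idempotent_rank F"
    by auto
  have idem: "idempotent_mat n F" and FW: "\<And>v. v \<in> carrier_vec n \<Longrightarrow> F *\<^sub>v v \<in> W"
    using F(1) by (auto simp: S_def)
  note Fc = idempotent_matD[OF idem]
  have "F *\<^sub>v w = w" if w: "w \<in> W" for w
  proof (rule ccontr)
    assume neq: "F *\<^sub>v w \<noteq> w"
    have wc: "w \<in> carrier_vec n" using w W by auto
    have Fw: "F *\<^sub>v w \<in> carrier_vec n" using Fc wc by simp
    define u where "u = w - F *\<^sub>v w"
    have uc: "u \<in> carrier_vec n" using wc Fw by (simp add: u_def)
    have u_alt: "u = w + (-1) \<cdot>\<^sub>v (F *\<^sub>v w)"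
      using wc Fw by (intro eq_vecI) (auto simp: u_def)
    have uW: "u \<in> W" unfolding u_alt using add smult w FW[OF wc] by blast
    have u0: "u \<noteq> 0\<^sub>v n"
    proof
      assume "u = 0\<^sub>v n"
      then have "F *\<^sub>v w = w"
      proof (intro eq_vecI)
        fix i assume i: "i < dim_vec w"
        have "u $ i = 0" using \<open>u = 0\<^sub>v n\<close> i wc by simp
        moreover have "u $ i = w $ i - (F *\<^sub>v w) $ i"
          unfolding u_def
            by (rule index_minus_vec) (use i wc carrier_matD[OF Fc(1)] in simp)
        ultimately show "(F *\<^sub>v w) $ i = w $ i" by simp
      qed (use wc carrier_matD[OF Fc(1)] in simp)
      with neq show False by simp
    qed
    have Fu: "F *\<^sub>v u = 0\<^sub>v n"
    proof -
      have "F *\<^sub>v u = F *\<^sub>v w - F *\<^sub>v (F *\<^sub>v w)"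
        unfolding u_def by (rule mult_minus_distrib_mat_vec) (use Fc wc Fw in auto)
      also have "F *\<^sub>v (F *\<^sub>v w) = F *\<^sub>v w"
        using assoc_mult_mat_vec[OF Fc(1) Fc(1) wc] Fc(2) by simp
      finally show ?thesis using Fw by simp
    qed
    obtain c where c: "c \<in> carrier_mat 1 n" "c * mat_of_cols n [u] = 1\<^sub>m 1"
      using dual_vector[OF uc u0] by blast
    define U where "U = mat_of_cols n [u]"
    have U: "U \<in> carrier_mat n 1" by (simp add: U_def mat_of_cols_def)
    have FU: "F * U = 0\<^sub>m n 1"
    proof (rule eq_matI)
      fix i j assume "i < dim_row (0\<^sub>m n 1 :: complex mat)" "j < dim_col (0\<^sub>m n 1 :: complex mat)"
      then have ij: "i < n" "j = 0" by auto
      have "col U 0 = u" using uc by (simp add: U_def)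
      then have "(F * U) $$ (i, j) = (F *\<^sub>v u) $ i"
        using ij Fc U by simp
      then show "(F * U) $$ (i, j) = 0\<^sub>m n 1 $$ (i, j)" using ij Fu by simp
    qed (use Fc U in auto)
    define d where "d = c * (1\<^sub>m n - F)"
    have d: "d \<in> carrier_mat 1 n"
      unfolding d_def by (rule mult_carrier_mat[OF c(1) minus_carrier_mat[OF Fc(1)]])
    have d_alt: "d = c - c * F"
      unfolding d_def using c Fc by (subst mult_minus_distrib_mat[of _ 1 n]) auto
    have dF: "d * F = 0\<^sub>m 1 n"
      unfolding d_alt using c Fc by (subst minus_mult_distrib_mat[of _ 1 n]) auto
    have dU: "d * U = 1\<^sub>m 1"
    proof -
      have "d * U = c * U - c * F * U"
        unfolding d_alt using c Fc U by (subst minus_mult_distrib_mat[of _ 1 n]) auto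
      also have "c * F * U = 0\<^sub>m 1 1"
        using c Fc U FU by (subst assoc_mult_mat[of _ 1 n _ n _ 1]) auto
      finally show ?thesis using c(2) by (auto simp: U_def)
    qed
    define F' where "F' = F + U * d"
    have Ud: "U * d \<in> carrier_mat n n" using U d by simp
    have F'c: "F' \<in> carrier_mat n n" using Ud by (simp add: F'_def)
    have 1: "F * (U * d) = 0\<^sub>m n n"
      using assoc_mult_mat[OF Fc(1) U d] FU d by simp
    have 2: "U * d * F = 0\<^sub>m n n"
      using assoc_mult_mat[OF U d Fc(1)] dF U by simp
    have 3: "U * d * (U * d) = U * d"
    proof -
      have "U * d * (U * d) = U * (d * (U * d))" using assoc_mult_mat[OF U d Ud] .
      also have "d * (U * d) = d * U * d" using assoc_mult_mat[OF d U d] by simp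
      finally show ?thesis using dU d by simp
    qed
    have "F' * F' = F * (F + U * d) + U * d * (F + U * d)"
      unfolding F'_def by (rule add_mult_distrib_mat[OF Fc(1) Ud F'c[unfolded F'_def]])
    also have "F * (F + U * d) = F * F + F * (U * d)"
      by (rule mult_add_distrib_mat) (use Fc Ud in auto)
    also have "U * d * (F + U * d) = U * d * F + U * d * (U * d)"
      by (rule mult_add_distrib_mat) (use Fc Ud in auto)
    finally have "F' * F' = F'"
      using 1 2 3 Fc Ud by (simp add: F'_def)
    then have idem': "idempotent_mat n F'" using F'c by (simp add: idempotent_mat_def)
    have "F' *\<^sub>v v \<in> W" if v: "v \<in> carrier_vec n" for v
    proof -
      have "F' *\<^sub>v v = F *\<^sub>v v + (U * d) *\<^sub>v v"
        unfolding F'_def by (rule add_mult_distrib_mat_vec) (use Fc Ud v in auto)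
      also have "(U * d) *\<^sub>v v = U *\<^sub>v (d *\<^sub>v v)"
        by (rule assoc_mult_mat_vec) (use U d v in auto)
      also have "U *\<^sub>v (d *\<^sub>v v) = ((d *\<^sub>v v) $ 0) \<cdot>\<^sub>v u"
        using uc d by (intro eq_vecI) (auto simp: U_def scalar_prod_def mat_of_cols_def)
      finally show ?thesis using add smult FW[OF v] uW by auto
    qed
    then have "F' \<in> S" using idem' by (simp add: S_def)
    then have le: "idempotent_rank F' \<le> idempotent_rank F" by (rule F(2))
    have "mat_trace F' = mat_trace F + mat_trace (d * U)"
      unfolding F'_def using mat_trace_add[OF Fc(1) Ud] mat_trace_mult_comm[OF U d] by simp
    also have "\<dots> = of_nat (Suc (idempotent_rank F))"
      using idempotent_rank[OF idem] dU by (simp add: mat_trace_def)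
    finally have "idempotent_rank F' = Suc (idempotent_rank F)" by (rule idempotent_rankI)
    with le show False by simp
  qed
  then show ?thesis using that idem FW by blast
qed

text \<open>The columns of \<open>B\<close> are a basis of the image of \<open>E\<close>, and
  \<open>C\<close> reads off coordinates. By induction on the rank, a rank-one idempotent
  \<open>U d\<close> with \<open>U\<close> a column of \<open>E\<close> is split off, and
  \<open>U\<close> and \<open>d\<close> are appended to the matrices found for
  \<open>E - U d\<close>.\<close>

lemma idempotent_mat_factor:
  assumes "idempotent_mat n E" "idempotent_rank E = k"
  obtains B C where "B \<in> carrier_mat n k" "C \<in> carrier_mat k n" "C * B = 1\<^sub>m k" "B * C = E"
  using assms
proof (induction k arbitrary: E thesis)
  case 0
  then have E: "E = 0\<^sub>m n n" using idempotent_rank_pos by (metis less_irrefl)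
  show ?case
    by (rule "0.prems"(1)[of "0\<^sub>m n 0" "0\<^sub>m 0 n"]) (auto simp: E)
next
  case (Suc k)
  note E = idempotent_matD[OF Suc.prems(2)]
  have "mat_trace E \<noteq> 0" using idempotent_rank[OF Suc.prems(2)] Suc.prems(3)
    by (metis nat.distinct(1) of_nat_eq_0_iff)
  then have "E \<noteq> 0\<^sub>m n n" using mat_trace_zero by auto
  then obtain i j where ij: "i < n" "j < n" "E $$ (i, j) \<noteq> 0"
    using E(1) by (metis carrier_matD eq_matI index_zero_mat(1) index_zero_mat(2) index_zero_mat(3))
  have uc: "col E j \<in> carrier_vec n"
    by (rule carrier_vecI) (use carrier_matD(1)[OF E(1)] in simp)
  have "col E j $ i \<noteq> 0" using ij E(1) by simp
  then have u0: "col E j \<noteq> 0\<^sub>v n" using ij by auto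
  obtain c where c: "c \<in> carrier_mat 1 n" "c * mat_of_cols n [col E j] = 1\<^sub>m 1"
    using dual_vector[OF uc u0] by blast
  define U where "U = mat_of_cols n [col E j]"
  have U: "U \<in> carrier_mat n 1" by (simp add: U_def mat_of_cols_def)
  have EU: "E * U = U"
  proof (rule eq_matI)
    fix a b assume "a < dim_row U" "b < dim_col U"
    then have ab: "a < n" "b = 0" using U by auto
    have Ui: "U $$ (l, 0) = E $$ (l, j)" if "l < n" for l
      using that ij E(1) by (simp add: U_def mat_of_cols_def)
    have "(E * U) $$ (a, b) = (\<Sum>l<n. E $$ (a, l) * U $$ (l, 0))"
      unfolding ab(2) by (rule mat_mult_index[OF E(1) U ab(1)]) simp
    also have "\<dots> = (\<Sum>l<n. E $$ (a, l) * E $$ (l, j))"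
      using Ui by simp
    also have "\<dots> = (E * E) $$ (a, j)"
      by (rule mat_mult_index[OF E(1) E(1) ab(1) ij(2), symmetric])
    also have "\<dots> = U $$ (a, b)" using E(2) ab Ui by simp
    finally show "(E * U) $$ (a, b) = U $$ (a, b)" .
  qed (use E U in auto)
  \<comment> \<open>Passing from \<open>c\<close> to \<open>c E\<close> keeps the value 1 on
    \<open>U\<close>, as \<open>E U = U\<close>, and gives \<open>d E = d\<close>. Hence
    \<open>U d\<close> is absorbed by \<open>E\<close> on both sides and \<open>E - U d\<close> is
    idempotent.\<close>
  define d where "d = c * E"
  have d: "d \<in> carrier_mat 1 n" using c E by (simp add: d_def)
  have dU: "d * U = 1\<^sub>m 1"
    unfolding d_def using assoc_mult_mat[OF c(1) E(1) U] EU c(2) by (simp add: U_def)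
  have dE: "d * E = d"
    unfolding d_def using assoc_mult_mat[OF c(1) E(1) E(1)] E(2) by simp
  have Ud: "U * d \<in> carrier_mat n n" using U d by simp
  have 1: "E * (U * d) = U * d" using assoc_mult_mat[OF E(1) U d] EU by simp
  have 2: "U * d * E = U * d" using assoc_mult_mat[OF U d E(1)] dE by simp
  have 3: "U * d * (U * d) = U * d"
  proof -
    have "U * d * (U * d) = U * (d * (U * d))" using assoc_mult_mat[OF U d Ud] .
    also have "d * (U * d) = d * U * d" using assoc_mult_mat[OF d U d] by simp
    finally show ?thesis using dU d by simp
  qed
  define E1 where "E1 = E - U * d"
  have E1c: "E1 \<in> carrier_mat n n" using minus_carrier_mat[OF Ud] by (simp add: E1_def)
  have "E1 * E1 = E * (E - U * d) - U * d * (E - U * d)"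
    unfolding E1_def by (rule minus_mult_distrib_mat) (use E Ud E1c in \<open>auto simp: E1_def\<close>)
  also have "E * (E - U * d) = E * E - E * (U * d)"
    by (rule mult_minus_distrib_mat) (use E Ud in auto)
  also have "U * d * (E - U * d) = U * d * E - U * d * (U * d)"
    by (rule mult_minus_distrib_mat) (use E Ud in auto)
  finally have "E1 * E1 = E - U * d - (U * d - U * d)"
    unfolding 1 2 3 E(2) .
  also have "\<dots> = E1" using carrier_matD[OF E(1)] carrier_matD[OF Ud]
    by (intro eq_matI) (simp_all add: E1_def del: index_mult_mat(1))
  finally have idem1: "idempotent_mat n E1" using E1c by (simp add: idempotent_mat_def)
  have "mat_trace E1 = mat_trace E - mat_trace (d * U)"
    unfolding E1_def using mat_trace_minus[OF E(1) Ud] mat_trace_mult_comm[OF U d] by simp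
  also have "\<dots> = of_nat k"
    using idempotent_rank[OF Suc.prems(2)] Suc.prems(3) dU by (simp add: mat_trace_def)
  finally have "idempotent_rank E1 = k" by (rule idempotent_rankI)
  then obtain B C where BC: "B \<in> carrier_mat n k" "C \<in> carrier_mat k n" "C * B = 1\<^sub>m k" "B * C = E1"
    using Suc.IH[OF _ idem1] by blast
  have E1U: "E1 * U = 0\<^sub>m n 1"
  proof -
    have "E1 * U = E * U - U * d * U"
      unfolding E1_def by (rule minus_mult_distrib_mat) (use E U Ud in auto)
    also have "U * d * U = U" using assoc_mult_mat[OF U d U] dU U by simp
    finally show ?thesis using EU U by simp
  qed
  have dE1: "d * E1 = 0\<^sub>m 1 n"
  proof -
    have "d * E1 = d * E - d * (U * d)"
      unfolding E1_def by (rule mult_minus_distrib_mat) (use E d Ud in auto)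
    also have "d * (U * d) = d" using assoc_mult_mat[OF d U d] dU d by simp
    finally show ?thesis using dE d by simp
  qed
  \<comment> \<open>Because \<open>C = (C B) C = C E1\<close> and \<open>B = B (C B) = E1 B\<close>,
    the identities \<open>E1 U = 0\<close> and \<open>d E1 = 0\<close> make the appended row and
    column orthogonal to the old ones.\<close>
  have CU: "C * U = 0\<^sub>m k 1"
  proof -
    have "C * U = C * B * (C * U)" using BC U by simp
    also have "\<dots> = C * (B * (C * U))"
      by (rule assoc_mult_mat[OF BC(2) BC(1)]) (use BC U in auto)
    also have "B * (C * U) = B * C * U"
      by (rule assoc_mult_mat[OF BC(1) BC(2) U, symmetric])
    finally show ?thesis using E1U BC by simp
  qed
  have dB: "d * B = 0\<^sub>m 1 k"
  proof -
    have "d * B = d * B * (C * B)" using BC d by simp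
    also have "\<dots> = d * (B * (C * B))"
      by (rule assoc_mult_mat[OF d BC(1)]) (use BC in auto)
    also have "B * (C * B) = B * C * B"
      by (rule assoc_mult_mat[OF BC(1) BC(2) BC(1), symmetric])
    also have "d * (B * C * B) = d * (B * C) * B"
      by (rule assoc_mult_mat[OF d _ BC(1), symmetric]) (use BC E1c in auto)
    finally show ?thesis using dE1 BC by simp
  qed
  define B' where "B' = mat n (Suc k) (\<lambda>(a, b). if b < k then B $$ (a, b) else U $$ (a, 0))"
  define C' where "C' = mat (Suc k) n (\<lambda>(a, b). if a < k then C $$ (a, b) else d $$ (0, b))"
  have B': "B' \<in> carrier_mat n (Suc k)" and C': "C' \<in> carrier_mat (Suc k) n"
    by (auto simp: B'_def C'_def)
  have "C' * B' = 1\<^sub>m (Suc k)"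
  proof (rule eq_matI)
    fix a b assume "a < dim_row (1\<^sub>m (Suc k) :: complex mat)" "b < dim_col (1\<^sub>m (Suc k) :: complex mat)"
    then have ab: "a < Suc k" "b < Suc k" by auto
    have "(C' * B') $$ (a, b) = (\<Sum>l<n. C' $$ (a, l) * B' $$ (l, b))"
      by (rule mat_mult_index[OF C' B' ab])
    also have "\<dots> = (if a < k then if b < k then (C * B) $$ (a, b) else (C * U) $$ (a, 0)
        else if b < k then (d * B) $$ (0, b) else (d * U) $$ (0, 0))"
      using ab mat_mult_index[OF BC(2,1)] mat_mult_index[OF BC(2) U] mat_mult_index[OF d BC(1)]
        mat_mult_index[OF d U] by (simp add: B'_def C'_def)
    also have "\<dots> = 1\<^sub>m (Suc k) $$ (a, b)"
      using ab BC(3) CU dB dU by auto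
    finally show "(C' * B') $$ (a, b) = 1\<^sub>m (Suc k) $$ (a, b)" .
  qed (use B' C' in auto)
  moreover have "B' * C' = E"
  proof (rule eq_matI)
    fix a b assume "a < dim_row E" "b < dim_col E"
    then have ab: "a < n" "b < n" using E by auto
    have "(B' * C') $$ (a, b) = (\<Sum>l<Suc k. B' $$ (a, l) * C' $$ (l, b))"
      by (rule mat_mult_index[OF B' C' ab])
    also have "\<dots> = (\<Sum>l<k. B $$ (a, l) * C $$ (l, b)) + (\<Sum>l<1. U $$ (a, l) * d $$ (l, b))"
      using ab by (simp add: B'_def C'_def)
    also have "\<dots> = E1 $$ (a, b) + (U * d) $$ (a, b)"
      using mat_mult_index[OF BC(1,2) ab] mat_mult_index[OF U d ab] BC(4) by simp
    also have "\<dots> = E $$ (a, b)" 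
      using ab carrier_matD[OF E(1)] carrier_matD[OF Ud] by (simp add: E1_def del: index_mult_mat(1))
    finally show "(B' * C') $$ (a, b) = E $$ (a, b)" .
  qed (use B' C' E in auto)
  ultimately show ?case using Suc.prems(1)[OF B' C'] by blast
qed

section \<open>Representations\<close>

text \<open>Plain matrix identities replace homomorphisms into the general linear group; the inverse
  of \<open>\<rho> g\<close> is \<open>\<rho> (inv g)\<close>.\<close>

definition mat_rep :: "('a, 'b) monoid_scheme \<Rightarrow> nat \<Rightarrow> ('a \<Rightarrow> complex mat) \<Rightarrow> bool" where
  "mat_rep G n \<rho> \<longleftrightarrow> (\<forall>g\<in>carrier G. \<rho> g \<in> carrier_mat n n) \<and>
     (\<forall>g\<in>carrier G. \<forall>h\<in>carrier G. \<rho> (g \<otimes>\<^bsub>G\<^esub> h) = \<rho> g * \<rho> h) \<and> \<rho> \<one>\<^bsub>G\<^esub> = 1\<^sub>m n"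

lemma mat_repD:
  assumes "mat_rep G n \<rho>"
  shows "g \<in> carrier G \<Longrightarrow> \<rho> g \<in> carrier_mat n n"
    and "g \<in> carrier G \<Longrightarrow> h \<in> carrier G \<Longrightarrow> \<rho> (g \<otimes>\<^bsub>G\<^esub> h) = \<rho> g * \<rho> h"
    and "\<rho> \<one>\<^bsub>G\<^esub> = 1\<^sub>m n"
  using assms by (auto simp: mat_rep_def)

lemma general_linear_simps:
  "carrier (general_linear n) = {A \<in> carrier_mat n n. \<exists>B \<in> carrier_mat n n. A * B = 1\<^sub>m n \<and> B * A = 1\<^sub>m n}"
  "(\<otimes>\<^bsub>general_linear n\<^esub>) = (*)" "\<one>\<^bsub>general_linear n\<^esub> = 1\<^sub>m n"
  by (auto simp: general_linear_def units_of_def Units_def ring_mat_def)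

lemma group_general_linear: "group (general_linear n)"
proof -
  interpret ring "ring_mat TYPE(complex) n ()" by (rule ring_mat)
  show ?thesis unfolding general_linear_def by (rule units_group)
qed

context group
begin

lemma is_representation_iff_mat_rep: "is_representation G n \<rho> \<longleftrightarrow> mat_rep G n \<rho>"
proof
  assume "is_representation G n \<rho>"
  then have hom: "\<rho> \<in> hom G (general_linear n)" by (simp add: is_representation_def)
  interpret group_hom G "general_linear n" \<rho>
    using hom group_general_linear by (simp add: group_hom_def group_hom_axioms_def is_group)
  show "mat_rep G n \<rho>"
    using hom hom_one by (auto simp: mat_rep_def hom_def general_linear_simps)
next
  assume R: "mat_rep G n \<rho>"
  have "\<exists>B\<in>carrier_mat n n. \<rho> g * B = 1\<^sub>m n \<and> B * \<rho> g = 1\<^sub>m n" if "g \<in> carrier G" for g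
    by (rule bexI[of _ "\<rho> (inv g)"])
      (use that R mat_repD(2)[OF R, symmetric] mat_repD(1,3)[OF R] in auto)
  then show "is_representation G n \<rho>"
    using R by (auto simp: is_representation_def hom_def general_linear_simps mat_rep_def)
qed

end

definition invariant_subspace ::
  "('a, 'b) monoid_scheme \<Rightarrow> nat \<Rightarrow> ('a \<Rightarrow> complex mat) \<Rightarrow> complex vec set \<Rightarrow> bool" where
  "invariant_subspace G n \<rho> W \<longleftrightarrow> W \<subseteq> carrier_vec n \<and> 0\<^sub>v n \<in> W \<and>
     (\<forall>v\<in>W. \<forall>w\<in>W. v + w \<in> W) \<and> (\<forall>c. \<forall>w\<in>W. c \<cdot>\<^sub>v w \<in> W) \<and>
     (\<forall>g\<in>carrier G. \<forall>w\<in>W. \<rho> g *\<^sub>v w \<in> W)"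

lemma subspace_iff_closed:
  "VectorSpace.subspace class_ring W (module_vec TYPE(complex) n) \<longleftrightarrow>
    W \<subseteq> carrier_vec n \<and> 0\<^sub>v n \<in> W \<and> (\<forall>v\<in>W. \<forall>w\<in>W. v + w \<in> W) \<and> (\<forall>c. \<forall>w\<in>W. c \<cdot>\<^sub>v w \<in> W)"
proof -
  interpret vec_space "TYPE(complex)" n .
  have "VectorSpace.subspace class_ring W (module_vec TYPE(complex) n) \<longleftrightarrow> submodule class_ring W V"
    by (auto simp: subspace_def vectorspace_axioms)
  also have "\<dots> \<longleftrightarrow> W \<subseteq> carrier_vec n \<and> 0\<^sub>v n \<in> W \<and> (\<forall>v\<in>W. \<forall>w\<in>W. v + w \<in> W) \<and> (\<forall>c. \<forall>w\<in>W. c \<cdot>\<^sub>v w \<in> W)"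
    by (auto simp: submodule_def module_vec_simps class_ring_simps module_axioms)
  finally show ?thesis .
qed

lemma (in group) irreducible_iff:
  "is_irreducible_representation G n \<rho> \<longleftrightarrow> mat_rep G n \<rho> \<and> n > 0 \<and>
     (\<forall>W. invariant_subspace G n \<rho> W \<longrightarrow> W = {0\<^sub>v n} \<or> W = carrier_vec n)"
  unfolding is_irreducible_representation_def is_representation_iff_mat_rep subspace_iff_closed
    invariant_subspace_def by blast


section \<open>Complete reducibility\<close>

lemma mat_eqI_mult_vec:
  fixes A B :: "complex mat"
  assumes "A \<in> carrier_mat n m" "B \<in> carrier_mat n m"
    and "\<And>v. v \<in> carrier_vec m \<Longrightarrow> A *\<^sub>v v = B *\<^sub>v v"
  shows "A = B"
proof (rule eq_matI)
  fix i j assume "i < dim_row B" "j < dim_col B"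
  then have ij: "i < n" "j < m" using assms by auto
  have "A $$ (i, j) = (A *\<^sub>v unit_vec m j) $ i" using assms(1) ij by simp
  also have "\<dots> = (B *\<^sub>v unit_vec m j) $ i" by (simp add: assms(3))
  also have "\<dots> = B $$ (i, j)" using assms(2) ij by simp
  finally show "A $$ (i, j) = B $$ (i, j)" .
qed (use assms in auto)

text \<open>Averaging the conjugates \<open>\<rho> g P \<rho> (inv g)\<close> of a projection
  \<open>P\<close> onto \<open>W\<close> makes it commute with the group. All conjugates have the
  trace of \<open>P\<close>, so the average has the same rank, strictly between 0 and
  \<open>n\<close>.\<close>

lemma (in group) maschke:
  assumes fin: "finite (carrier G)" and R: "mat_rep G n \<rho>"
    and W: "invariant_subspace G n \<rho> W" "W \<noteq> {0\<^sub>v n}" "W \<noteq> carrier_vec n"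
  obtains F where "idempotent_mat n F" "\<And>g. g \<in> carrier G \<Longrightarrow> \<rho> g * F = F * \<rho> g"
    "0 < idempotent_rank F" "idempotent_rank F < n"
proof -
  note Rc = mat_repD(1)[OF R] and Rm = mat_repD(2)[OF R] and R1 = mat_repD(3)[OF R]
  have WD: "W \<subseteq> carrier_vec n" "0\<^sub>v n \<in> W" "\<And>v w. v \<in> W \<Longrightarrow> w \<in> W \<Longrightarrow> v + w \<in> W"
    "\<And>c w. w \<in> W \<Longrightarrow> c \<cdot>\<^sub>v w \<in> W" "\<And>g w. g \<in> carrier G \<Longrightarrow> w \<in> W \<Longrightarrow> \<rho> g *\<^sub>v w \<in> W"
    using W(1) by (auto simp: invariant_subspace_def)
  obtain P where P: "idempotent_mat n P" "\<And>v. v \<in> carrier_vec n \<Longrightarrow> P *\<^sub>v v \<in> W"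
    "\<And>w. w \<in> W \<Longrightarrow> P *\<^sub>v w = w"
    using exists_projection[OF WD(1-4)] by metis
  note Pc = idempotent_matD[OF P(1)]
  have PRP: "P * (\<rho> g * P) = \<rho> g * P" if g: "g \<in> carrier G" for g
  proof (rule mat_eqI_mult_vec)
    fix v :: "complex vec" assume v: "v \<in> carrier_vec n"
    have RP: "\<rho> g * P \<in> carrier_mat n n" using Rc[OF g] Pc by simp
    have "(P * (\<rho> g * P)) *\<^sub>v v = P *\<^sub>v ((\<rho> g * P) *\<^sub>v v)"
      by (rule assoc_mult_mat_vec[OF Pc(1) RP v])
    also have "(\<rho> g * P) *\<^sub>v v = \<rho> g *\<^sub>v (P *\<^sub>v v)"
      by (rule assoc_mult_mat_vec[OF Rc[OF g] Pc(1) v])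
    also have "P *\<^sub>v \<dots> = \<rho> g *\<^sub>v (P *\<^sub>v v)"
      by (intro P WD g v)
    also have "\<dots> = (\<rho> g * P) *\<^sub>v v"
      by (rule assoc_mult_mat_vec[OF Rc[OF g] Pc(1) v, symmetric])
    finally show "(P * (\<rho> g * P)) *\<^sub>v v = (\<rho> g * P) *\<^sub>v v" .
  qed (use Rc[OF g] Pc in auto)
  define A where "A g = \<rho> g * P * \<rho> (inv g)" for g
  have Ac: "A g \<in> carrier_mat n n" if "g \<in> carrier G" for g
    unfolding A_def by (intro mult_carrier_mat[of _ n n] Rc Pc inv_closed that)
  define S where "S = sum_mats n n (carrier G) A"
  have Sc: "S \<in> carrier_mat n n" by (simp add: S_def)
  \<comment> \<open>Every conjugate is again a projection onto the invariant space \<open>W\<close>,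
    so \<open>A g\<close> fixes the image of \<open>A h\<close>; this makes the average
    idempotent.\<close>
  have AA: "A g * A h = A h" if g: "g \<in> carrier G" and h: "h \<in> carrier G" for g h
  proof -
    have c: "\<rho> g * P \<in> carrier_mat n n" "\<rho> h * P \<in> carrier_mat n n" "\<rho> (inv g) \<in> carrier_mat n n"
      "\<rho> (inv h) \<in> carrier_mat n n" "\<rho> g \<in> carrier_mat n n" "\<rho> h \<in> carrier_mat n n"
      using Rc g h Pc by (simp_all add: mult_carrier_mat[of _ n n _ n])
    have gh: "inv g \<otimes> h \<in> carrier G" using g h by simp
    have "\<rho> (inv g) * (\<rho> h * P) = \<rho> (inv g \<otimes> h) * P"
      using assoc_mult_mat[OF c(3,6) Pc(1)] Rm[of "inv g" h] g h by simp
    then have "\<rho> g * P * \<rho> (inv g) * (\<rho> h * P) = \<rho> g * P * (\<rho> (inv g \<otimes> h) * P)"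
      using assoc_mult_mat[OF c(1,3,2)] by simp
    also have "\<dots> = \<rho> g * (P * (\<rho> (inv g \<otimes> h) * P))"
      by (rule assoc_mult_mat[OF c(5) Pc(1) mult_carrier_mat[OF Rc[OF gh] Pc(1)]])
    also have "\<dots> = \<rho> g * (\<rho> (inv g \<otimes> h) * P)" using PRP[OF gh] by simp
    also have "\<dots> = \<rho> g * \<rho> (inv g \<otimes> h) * P"
      by (rule assoc_mult_mat[OF c(5) Rc[OF gh] Pc(1), symmetric])
    also have "\<rho> g * \<rho> (inv g \<otimes> h) = \<rho> h"
      using Rm[OF g gh] g h by (simp add: m_assoc[symmetric])
    finally have "\<rho> g * P * \<rho> (inv g) * (\<rho> h * P) = \<rho> h * P" .
    then show ?thesis
      unfolding A_def using assoc_mult_mat[OF _ c(2,4), of "\<rho> g * P * \<rho> (inv g)" n] c by simp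
  qed
  have AS: "A g * S = S" if g: "g \<in> carrier G" for g
  proof -
    have "A g * S = sum_mats n n (carrier G) (\<lambda>h. A g * A h)"
      unfolding S_def by (rule mult_sum_mats[OF Ac[OF g] Ac])
    also have "\<dots> = S" unfolding S_def by (rule sum_mats_cong) (rule AA[OF g])
    finally show ?thesis .
  qed
  have SS: "S * S = of_nat (card (carrier G)) \<cdot>\<^sub>m S"
  proof -
    have "S * S = sum_mats n n (carrier G) (\<lambda>g. A g * S)"
      using sum_mats_mult[OF Sc Ac] by (simp add: S_def)
    also have "\<dots> = sum_mats n n (carrier G) (\<lambda>g. S)"
      by (rule sum_mats_cong) (rule AS)
    also have "\<dots> = of_nat (card (carrier G)) \<cdot>\<^sub>m S"
      by (rule sum_mats_const[OF fin Sc])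
    finally show ?thesis .
  qed
  have N0: "(of_nat (card (carrier G)) :: complex) \<noteq> 0"
    using fin one_closed by auto
  have comm: "\<rho> x * S = S * \<rho> x" if x: "x \<in> carrier G" for x
  proof -
    have bij: "bij_betw (\<lambda>g. x \<otimes> g) (carrier G) (carrier G)"
      by (rule bij_betwI[of _ _ _ "\<lambda>g. inv x \<otimes> g"]) (use x in \<open>auto simp: m_assoc[symmetric]\<close>)
    have "S * \<rho> x = sum_mats n n (carrier G) (\<lambda>g. A g * \<rho> x)"
      unfolding S_def by (rule sum_mats_mult[OF Rc[OF x] Ac])
    also have "\<dots> = sum_mats n n (carrier G) (\<lambda>g. A (x \<otimes> g) * \<rho> x)"
      by (rule sum_mats_reindex[OF bij])
    also have "\<dots> = sum_mats n n (carrier G) (\<lambda>g. \<rho> x * A g)"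
    proof (rule sum_mats_cong)
      fix g assume g: "g \<in> carrier G"
      have c: "\<rho> (x \<otimes> g) * P \<in> carrier_mat n n" "\<rho> (inv (x \<otimes> g)) \<in> carrier_mat n n"
        "\<rho> g * P \<in> carrier_mat n n" "\<rho> (inv g) \<in> carrier_mat n n"
        using Rc g x Pc by (simp_all add: mult_carrier_mat[of _ n n _ n])
      have "A (x \<otimes> g) * \<rho> x = \<rho> (x \<otimes> g) * P * (\<rho> (inv (x \<otimes> g)) * \<rho> x)"
        unfolding A_def by (rule assoc_mult_mat[OF c(1,2) Rc[OF x]])
      also have "\<rho> (inv (x \<otimes> g)) * \<rho> x = \<rho> (inv g)"
        using g x by (simp add: Rm[symmetric] inv_mult_group m_assoc)
      also have "\<rho> (x \<otimes> g) * P = \<rho> x * (\<rho> g * P)"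
        using Rm[OF x g] assoc_mult_mat[OF Rc[OF x] Rc[OF g] Pc(1)] by simp
      also have "\<rho> x * (\<rho> g * P) * \<rho> (inv g) = \<rho> x * A g"
        unfolding A_def by (rule assoc_mult_mat[OF Rc[OF x] c(3,4)])
      finally show "A (x \<otimes> g) * \<rho> x = \<rho> x * A g" .
    qed
    also have "\<dots> = \<rho> x * S"
      unfolding S_def by (rule mult_sum_mats[OF Rc[OF x] Ac, symmetric])
    finally show ?thesis by simp
  qed
  define F where "F = (1 / of_nat (card (carrier G))) \<cdot>\<^sub>m S"
  have Fc: "F \<in> carrier_mat n n" using Sc by (simp add: F_def)
  have "F * F = (1 / of_nat (card (carrier G))) \<cdot>\<^sub>m ((1 / of_nat (card (carrier G))) \<cdot>\<^sub>m (S * S))"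
    unfolding F_def using Sc
    by (simp add: mult_smult_distrib[of _ n n _ n] mult_smult_assoc_mat[of _ n n _ n])
  also have "\<dots> = F"
    using N0 Sc by (intro eq_matI) (auto simp: SS F_def)
  finally have idem: "idempotent_mat n F" using Fc by (simp add: idempotent_mat_def)
  have comm': "\<rho> g * F = F * \<rho> g" if g: "g \<in> carrier G" for g
    unfolding F_def
    using comm[OF g] mult_smult_distrib[OF Rc[OF g] Sc] mult_smult_assoc_mat[OF Sc Rc[OF g]] by simp
  have tA: "mat_trace (A g) = mat_trace P" if g: "g \<in> carrier G" for g
  proof -
    have "mat_trace (A g) = mat_trace (\<rho> (inv g) * (\<rho> g * P))"
      unfolding A_def
      by (rule mat_trace_mult_comm[OF mult_carrier_mat[OF Rc[OF g] Pc(1)]]) (use Rc g in simp)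
    also have "\<rho> (inv g) * (\<rho> g * P) = \<rho> (inv g) * \<rho> g * P"
      by (rule assoc_mult_mat[OF Rc Rc Pc(1), symmetric]) (use g in auto)
    also have "\<rho> (inv g) * \<rho> g = 1\<^sub>m n" using g by (simp add: Rm[symmetric] R1)
    finally show ?thesis using Pc by simp
  qed
  have "mat_trace S = of_nat (card (carrier G)) * mat_trace P"
    unfolding S_def using tA by (simp add: mat_trace_sum_mats[OF Ac])
  then have "mat_trace F = mat_trace P"
    unfolding F_def mat_trace_smult[OF Sc] using N0 by simp
  then have rank: "idempotent_rank F = idempotent_rank P" by (simp add: idempotent_rank_def)
  obtain w where w: "w \<in> W" "w \<noteq> 0\<^sub>v n" using W(2) WD(2) by auto
  have "P \<noteq> 0\<^sub>m n n"
  proof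
    assume "P = 0\<^sub>m n n"
    moreover have "0\<^sub>m n n *\<^sub>v w = 0\<^sub>v n"
      using w(1) WD(1) by (intro eq_vecI) (auto simp: scalar_prod_def)
    ultimately show False using P(3)[OF w(1)] w(2) by simp
  qed
  then have pos: "0 < idempotent_rank P" by (rule idempotent_rank_pos[OF P(1)])
  obtain v where v: "v \<in> carrier_vec n" "v \<notin> W" using W(3) WD(1) by auto
  have "1\<^sub>m n - P \<noteq> 0\<^sub>m n n"
  proof
    assume eq: "1\<^sub>m n - P = 0\<^sub>m n n"
    have "P *\<^sub>v v = 1\<^sub>m n *\<^sub>v v - (1\<^sub>m n - P) *\<^sub>v v"
      using v(1) Pc(1) by (subst minus_mult_distrib_mat_vec[of _ n n]) auto
    also have "(1\<^sub>m n - P) *\<^sub>v v = 0\<^sub>v n"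
      unfolding eq using v(1) by (intro eq_vecI) (auto simp: scalar_prod_def)
    finally have "P *\<^sub>v v = v" using v(1) by simp
    then show False using P(2)[OF v(1)] v(2) by simp
  qed
  then have "0 < idempotent_rank (1\<^sub>m n - P)"
    by (rule idempotent_rank_pos[OF minus_idempotent_mat[OF P(1)]])
  then have "idempotent_rank P < n" using idempotent_rank_compl[OF P(1)] by simp
  with pos rank that[OF idem comm'] show ?thesis by simp
qed

text \<open>\<open>G\<close> supplies the multiplication and \<open>H\<close> the domain, so the
  characters of all subgroups live in one type. Extensionality makes characters that agree on
  \<open>H\<close> equal, as counting requires.\<close>

definition lin_chars :: "('a, 'b) monoid_scheme \<Rightarrow> 'a set \<Rightarrow> ('a \<Rightarrow> complex) set" where
  "lin_chars G H = {\<gamma> \<in> extensional H. (\<forall>x\<in>H. \<gamma> x \<noteq> 0) \<and>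
     (\<forall>x\<in>H. \<forall>y\<in>H. \<gamma> (x \<otimes>\<^bsub>G\<^esub> y) = \<gamma> x * \<gamma> y)}"

text \<open>For a representation \<open>\<rho>\<close> and a linear character
  \<open>\<gamma>\<close> of a subgroup \<open>T\<close>, this is the projection onto the vectors on
  which \<open>T\<close> acts through \<open>\<gamma>\<close>.\<close>

definition char_proj ::
  "'a set \<Rightarrow> ('a \<Rightarrow> complex) \<Rightarrow> nat \<Rightarrow> ('a \<Rightarrow> complex mat) \<Rightarrow> complex mat" where
  "char_proj T \<gamma> n \<rho> = (1 / of_nat (card T)) \<cdot>\<^sub>m sum_mats n n T (\<lambda>t. inverse (\<gamma> t) \<cdot>\<^sub>m \<rho> t)"

lemma char_proj_carrier [simp]: "char_proj T \<gamma> n \<rho> \<in> carrier_mat n n"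
  by (simp add: char_proj_def)

lemma mult_char_proj:
  assumes "\<And>t. t \<in> T \<Longrightarrow> \<rho> t \<in> carrier_mat n n" "A \<in> carrier_mat k n"
  shows "A * char_proj T \<gamma> n \<rho> =
    (1 / of_nat (card T)) \<cdot>\<^sub>m sum_mats k n T (\<lambda>t. inverse (\<gamma> t) \<cdot>\<^sub>m (A * \<rho> t))"
proof -
  have "A * char_proj T \<gamma> n \<rho> = (1 / of_nat (card T)) \<cdot>\<^sub>m (A * sum_mats n n T (\<lambda>t. inverse (\<gamma> t) \<cdot>\<^sub>m \<rho> t))"
    unfolding char_proj_def by (rule mult_smult_distrib[OF assms(2) sum_mats_carrier])
  also have "A * sum_mats n n T (\<lambda>t. inverse (\<gamma> t) \<cdot>\<^sub>m \<rho> t) = sum_mats k n T (\<lambda>t. A * (inverse (\<gamma> t) \<cdot>\<^sub>m \<rho> t))"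
    by (rule mult_sum_mats[OF assms(2)]) (use assms(1) in simp)
  also have "\<dots> = sum_mats k n T (\<lambda>t. inverse (\<gamma> t) \<cdot>\<^sub>m (A * \<rho> t))"
    by (rule sum_mats_cong) (rule mult_smult_distrib[OF assms(2,1)])
  finally show ?thesis .
qed

lemma char_proj_mult:
  assumes "\<And>t. t \<in> T \<Longrightarrow> \<rho> t \<in> carrier_mat n n" "A \<in> carrier_mat n k"
  shows "char_proj T \<gamma> n \<rho> * A =
    (1 / of_nat (card T)) \<cdot>\<^sub>m sum_mats n k T (\<lambda>t. inverse (\<gamma> t) \<cdot>\<^sub>m (\<rho> t * A))"
proof -
  have "char_proj T \<gamma> n \<rho> * A = (1 / of_nat (card T)) \<cdot>\<^sub>m (sum_mats n n T (\<lambda>t. inverse (\<gamma> t) \<cdot>\<^sub>m \<rho> t) * A)"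
    unfolding char_proj_def by (rule mult_smult_assoc_mat[OF sum_mats_carrier assms(2)])
  also have "sum_mats n n T (\<lambda>t. inverse (\<gamma> t) \<cdot>\<^sub>m \<rho> t) * A = sum_mats n k T (\<lambda>t. inverse (\<gamma> t) \<cdot>\<^sub>m \<rho> t * A)"
    by (rule sum_mats_mult[OF assms(2)]) (use assms(1) in simp)
  also have "\<dots> = sum_mats n k T (\<lambda>t. inverse (\<gamma> t) \<cdot>\<^sub>m (\<rho> t * A))"
    by (rule sum_mats_cong) (rule mult_smult_assoc_mat[OF assms(1,2)])
  finally show ?thesis .
qed

section \<open>Passing to an invariant summand\<close>

lemma char_proj_compress:
  assumes \<rho>: "\<And>t. t \<in> T \<Longrightarrow> \<rho> t \<in> carrier_mat n n"
    and B: "B \<in> carrier_mat n k" and C: "C \<in> carrier_mat k n"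
  shows "char_proj T \<gamma> k (\<lambda>g. C * \<rho> g * B) = C * char_proj T \<gamma> n \<rho> * B"
proof -
  have Cr: "C * \<rho> t \<in> carrier_mat k n" if "t \<in> T" for t
    by (rule mult_carrier_mat[OF C \<rho>[OF that]])
  have "C * char_proj T \<gamma> n \<rho> * B =
      (1 / of_nat (card T)) \<cdot>\<^sub>m sum_mats k n T (\<lambda>t. inverse (\<gamma> t) \<cdot>\<^sub>m (C * \<rho> t)) * B"
    using mult_char_proj[of T \<rho> n C k \<gamma>] \<rho> C by simp
  also have "\<dots> = (1 / of_nat (card T)) \<cdot>\<^sub>m (sum_mats k n T (\<lambda>t. inverse (\<gamma> t) \<cdot>\<^sub>m (C * \<rho> t)) * B)"
    by (rule mult_smult_assoc_mat[OF sum_mats_carrier B])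
  also have "sum_mats k n T (\<lambda>t. inverse (\<gamma> t) \<cdot>\<^sub>m (C * \<rho> t)) * B =
      sum_mats k k T (\<lambda>t. inverse (\<gamma> t) \<cdot>\<^sub>m (C * \<rho> t) * B)"
    by (rule sum_mats_mult[OF B]) (use Cr in simp)
  also have "\<dots> = sum_mats k k T (\<lambda>t. inverse (\<gamma> t) \<cdot>\<^sub>m (C * \<rho> t * B))"
    by (rule sum_mats_cong) (rule mult_smult_assoc_mat[OF Cr B])
  finally show ?thesis by (simp add: char_proj_def)
qed

text \<open>The map \<open>M \<mapsto> C M B\<close> restricts to the image of \<open>B C\<close>.
  It is multiplicative when the second factor commutes with \<open>B C\<close>: then
  \<open>N\<close> preserves that image, and \<open>B C\<close> can be moved past \<open>N\<close>
  onto \<open>B\<close>, where it acts as the identity.\<close>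

lemma compress_mult:
  fixes M N B C :: "complex mat"
  assumes M: "M \<in> carrier_mat n n" and N: "N \<in> carrier_mat n n"
    and B: "B \<in> carrier_mat n k" and C: "C \<in> carrier_mat k n"
    and CB: "C * B = 1\<^sub>m k" and comm: "N * (B * C) = (B * C) * N"
  shows "(C * M * B) * (C * N * B) = C * (M * N) * B"
proof -
  have BC: "B * C \<in> carrier_mat n n" using B C by simp
  have FB: "B * C * B = B" using assoc_mult_mat[OF B C B] CB B by simp
  have c: "C * M \<in> carrier_mat k n" "C * N * B \<in> carrier_mat k k" "N * B \<in> carrier_mat n k"
    using M N B C by (auto intro!: mult_carrier_mat[of _ _ n])
  have "B * (C * N * B) = B * (C * (N * B))" using assoc_mult_mat[OF C N B] by simp
  also have "\<dots> = B * C * (N * B)" by (rule assoc_mult_mat[OF B C c(3), symmetric])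
  also have "\<dots> = B * C * N * B" by (rule assoc_mult_mat[OF BC N B, symmetric])
  also have "\<dots> = N * (B * C) * B" using comm by simp
  also have "\<dots> = N * (B * C * B)" by (rule assoc_mult_mat[OF N BC B])
  finally have 1: "B * (C * N * B) = N * B" using FB by simp
  have "(C * M * B) * (C * N * B) = C * M * (B * (C * N * B))"
    by (rule assoc_mult_mat[OF c(1) B c(2)])
  also have "\<dots> = C * M * (N * B)" using 1 by simp
  also have "\<dots> = C * M * N * B" by (rule assoc_mult_mat[OF c(1) N B, symmetric])
  also have "C * M * N = C * (M * N)" by (rule assoc_mult_mat[OF C M N])
  finally show ?thesis .
qed

text \<open>For a representation, the vectors \<open>w\<close> with all \<open>E \<rho> g w\<close>
  zero form the largest invariant subspace inside the kernel of \<open>E\<close>, so the condition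
  says that \<open>E\<close> kills no nonzero invariant subspace. It plays the role of Frobenius
  reciprocity and passes to summands. Vectors are one-column matrices, so that one associative law
  covers all products.\<close>

definition generating ::
  "('a, 'b) monoid_scheme \<Rightarrow> nat \<Rightarrow> ('a \<Rightarrow> complex mat) \<Rightarrow> complex mat \<Rightarrow> bool" where
  "generating G n \<rho> E \<longleftrightarrow> (\<forall>w\<in>carrier_mat n 1.
     (\<forall>g\<in>carrier G. E * \<rho> g * w = 0\<^sub>m n 1) \<longrightarrow> w = 0\<^sub>m n 1)"

context group
begin

text \<open>An idempotent commuting with \<open>\<rho>\<close> has an invariant image, on which
  \<open>B\<close> and \<open>C\<close> with \<open>B C = F\<close> are coordinates. The projection
  for \<open>\<gamma>\<close> is a combination of matrices \<open>\<rho> t\<close> and commutes with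
  \<open>F\<close>, so what its compression kills in the image is killed by the projection
  itself.\<close>

lemma mat_rep_compress:
  assumes R: "mat_rep G n \<rho>" and F: "idempotent_mat n F"
    and comm: "\<And>g. g \<in> carrier G \<Longrightarrow> \<rho> g * F = F * \<rho> g"
    and T: "T \<subseteq> carrier G" and gen: "generating G n \<rho> (char_proj T \<gamma> n \<rho>)"
  obtains \<rho>' where "mat_rep G (idempotent_rank F) \<rho>'"
    "generating G (idempotent_rank F) \<rho>' (char_proj T \<gamma> (idempotent_rank F) \<rho>')"
proof -
  define k where "k = idempotent_rank F"
  obtain B C where B: "B \<in> carrier_mat n k" and C: "C \<in> carrier_mat k n"
    and CB: "C * B = 1\<^sub>m k" and BC: "B * C = F"
    using idempotent_mat_factor[OF F k_def[symmetric]] by metis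
  note Rc = mat_repD(1)[OF R]
  note Fc = idempotent_matD[OF F]
  define \<rho>' where "\<rho>' = (\<lambda>g. C * \<rho> g * B)"
  define E where "E = char_proj T \<gamma> n \<rho>"
  have Ec: "E \<in> carrier_mat n n" by (simp add: E_def)
  have E': "char_proj T \<gamma> k \<rho>' = C * E * B"
    unfolding \<rho>'_def E_def by (rule char_proj_compress[OF Rc B C]) (use T in auto)
  have FE: "F * E = E * F"
  proof -
    have Rc': "\<rho> t \<in> carrier_mat n n" if "t \<in> T" for t using Rc T that by blast
    have "sum_mats n n T (\<lambda>t. inverse (\<gamma> t) \<cdot>\<^sub>m (F * \<rho> t)) =
        sum_mats n n T (\<lambda>t. inverse (\<gamma> t) \<cdot>\<^sub>m (\<rho> t * F))"
      by (rule sum_mats_cong) (use comm T in auto)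
    then show ?thesis
      unfolding E_def using mult_char_proj[of T \<rho> n F n \<gamma>] char_proj_mult[of T \<rho> n F n \<gamma>]
        Rc' Fc(1) by simp
  qed
  have R': "mat_rep G k \<rho>'"
    unfolding mat_rep_def
  proof (intro conjI ballI)
    fix g assume g: "g \<in> carrier G"
    show "\<rho>' g \<in> carrier_mat k k"
      unfolding \<rho>'_def by (rule mult_carrier_mat[OF mult_carrier_mat[OF C Rc[OF g]] B])
    fix h assume h: "h \<in> carrier G"
    show "\<rho>' (g \<otimes> h) = \<rho>' g * \<rho>' h"
      unfolding \<rho>'_def mat_repD(2)[OF R g h]
      by (rule compress_mult[OF Rc[OF g] Rc[OF h] B C CB, symmetric]) (use comm[OF h] BC in simp)
  next
    show "\<rho>' \<one> = 1\<^sub>m k"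
      unfolding \<rho>'_def mat_repD(3)[OF R] using C CB by simp
  qed
  have "generating G k \<rho>' (C * E * B)"
    unfolding generating_def
  proof (intro ballI impI)
    fix w :: "complex mat" assume w: "w \<in> carrier_mat k 1"
      and 0: "\<forall>g\<in>carrier G. C * E * B * \<rho>' g * w = 0\<^sub>m k 1"
    define z where "z = B * w"
    have z: "z \<in> carrier_mat n 1" using B w by (simp add: z_def)
    have Fz: "F * z = z"
    proof -
      have "F * z = F * B * w" unfolding z_def by (rule assoc_mult_mat[OF Fc(1) B w, symmetric])
      also have "F * B = B" unfolding BC[symmetric] using assoc_mult_mat[OF B C B] CB B by simp
      finally show ?thesis by (simp add: z_def)
    qed
    have "E * \<rho> g * z = 0\<^sub>m n 1" if g: "g \<in> carrier G" for g
    proof -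
      have Er: "E * \<rho> g \<in> carrier_mat n n" by (rule mult_carrier_mat[OF Ec Rc[OF g]])
      have "C * E * B * \<rho>' g = C * (E * \<rho> g) * B"
        unfolding \<rho>'_def
        by (rule compress_mult[OF Ec Rc[OF g] B C CB]) (use comm[OF g] BC in simp)
      then have "C * (E * \<rho> g) * B * w = 0\<^sub>m k 1" using 0 g by metis
      moreover have "C * (E * \<rho> g) * B * w = C * (E * \<rho> g) * z"
        unfolding z_def by (rule assoc_mult_mat[OF mult_carrier_mat[OF C Er] B w])
      moreover have "\<dots> = C * (E * \<rho> g * z)" by (rule assoc_mult_mat[OF C Er z])
      ultimately have "C * (E * \<rho> g * z) = 0\<^sub>m k 1" by simp
      then have "B * (C * (E * \<rho> g * z)) = 0\<^sub>m n 1" using B by simp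
      moreover have "B * (C * (E * \<rho> g * z)) = F * (E * \<rho> g * z)"
        unfolding BC[symmetric] by (rule assoc_mult_mat[OF B C mult_carrier_mat[OF Er z], symmetric])
      moreover have "F * (E * \<rho> g * z) = F * (E * \<rho> g) * z"
        by (rule assoc_mult_mat[OF Fc(1) Er z, symmetric])
      moreover have "F * (E * \<rho> g) = E * \<rho> g * F"
      proof -
        have "F * (E * \<rho> g) = F * E * \<rho> g" by (rule assoc_mult_mat[OF Fc(1) Ec Rc[OF g], symmetric])
        also have "\<dots> = E * (F * \<rho> g)" unfolding FE by (rule assoc_mult_mat[OF Ec Fc(1) Rc[OF g]])
        also have "\<dots> = E * (\<rho> g * F)" using comm[OF g] by simp
        also have "\<dots> = E * \<rho> g * F" by (rule assoc_mult_mat[OF Ec Rc[OF g] Fc(1), symmetric])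
        finally show ?thesis .
      qed
      moreover have "E * \<rho> g * F * z = E * \<rho> g * (F * z)" by (rule assoc_mult_mat[OF Er Fc(1) z])
      ultimately show ?thesis using Fz by simp
    qed
    then have "z = 0\<^sub>m n 1" using gen z unfolding generating_def E_def by blast
    moreover have "C * z = w"
      unfolding z_def using assoc_mult_mat[OF C B w] CB w by simp
    ultimately show "w = 0\<^sub>m k 1" using C by simp
  qed
  then show ?thesis using that R' unfolding E'[symmetric] k_def by blast
qed

text \<open>Maschke splits a reducible representation into two summands, at least one of degree not
  divisible by \<open>p\<close>, and the generating property passes to it. At the irreducible end
  that property forces the projection to be nonzero.\<close>

lemma exists_irreducible_constituent:
  assumes fin: "finite (carrier G)" and T: "T \<subseteq> carrier G"
    and "mat_rep G n \<rho>" "generating G n \<rho> (char_proj T \<gamma> n \<rho>)" "\<not> p dvd n"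
  obtains k \<rho>' where "is_irreducible_representation G k \<rho>'" "\<not> p dvd k"
    "char_proj T \<gamma> k \<rho>' \<noteq> 0\<^sub>m k k"
  using assms(3-)
proof (induction n arbitrary: \<rho> thesis rule: less_induct)
  case (less n)
  have n: "n > 0" using less.prems(4) by (metis dvd_0_right gr0I)
  show ?case
  proof (cases "is_irreducible_representation G n \<rho>")
    case True
    have "char_proj T \<gamma> n \<rho> \<noteq> 0\<^sub>m n n"
    proof
      assume E: "char_proj T \<gamma> n \<rho> = 0\<^sub>m n n"
      define w :: "complex mat" where "w = mat n 1 (\<lambda>_. 1)"
      have w: "w \<in> carrier_mat n 1" by (simp add: w_def)
      have "char_proj T \<gamma> n \<rho> * \<rho> g * w = 0\<^sub>m n 1" if "g \<in> carrier G" for g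
        using mat_repD(1)[OF less.prems(2) that] w by (simp add: E)
      then have "w = 0\<^sub>m n 1" using less.prems(3) w unfolding generating_def by blast
      then have "w $$ (0, 0) = 0" using n by simp
      then show False using n by (simp add: w_def)
    qed
    with True less.prems show ?thesis by blast
  next
    case False
    then obtain W where W: "invariant_subspace G n \<rho> W" "W \<noteq> {0\<^sub>v n}" "W \<noteq> carrier_vec n"
      using n less.prems(2) by (auto simp: irreducible_iff)
    obtain F where F: "idempotent_mat n F" "\<And>g. g \<in> carrier G \<Longrightarrow> \<rho> g * F = F * \<rho> g"
      "0 < idempotent_rank F" "idempotent_rank F < n"
      using maschke[OF fin less.prems(2) W] by metis
    note Fc = idempotent_matD[OF F(1)]
    have comm: "\<rho> g * (1\<^sub>m n - F) = (1\<^sub>m n - F) * \<rho> g" if g: "g \<in> carrier G" for g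
    proof -
      note r = mat_repD(1)[OF less.prems(2) g]
      have "\<rho> g * (1\<^sub>m n - F) = \<rho> g * 1\<^sub>m n - \<rho> g * F"
        by (rule mult_minus_distrib_mat[OF r one_carrier_mat Fc(1)])
      also have "\<dots> = 1\<^sub>m n * \<rho> g - F * \<rho> g" using F(2)[OF g] r by simp
      also have "\<dots> = (1\<^sub>m n - F) * \<rho> g"
        by (rule minus_mult_distrib_mat[OF one_carrier_mat Fc(1) r, symmetric])
      finally show ?thesis .
    qed
    have "\<exists>F'. idempotent_mat n F' \<and> (\<forall>g\<in>carrier G. \<rho> g * F' = F' * \<rho> g) \<and>
        idempotent_rank F' < n \<and> \<not> p dvd idempotent_rank F'"
    proof (cases "p dvd idempotent_rank F")
      case True
      note compl = idempotent_rank_compl[OF F(1)]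
      have "\<not> p dvd idempotent_rank (1\<^sub>m n - F)"
        using True less.prems(4) compl by (metis dvd_add)
      moreover have "idempotent_rank (1\<^sub>m n - F) < n" using compl F(3) by simp
      ultimately show ?thesis using comm minus_idempotent_mat[OF F(1)] by blast
    qed (use F in blast)
    then obtain F' where F': "idempotent_mat n F'" "\<And>g. g \<in> carrier G \<Longrightarrow> \<rho> g * F' = F' * \<rho> g"
      "idempotent_rank F' < n" "\<not> p dvd idempotent_rank F'" by blast
    obtain \<rho>' where "mat_rep G (idempotent_rank F') \<rho>'"
      "generating G (idempotent_rank F') \<rho>' (char_proj T \<gamma> (idempotent_rank F') \<rho>')"
      using mat_rep_compress[OF less.prems(2) F'(1,2) T less.prems(3)] by metis
    then show ?thesis using less.IH[OF F'(3)] less.prems(1) F'(4) by blast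
  qed
qed

end

section \<open>Linear characters and the induced representation\<close>

lemma lin_charsD:
  assumes "\<gamma> \<in> lin_chars G H"
  shows "x \<in> H \<Longrightarrow> \<gamma> x \<noteq> 0" "x \<in> H \<Longrightarrow> y \<in> H \<Longrightarrow> \<gamma> (x \<otimes>\<^bsub>G\<^esub> y) = \<gamma> x * \<gamma> y"
    "\<gamma> \<in> extensional H"
  using assms by (auto simp: lin_chars_def)

context group
begin

lemma lin_char_one:
  assumes "\<gamma> \<in> lin_chars G H" "subgroup H G"
  shows "\<gamma> \<one> = 1"
proof -
  have "\<one> \<in> H" using assms(2) by (simp add: subgroup.one_closed)
  then have "\<gamma> \<one> \<noteq> 0" "\<gamma> \<one> = \<gamma> \<one> * \<gamma> \<one>"
    using lin_charsD(1,2)[OF assms(1)] by (metis, metis l_one one_closed)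
  then show ?thesis by simp
qed

lemma lin_char_inv:
  assumes "\<gamma> \<in> lin_chars G H" "subgroup H G" "x \<in> H"
  shows "\<gamma> (inv x) = inverse (\<gamma> x)"
proof -
  have "\<gamma> (inv x) * \<gamma> x = \<gamma> (inv x \<otimes> x)"
    using lin_charsD(2)[OF assms(1)] subgroup.m_inv_closed[OF assms(2,3)] assms(3) by simp
  also have "\<dots> = 1"
    using lin_char_one[OF assms(1,2)] subgroup.mem_carrier[OF assms(2,3)] by simp
  finally show ?thesis using inverse_unique[of "\<gamma> x" "\<gamma> (inv x)"] by (simp add: mult.commute)
qed

text \<open>This is the representation induced from \<open>\<gamma>\<close>, as monomial matrices
  indexed by the right cosets of \<open>T\<close>. A vector killed by all \<open>E \<rho> g\<close>
  is zero because the row belonging to the coset \<open>T\<close> reads off each of its coordinates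
  as \<open>g\<close> varies.\<close>

lemma exists_monomial_rep:
  assumes fin: "finite (carrier G)" and T: "subgroup T G" and \<gamma>: "\<gamma> \<in> lin_chars G T"
  obtains \<rho> where "mat_rep G (card (rcosets T)) \<rho>"
    "generating G (card (rcosets T)) \<rho> (char_proj T \<gamma> (card (rcosets T)) \<rho>)"
proof -
  interpret T: subgroup T G by fact
  define m where "m = card (rcosets T)"
  have "finite (rcosets T)" using fin by (simp add: RCOSETS_def)
  then obtain e where e: "bij_betw e {0..<m} (rcosets T)"
    unfolding m_def using ex_bij_betw_nat_finite by blast
  define r where "r i = (SOME x. x \<in> carrier G \<and> e i = T #> x)" for i
  have r: "r i \<in> carrier G \<and> e i = T #> r i" if "i < m" for i
  proof -
    have "e i \<in> rcosets T" using e that by (auto simp: bij_betw_def)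
    then have "\<exists>x. x \<in> carrier G \<and> e i = T #> x" by (auto simp: RCOSETS_def)
    then show ?thesis unfolding r_def by (rule someI_ex)
  qed
  then have rc [simp]: "r i \<in> carrier G" if "i < m" for i using that by blast
  have mem: "g \<otimes> inv (r i) \<in> T \<longleftrightarrow> T #> g = e i" if "i < m" "g \<in> carrier G" for i g
  proof -
    have "g \<otimes> inv (r i) \<in> T \<longleftrightarrow> g \<in> T #> r i"
    proof
      assume "g \<otimes> inv (r i) \<in> T"
      then have "g \<otimes> inv (r i) \<otimes> r i \<in> T #> r i" by (auto simp: r_coset_def)
      then show "g \<in> T #> r i" using that by (simp add: m_assoc)
    next
      assume "g \<in> T #> r i"
      then obtain t where "t \<in> T" "g = t \<otimes> r i" by (auto simp: r_coset_def)
      then show "g \<otimes> inv (r i) \<in> T" using that by (simp add: m_assoc)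
    qed
    also have "\<dots> \<longleftrightarrow> T #> g = T #> r i"
      using that T repr_independence[OF _ _ T] rcos_self[OF that(2) T] by (metis rc)
    finally show ?thesis using r[OF that(1)] by simp
  qed
  have ex: "\<exists>i<m. g \<otimes> inv (r i) \<in> T" if g: "g \<in> carrier G" for g
  proof -
    have "T #> g \<in> rcosets T" using g by (auto simp: RCOSETS_def)
    then have "T #> g \<in> e ` {0..<m}" using e by (simp add: bij_betw_def)
    then obtain i where "i < m" "T #> g = e i" by auto
    then show ?thesis using mem g by blast
  qed
  have uniq: "i = j" if "i < m" "j < m" "g \<in> carrier G" "g \<otimes> inv (r i) \<in> T" "g \<otimes> inv (r j) \<in> T" for i j g
    using that mem e by (metis atLeastLessThan_iff bij_betw_def inj_onD zero_le)
  \<comment> \<open>Extension of \<open>\<gamma>\<close> by zero, so that the entry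
    \<open>(i, j)\<close> of \<open>\<rho> g\<close> below vanishes unless
    \<open>r i \<otimes> g\<close> lies in the coset of \<open>r j\<close>.\<close>
  define q where "q x = (if x \<in> T then \<gamma> x else 0)" for x
  have q_mult: "q (a \<otimes> x) = \<gamma> a * q x" if a: "a \<in> T" and x: "x \<in> carrier G" for a x
  proof -
    have "a \<otimes> x \<in> T \<longleftrightarrow> x \<in> T"
    proof
      assume "a \<otimes> x \<in> T"
      then have "inv a \<otimes> (a \<otimes> x) \<in> T" using a by blast
      then show "x \<in> T" using a x by (simp add: m_assoc[symmetric])
    qed (use a in blast)
    then show ?thesis using a lin_charsD(2)[OF \<gamma>] by (simp add: q_def)
  qed
  have q_delta: "q (r i \<otimes> inv (r j)) = (if i = j then 1 else 0)" if "i < m" "j < m" for i j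
  proof -
    have "r i \<otimes> inv (r i) \<in> T" using that by simp
    then have "r i \<otimes> inv (r j) \<in> T \<longleftrightarrow> i = j" using uniq[OF that rc[OF that(1)]] by metis
    then show ?thesis using that lin_char_one[OF \<gamma> T] by (auto simp: q_def)
  qed
  define \<rho> where "\<rho> g = mat m m (\<lambda>(i, j). q (r i \<otimes> g \<otimes> inv (r j)))" for g
  have \<rho>c: "\<rho> g \<in> carrier_mat m m" for g by (simp add: \<rho>_def)
  have R: "mat_rep G m \<rho>"
    unfolding mat_rep_def
  proof (intro conjI ballI)
    show "\<rho> \<one> = 1\<^sub>m m"
      by (rule eq_matI) (auto simp: \<rho>_def q_delta)
    fix g h assume g: "g \<in> carrier G" and h: "h \<in> carrier G"
    show "\<rho> (g \<otimes> h) = \<rho> g * \<rho> h"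
    proof (rule eq_matI)
      fix i k assume "i < dim_row (\<rho> g * \<rho> h)" "k < dim_col (\<rho> g * \<rho> h)"
      then have ik: "i < m" "k < m" by (auto simp: \<rho>_def)
      obtain j where j: "j < m" "r i \<otimes> g \<otimes> inv (r j) \<in> T" using ex[of "r i \<otimes> g"] ik g by auto
      have "(\<rho> g * \<rho> h) $$ (i, k) = (\<Sum>l<m. \<rho> g $$ (i, l) * \<rho> h $$ (l, k))"
        by (rule mat_mult_index[OF \<rho>c \<rho>c ik])
      also have "\<dots> = (\<Sum>l<m. if l = j then \<gamma> (r i \<otimes> g \<otimes> inv (r j)) * q (r j \<otimes> h \<otimes> inv (r k)) else 0)"
      proof (rule sum.cong)
        fix l assume "l \<in> {..<m}"
        then have l: "l < m" by simp
        have "r i \<otimes> g \<otimes> inv (r l) \<notin> T" if "l \<noteq> j"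
          using uniq[OF l j(1), of "r i \<otimes> g"] that j ik g by auto
        then show "\<rho> g $$ (i, l) * \<rho> h $$ (l, k) =
            (if l = j then \<gamma> (r i \<otimes> g \<otimes> inv (r j)) * q (r j \<otimes> h \<otimes> inv (r k)) else 0)"
          using ik l j by (auto simp: \<rho>_def q_def)
      qed simp
      also have "\<dots> = \<gamma> (r i \<otimes> g \<otimes> inv (r j)) * q (r j \<otimes> h \<otimes> inv (r k))"
        using j(1) by simp
      also have "\<dots> = q (r i \<otimes> g \<otimes> inv (r j) \<otimes> (r j \<otimes> h \<otimes> inv (r k)))"
        using q_mult[OF j(2)] ik j(1) h by simp
      also have "r i \<otimes> g \<otimes> inv (r j) \<otimes> (r j \<otimes> h \<otimes> inv (r k)) = r i \<otimes> (g \<otimes> h) \<otimes> inv (r k)"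
      proof -
        have "inv (r j) \<otimes> (r j \<otimes> (h \<otimes> inv (r k))) = h \<otimes> inv (r k)"
          using ik j(1) h by (simp add: m_assoc[symmetric])
        then show ?thesis using ik j(1) g h by (simp add: m_assoc)
      qed
      finally show "\<rho> (g \<otimes> h) $$ (i, k) = (\<rho> g * \<rho> h) $$ (i, k)"
        using ik by (simp add: \<rho>_def)
    qed (auto simp: \<rho>_def)
  qed (rule \<rho>c)
  \<comment> \<open>\<open>i0\<close> is the index of the coset \<open>T\<close> itself. Its
    representative \<open>r i0\<close> may differ from \<open>\<one>\<close>, but it lies in
    \<open>T\<close>, and conjugation by it does not change \<open>\<gamma>\<close>.\<close>
  obtain i0 where i0: "i0 < m" "\<one> \<otimes> inv (r i0) \<in> T" using ex[OF one_closed] by blast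
  then have r0: "r i0 \<in> T" using T.m_inv_closed by fastforce
  define E where "E = char_proj T \<gamma> m \<rho>"
  have Ec: "E \<in> carrier_mat m m" by (simp add: E_def)
  have E0: "E $$ (i0, j) = (if j = i0 then 1 else 0)" if j: "j < m" for j
  proof -
    have "inverse (\<gamma> t) * \<rho> t $$ (i0, j) = (if j = i0 then 1 else 0)" if t: "t \<in> T" for t
    proof -
      have tc: "t \<in> carrier G" using t by simp
      have "r i0 \<otimes> t \<otimes> inv (r i0) \<in> T" using r0 t by blast
      then have in_T: "r i0 \<otimes> t \<otimes> inv (r j) \<in> T \<longleftrightarrow> j = i0"
        using uniq[OF j i0(1), of "r i0 \<otimes> t"] tc i0(1) by auto
      have "\<gamma> (r i0 \<otimes> t \<otimes> inv (r i0)) = \<gamma> t"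
        using lin_charsD(1)[OF \<gamma> r0] r0 t
        by (simp add: lin_charsD(2)[OF \<gamma>] lin_char_inv[OF \<gamma> T])
      then show ?thesis using in_T i0(1) j lin_charsD(1)[OF \<gamma> t] by (auto simp: \<rho>_def q_def)
    qed
    then have "(\<Sum>t\<in>T. inverse (\<gamma> t) * \<rho> t $$ (i0, j)) = of_nat (card T) * (if j = i0 then 1 else 0)"
      by simp
    moreover have "card T \<noteq> 0" using T.one_closed finite_subset[OF T.subset fin]
      by (metis card_0_eq empty_iff)
    moreover have "E $$ (i0, j) = (1 / of_nat (card T)) * (\<Sum>t\<in>T. inverse (\<gamma> t) * \<rho> t $$ (i0, j))"
      using i0(1) j by (simp add: E_def char_proj_def sum_mats_def \<rho>_def)
    ultimately show ?thesis by simp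
  qed
  have "generating G m \<rho> E"
    unfolding generating_def
  proof (intro ballI impI)
    fix w :: "complex mat" assume w: "w \<in> carrier_mat m 1"
      and 0: "\<forall>g\<in>carrier G. E * \<rho> g * w = 0\<^sub>m m 1"
    show "w = 0\<^sub>m m 1"
    proof (rule eq_matI)
      fix i j assume "i < dim_row (0\<^sub>m m 1 :: complex mat)" "j < dim_col (0\<^sub>m m 1 :: complex mat)"
      then have ij: "i < m" "j = 0" by auto
      \<comment> \<open>This \<open>g\<close> takes the coset \<open>T\<close> to that of
        \<open>r i\<close>, so row \<open>i0\<close> of \<open>E \<rho> g\<close> is the unit row at
        \<open>i\<close>.\<close>
      define g where "g = inv (r i0) \<otimes> r i"
      have g: "g \<in> carrier G" using ij i0 by (simp add: g_def)
      have row: "(E * \<rho> g) $$ (i0, l) = (if l = i then 1 else 0)" if l: "l < m" for l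
      proof -
        have "(E * \<rho> g) $$ (i0, l) = (\<Sum>k<m. E $$ (i0, k) * \<rho> g $$ (k, l))"
          by (rule mat_mult_index[OF Ec \<rho>c i0(1) l])
        also have "\<dots> = (\<Sum>k<m. if k = i0 then \<rho> g $$ (i0, l) else 0)"
          by (rule sum.cong) (auto simp: E0)
        also have "\<dots> = \<rho> g $$ (i0, l)" using i0(1) by simp
        also have "\<dots> = q (r i \<otimes> inv (r l))"
          using i0(1) l ij by (simp add: \<rho>_def g_def m_assoc[symmetric])
        finally show ?thesis using q_delta[OF ij(1) l] by auto
      qed
      have "0 = (E * \<rho> g * w) $$ (i0, 0)" using 0 g i0(1) by simp
      also have "\<dots> = (\<Sum>l<m. (E * \<rho> g) $$ (i0, l) * w $$ (l, 0))"
        by (rule mat_mult_index[OF mult_carrier_mat[OF Ec \<rho>c] w i0(1)]) simp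
      also have "\<dots> = (\<Sum>l<m. if l = i then w $$ (i, 0) else 0)"
        by (rule sum.cong) (auto simp: row)
      also have "\<dots> = w $$ (i, 0)" using ij by simp
      finally show "w $$ (i, j) = 0\<^sub>m m 1 $$ (i, j)" using ij by simp
    qed (use w in auto)
  qed
  then show ?thesis using that R unfolding E_def m_def by blast
qed

end

section \<open>Multiplicities of linear characters\<close>

lemma smult_smult_mat: "a \<cdot>\<^sub>m (b \<cdot>\<^sub>m A) = (a * b) \<cdot>\<^sub>m (A :: complex mat)"
  by (rule eq_matI) auto

context group
begin

lemma left_mult_bij: "x \<in> H \<Longrightarrow> subgroup H G \<Longrightarrow> bij_betw (\<lambda>g. x \<otimes> g) H H"
  by (rule bij_betwI[of _ _ _ "\<lambda>g. inv x \<otimes> g"])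
    (auto simp: m_assoc[symmetric] subgroup.mem_carrier subgroup.m_closed subgroup.m_inv_closed)

lemma right_mult_bij: "x \<in> H \<Longrightarrow> subgroup H G \<Longrightarrow> bij_betw (\<lambda>g. g \<otimes> x) H H"
  by (rule bij_betwI[of _ _ _ "\<lambda>g. g \<otimes> inv x"])
    (auto simp: m_assoc subgroup.mem_carrier subgroup.m_closed subgroup.m_inv_closed)

context
  fixes n :: nat and \<rho> :: "'a \<Rightarrow> complex mat"
  assumes fin: "finite (carrier G)" and R: "mat_rep G n \<rho>"
begin

text \<open>Replacing \<open>t\<close> by \<open>x \<otimes> t\<close> in the average pulls out the
  scalar \<open>\<gamma> x\<close>.\<close>

lemma rep_char_proj:
  assumes T: "subgroup T G" and \<gamma>: "\<gamma> \<in> lin_chars G T" and x: "x \<in> T"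
  shows "\<rho> x * char_proj T \<gamma> n \<rho> = \<gamma> x \<cdot>\<^sub>m char_proj T \<gamma> n \<rho>"
proof -
  interpret T: subgroup T G by fact
  have Rc: "\<rho> t \<in> carrier_mat n n" if "t \<in> T" for t using mat_repD(1)[OF R] that by simp
  have "sum_mats n n T (\<lambda>t. inverse (\<gamma> t) \<cdot>\<^sub>m (\<rho> x * \<rho> t)) =
      sum_mats n n T (\<lambda>t. \<gamma> x \<cdot>\<^sub>m (inverse (\<gamma> (x \<otimes> t)) \<cdot>\<^sub>m \<rho> (x \<otimes> t)))"
  proof (rule sum_mats_cong)
    fix t assume t: "t \<in> T"
    have "\<gamma> x * inverse (\<gamma> (x \<otimes> t)) = inverse (\<gamma> t)"
      using lin_charsD(1,2)[OF \<gamma>] x t by (simp add: field_simps)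
    then show "inverse (\<gamma> t) \<cdot>\<^sub>m (\<rho> x * \<rho> t) = \<gamma> x \<cdot>\<^sub>m (inverse (\<gamma> (x \<otimes> t)) \<cdot>\<^sub>m \<rho> (x \<otimes> t))"
      using mat_repD(2)[OF R] x t by (simp add: smult_smult_mat)
  qed
  also have "\<dots> = \<gamma> x \<cdot>\<^sub>m sum_mats n n T (\<lambda>t. inverse (\<gamma> (x \<otimes> t)) \<cdot>\<^sub>m \<rho> (x \<otimes> t))"
    by (rule smult_sum_mats[symmetric]) (use x Rc in simp)
  also have "sum_mats n n T (\<lambda>t. inverse (\<gamma> (x \<otimes> t)) \<cdot>\<^sub>m \<rho> (x \<otimes> t)) = sum_mats n n T (\<lambda>t. inverse (\<gamma> t) \<cdot>\<^sub>m \<rho> t)"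
    by (rule sum_mats_reindex[OF left_mult_bij[OF x T], symmetric])
  finally have "sum_mats n n T (\<lambda>t. inverse (\<gamma> t) \<cdot>\<^sub>m (\<rho> x * \<rho> t)) =
     \<gamma> x \<cdot>\<^sub>m sum_mats n n T (\<lambda>t. inverse (\<gamma> t) \<cdot>\<^sub>m \<rho> t)" .
  then show ?thesis
    using mult_char_proj[of T \<rho> n "\<rho> x" n \<gamma>] Rc x
    by (simp add: char_proj_def smult_smult_mat mult.commute)
qed

lemma char_proj_rep:
  assumes T: "subgroup T G" and \<gamma>: "\<gamma> \<in> lin_chars G T" and x: "x \<in> T"
  shows "char_proj T \<gamma> n \<rho> * \<rho> x = \<gamma> x \<cdot>\<^sub>m char_proj T \<gamma> n \<rho>"
proof -
  interpret T: subgroup T G by fact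
  have Rc: "\<rho> t \<in> carrier_mat n n" if "t \<in> T" for t using mat_repD(1)[OF R] that by simp
  have "sum_mats n n T (\<lambda>t. inverse (\<gamma> t) \<cdot>\<^sub>m (\<rho> t * \<rho> x)) =
      sum_mats n n T (\<lambda>t. \<gamma> x \<cdot>\<^sub>m (inverse (\<gamma> (t \<otimes> x)) \<cdot>\<^sub>m \<rho> (t \<otimes> x)))"
  proof (rule sum_mats_cong)
    fix t assume t: "t \<in> T"
    have "\<gamma> x * inverse (\<gamma> (t \<otimes> x)) = inverse (\<gamma> t)"
      using lin_charsD(1,2)[OF \<gamma>] x t by (simp add: field_simps)
    then show "inverse (\<gamma> t) \<cdot>\<^sub>m (\<rho> t * \<rho> x) = \<gamma> x \<cdot>\<^sub>m (inverse (\<gamma> (t \<otimes> x)) \<cdot>\<^sub>m \<rho> (t \<otimes> x))"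
      using mat_repD(2)[OF R] x t by (simp add: smult_smult_mat)
  qed
  also have "\<dots> = \<gamma> x \<cdot>\<^sub>m sum_mats n n T (\<lambda>t. inverse (\<gamma> (t \<otimes> x)) \<cdot>\<^sub>m \<rho> (t \<otimes> x))"
    by (rule smult_sum_mats[symmetric]) (use x Rc in simp)
  also have "sum_mats n n T (\<lambda>t. inverse (\<gamma> (t \<otimes> x)) \<cdot>\<^sub>m \<rho> (t \<otimes> x)) = sum_mats n n T (\<lambda>t. inverse (\<gamma> t) \<cdot>\<^sub>m \<rho> t)"
    by (rule sum_mats_reindex[OF right_mult_bij[OF x T], symmetric])
  finally have "sum_mats n n T (\<lambda>t. inverse (\<gamma> t) \<cdot>\<^sub>m (\<rho> t * \<rho> x)) =
     \<gamma> x \<cdot>\<^sub>m sum_mats n n T (\<lambda>t. inverse (\<gamma> t) \<cdot>\<^sub>m \<rho> t)" .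
  then show ?thesis
    using char_proj_mult[of T \<rho> n "\<rho> x" n \<gamma>] Rc x
    by (simp add: char_proj_def smult_smult_mat mult.commute)
qed

text \<open>If \<open>T\<close> acts on the columns of \<open>E\<close> through
  \<open>\<gamma>\<close>, every term of the average acts on them as the identity. With
  \<open>E\<close> the projection itself this is idempotence.\<close>

lemma char_proj_absorb:
  assumes T: "subgroup T G" and \<gamma>: "\<gamma> \<in> lin_chars G T"
    and E: "E \<in> carrier_mat n k" "\<And>t. t \<in> T \<Longrightarrow> \<rho> t * E = \<gamma> t \<cdot>\<^sub>m E"
  shows "char_proj T \<gamma> n \<rho> * E = E"
proof -
  interpret T: subgroup T G by fact
  have finT: "finite T" using finite_subset[OF T.subset fin] .
  then have T0: "card T \<noteq> 0" using T.one_closed by (metis card_0_eq empty_iff)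
  have Rc: "\<rho> t \<in> carrier_mat n n" if "t \<in> T" for t using mat_repD(1)[OF R] that by simp
  have "char_proj T \<gamma> n \<rho> * E =
      (1 / of_nat (card T)) \<cdot>\<^sub>m sum_mats n k T (\<lambda>t. inverse (\<gamma> t) \<cdot>\<^sub>m (\<rho> t * E))"
    by (rule char_proj_mult[OF _ E(1)]) (use Rc in auto)
  also have "sum_mats n k T (\<lambda>t. inverse (\<gamma> t) \<cdot>\<^sub>m (\<rho> t * E)) = sum_mats n k T (\<lambda>t. E)"
    by (rule sum_mats_cong) (use E lin_charsD(1)[OF \<gamma>] in \<open>auto simp: smult_smult_mat\<close>)
  also have "\<dots> = of_nat (card T) \<cdot>\<^sub>m E" by (rule sum_mats_const[OF finT E(1)])
  also have "(1 / of_nat (card T)) \<cdot>\<^sub>m (of_nat (card T) \<cdot>\<^sub>m E) = E"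
    using T0 by (intro eq_matI) (auto simp: smult_smult_mat)
  finally show ?thesis .
qed

lemma idempotent_char_proj:
  assumes T: "subgroup T G" and \<gamma>: "\<gamma> \<in> lin_chars G T"
  shows "idempotent_mat n (char_proj T \<gamma> n \<rho>)"
  using char_proj_absorb[OF T \<gamma> char_proj_carrier rep_char_proj[OF T \<gamma>]]
  by (simp add: idempotent_mat_def)

text \<open>Inserting \<open>\<rho> r\<close> between the projections multiplies the product by
  \<open>\<gamma> r\<close> and also by \<open>\<gamma>' r\<close>. One common element suffices, so
  the groups may differ.\<close>

lemma char_proj_orthogonal:
  assumes T: "subgroup T G" and \<gamma>: "\<gamma> \<in> lin_chars G T"
    and T': "subgroup T' G" and \<gamma>': "\<gamma>' \<in> lin_chars G T'"
    and r: "r \<in> T" "r \<in> T'" "\<gamma> r \<noteq> \<gamma>' r"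
  shows "char_proj T \<gamma> n \<rho> * char_proj T' \<gamma>' n \<rho> = 0\<^sub>m n n"
proof -
  define E where "E = char_proj T \<gamma> n \<rho>"
  define E' where "E' = char_proj T' \<gamma>' n \<rho>"
  have c: "E \<in> carrier_mat n n" "E' \<in> carrier_mat n n" by (simp_all add: E_def E'_def)
  have rc: "\<rho> r \<in> carrier_mat n n" using mat_repD(1)[OF R] subgroup.mem_carrier[OF T r(1)] .
  have EE': "E * E' \<in> carrier_mat n n" using c by simp
  have "\<gamma> r \<cdot>\<^sub>m (E * E') = (\<gamma> r \<cdot>\<^sub>m E) * E'"
    by (rule mult_smult_assoc_mat[OF c, symmetric])
  also have "\<dots> = E * \<rho> r * E'" using char_proj_rep[OF T \<gamma> r(1)] by (simp add: E_def)
  also have "\<dots> = E * (\<rho> r * E')" by (rule assoc_mult_mat[OF c(1) rc c(2)])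
  also have "\<dots> = E * (\<gamma>' r \<cdot>\<^sub>m E')" using rep_char_proj[OF T' \<gamma>' r(2)] by (simp add: E'_def)
  also have "\<dots> = \<gamma>' r \<cdot>\<^sub>m (E * E')" by (rule mult_smult_distrib[OF c])
  finally have eq: "\<gamma> r \<cdot>\<^sub>m (E * E') = \<gamma>' r \<cdot>\<^sub>m (E * E')" .
  have "E * E' = 0\<^sub>m n n"
  proof (rule eq_matI)
    fix i j assume "i < dim_row (0\<^sub>m n n :: complex mat)" "j < dim_col (0\<^sub>m n n :: complex mat)"
    then have ij: "i < n" "j < n" by auto
    have "\<gamma> r * (E * E') $$ (i, j) = \<gamma>' r * (E * E') $$ (i, j)"
      using arg_cong[OF eq, of "\<lambda>A. A $$ (i, j)"] ij EE'
      by (metis carrier_matD(1) carrier_matD(2) index_smult_mat(1))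
    then show "(E * E') $$ (i, j) = 0\<^sub>m n n $$ (i, j)" using r(3) ij by simp
  qed (use c in auto)
  then show ?thesis by (simp add: E_def E'_def)
qed

end

end

text \<open>The sum of the family is itself idempotent and its trace is the sum of the ranks, which
  therefore cannot exceed \<open>n\<close>.\<close>

lemma sum_orthogonal_idempotents:
  assumes I: "finite I" and E: "\<And>i. i \<in> I \<Longrightarrow> idempotent_mat n (E i)"
    and orth: "\<And>i j. i \<in> I \<Longrightarrow> j \<in> I \<Longrightarrow> i \<noteq> j \<Longrightarrow> E i * E j = 0\<^sub>m n n"
  shows "(\<Sum>i\<in>I. idempotent_rank (E i)) \<le> n"
proof -
  have Ec: "E i \<in> carrier_mat n n" if "i \<in> I" for i using E[OF that] by (rule idempotent_matD)
  define S where "S = sum_mats n n I E"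
  have Sc: "S \<in> carrier_mat n n" by (simp add: S_def)
  have ES: "E i * S = E i" if i: "i \<in> I" for i
  proof -
    have "E i * S = sum_mats n n I (\<lambda>j. E i * E j)"
      unfolding S_def by (rule mult_sum_mats[OF Ec[OF i] Ec])
    also have "\<dots> = sum_mats n n I (\<lambda>j. if j = i then E i else 0\<^sub>m n n)"
      by (rule sum_mats_cong) (use orth i idempotent_matD(2)[OF E] in auto)
    also have "\<dots> = E i"
    proof (rule eq_matI)
      fix a b assume "a < dim_row (E i)" "b < dim_col (E i)"
      then have ab: "a < n" "b < n" using Ec[OF i] by auto
      have "(\<Sum>j\<in>I. (if j = i then E i else 0\<^sub>m n n) $$ (a, b)) = (\<Sum>j\<in>I. if j = i then E i $$ (a, b) else 0)"
        by (rule sum.cong) (use ab in auto)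
      then show "sum_mats n n I (\<lambda>j. if j = i then E i else 0\<^sub>m n n) $$ (a, b) = E i $$ (a, b)"
        using ab I i by (simp add: sum_mats_index)
    qed (use Ec[OF i] in \<open>auto simp: sum_mats_def\<close>)
    finally show ?thesis .
  qed
  have "S * S = sum_mats n n I (\<lambda>i. E i * S)"
    using sum_mats_mult[OF Sc, of I E n] Ec by (simp add: S_def)
  also have "\<dots> = S" unfolding S_def by (rule sum_mats_cong) (use ES in \<open>simp add: S_def\<close>)
  finally have idem: "idempotent_mat n S" using Sc by (simp add: idempotent_mat_def)
  have "mat_trace S = (\<Sum>i\<in>I. mat_trace (E i))"
    unfolding S_def by (rule mat_trace_sum_mats) (rule Ec)
  also have "\<dots> = (\<Sum>i\<in>I. of_nat (idempotent_rank (E i)))"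
    by (rule sum.cong) (use idempotent_rank[OF E] in auto)
  also have "\<dots> = of_nat (\<Sum>i\<in>I. idempotent_rank (E i))" by simp
  finally have "idempotent_rank S = (\<Sum>i\<in>I. idempotent_rank (E i))" by (rule idempotent_rankI)
  then show ?thesis using idempotent_rank_le[OF idem] by simp
qed


text \<open>The inner product of \<open>\<gamma>\<close> with the restriction of
  \<open>\<chi>\<close> to \<open>T\<close>, with \<open>inverse\<close> in place of complex
  conjugation. It depends on \<open>\<chi>\<close> and not on a representation, so it can be summed
  over characters. The \<open>THE\<close> is meaningful when \<open>\<chi>\<close> is a character
  and \<open>\<gamma>\<close> a linear character of the subgroup \<open>T\<close>.\<close>

definition char_mult :: "'a set \<Rightarrow> ('a \<Rightarrow> complex) \<Rightarrow> ('a \<Rightarrow> complex) \<Rightarrow> nat" where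
  "char_mult T \<gamma> \<chi> = (THE k. (1 / of_nat (card T)) * (\<Sum>t\<in>T. inverse (\<gamma> t) * \<chi> t) = of_nat k)"

context group
begin

text \<open>Taking traces termwise turns the projection into the inner product, so multiplicities
  are ranks.\<close>

lemma idempotent_rank_char_proj:
  assumes R: "mat_rep G n \<rho>" and T: "T \<subseteq> carrier G"
  shows "idempotent_rank (char_proj T \<gamma> n \<rho>) = char_mult T \<gamma> (character_of G \<rho>)"
proof -
  have Rc: "\<rho> t \<in> carrier_mat n n" if "t \<in> T" for t using mat_repD(1)[OF R] T that by blast
  have "mat_trace (char_proj T \<gamma> n \<rho>) =
      (1 / of_nat (card T)) * mat_trace (sum_mats n n T (\<lambda>t. inverse (\<gamma> t) \<cdot>\<^sub>m \<rho> t))"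
    unfolding char_proj_def by (rule mat_trace_smult[OF sum_mats_carrier])
  also have "mat_trace (sum_mats n n T (\<lambda>t. inverse (\<gamma> t) \<cdot>\<^sub>m \<rho> t)) =
      (\<Sum>t\<in>T. mat_trace (inverse (\<gamma> t) \<cdot>\<^sub>m \<rho> t))"
    by (rule mat_trace_sum_mats) (use Rc in simp)
  also have "\<dots> = (\<Sum>t\<in>T. inverse (\<gamma> t) * character_of G \<rho> t)"
    by (rule sum.cong) (use mat_trace_smult[OF Rc] T in \<open>auto simp: character_of_def\<close>)
  finally show ?thesis by (simp add: idempotent_rank_def char_mult_def)
qed

lemma char_degree_character:
  assumes "mat_rep G n \<rho>"
  shows "char_degree G (character_of G \<rho>) = n"
  using mat_repD(3)[OF assms]
  by (auto simp: char_degree_def character_of_def mat_trace_one intro!: the_equality)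

text \<open>The separation hypothesis makes the projections pairwise orthogonal. Since the groups
  may vary with \<open>i\<close>, a single count covers all stabilizers.\<close>

lemma sum_char_mult_le:
  assumes fin: "finite (carrier G)" and R: "mat_rep G n \<rho>" and I: "finite I"
    and T: "\<And>i. i \<in> I \<Longrightarrow> subgroup (T i) G" and \<gamma>: "\<And>i. i \<in> I \<Longrightarrow> \<gamma> i \<in> lin_chars G (T i)"
    and sep: "\<And>i j. i \<in> I \<Longrightarrow> j \<in> I \<Longrightarrow> i \<noteq> j \<Longrightarrow> \<exists>r\<in>T i \<inter> T j. \<gamma> i r \<noteq> \<gamma> j r"
  shows "(\<Sum>i\<in>I. char_mult (T i) (\<gamma> i) (character_of G \<rho>)) \<le> n"
proof -
  have "(\<Sum>i\<in>I. idempotent_rank (char_proj (T i) (\<gamma> i) n \<rho>)) \<le> n"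
  proof (rule sum_orthogonal_idempotents[OF I])
    show "idempotent_mat n (char_proj (T i) (\<gamma> i) n \<rho>)" if "i \<in> I" for i
      by (rule idempotent_char_proj[OF fin R T[OF that] \<gamma>[OF that]])
    show "char_proj (T i) (\<gamma> i) n \<rho> * char_proj (T j) (\<gamma> j) n \<rho> = 0\<^sub>m n n"
      if ij: "i \<in> I" "j \<in> I" "i \<noteq> j" for i j
    proof -
      obtain r where "r \<in> T i" "r \<in> T j" "\<gamma> i r \<noteq> \<gamma> j r" using sep[OF ij] by blast
      then show ?thesis
        by (rule char_proj_orthogonal[OF fin R T[OF ij(1)] \<gamma>[OF ij(1)] T[OF ij(2)] \<gamma>[OF ij(2)]])
    qed
  qed
  also have "(\<Sum>i\<in>I. idempotent_rank (char_proj (T i) (\<gamma> i) n \<rho>)) =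
      (\<Sum>i\<in>I. char_mult (T i) (\<gamma> i) (character_of G \<rho>))"
    by (rule sum.cong) (use idempotent_rank_char_proj[OF R] subgroup.subset[OF T] in auto)
  finally show ?thesis .
qed

text \<open>The representation induced from \<open>\<gamma>\<close> has degree
  \<open>|G : T|\<close>, so splitting it leaves an irreducible constituent of degree not divisible
  by \<open>p\<close> on which the projection for \<open>\<gamma>\<close> survives.\<close>

lemma exists_irr_char_over:
  assumes fin: "finite (carrier G)" and T: "subgroup T G" and \<gamma>: "\<gamma> \<in> lin_chars G T"
    and p: "\<not> p dvd card (rcosets T)"
  obtains \<chi> where "\<chi> \<in> irr_chars_p' p G" "char_mult T \<gamma> \<chi> > 0"
proof -
  have sub: "T \<subseteq> carrier G" by (rule subgroup.subset[OF T])
  obtain \<sigma> where "mat_rep G (card (rcosets T)) \<sigma>"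
    "generating G (card (rcosets T)) \<sigma> (char_proj T \<gamma> (card (rcosets T)) \<sigma>)"
    using exists_monomial_rep[OF fin T \<gamma>] by metis
  then obtain k \<rho> where \<rho>: "is_irreducible_representation G k \<rho>" "\<not> p dvd k"
    "char_proj T \<gamma> k \<rho> \<noteq> 0\<^sub>m k k"
    using exists_irreducible_constituent[OF fin sub] p by metis
  have R: "mat_rep G k \<rho>" using \<rho>(1) by (simp add: irreducible_iff)
  have "character_of G \<rho> \<in> irr_chars_p' p G"
    using \<rho>(1,2) char_degree_character[OF R] by (auto simp: irr_chars_p'_def irr_chars_def)
  moreover have "char_mult T \<gamma> (character_of G \<rho>) > 0"
    using idempotent_rank_pos[OF idempotent_char_proj[OF fin R T \<gamma>] \<rho>(3)]
    by (simp add: idempotent_rank_char_proj[OF R sub])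
  ultimately show ?thesis using that by blast
qed

text \<open>The image of the projection for \<open>\<gamma>\<close> lies in that of the projection
  for its restriction \<open>\<eta>\<close>, so the latter is nonzero as well.\<close>

lemma char_mult_restrict_pos:
  assumes fin: "finite (carrier G)" and R: "mat_rep G n \<rho>"
    and T: "subgroup T G" and \<gamma>: "\<gamma> \<in> lin_chars G T"
    and H: "subgroup H G" "H \<subseteq> T" and \<eta>: "\<eta> \<in> lin_chars G H" "\<And>x. x \<in> H \<Longrightarrow> \<gamma> x = \<eta> x"
    and pos: "char_mult T \<gamma> (character_of G \<rho>) > 0"
  shows "char_mult H \<eta> (character_of G \<rho>) > 0"
proof -
  define E where "E = char_proj T \<gamma> n \<rho>"
  have Ec: "E \<in> carrier_mat n n" by (simp add: E_def)
  have "char_proj H \<eta> n \<rho> * E = E"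
    by (rule char_proj_absorb[OF fin R H(1) \<eta>(1) Ec])
      (use rep_char_proj[OF fin R T \<gamma>] H(2) \<eta>(2) in \<open>auto simp: E_def\<close>)
  moreover have "E \<noteq> 0\<^sub>m n n"
    using pos idempotent_rankI[of E 0] mat_trace_zero[of n]
    unfolding idempotent_rank_char_proj[OF R subgroup.subset[OF T], symmetric] E_def by auto
  ultimately have "char_proj H \<eta> n \<rho> \<noteq> 0\<^sub>m n n" using Ec by auto
  then have "idempotent_rank (char_proj H \<eta> n \<rho>) > 0"
    by (rule idempotent_rank_pos[OF idempotent_char_proj[OF fin R H(1) \<eta>(1)]])
  then show ?thesis by (simp add: idempotent_rank_char_proj[OF R subgroup.subset[OF H(1)]])
qed

lemma character_of_conj:
  assumes R: "mat_rep G n \<rho>" and x: "x \<in> carrier G" and g: "g \<in> carrier G"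
  shows "character_of G \<rho> (x \<otimes> g \<otimes> inv x) = character_of G \<rho> g"
proof -
  note Rc = mat_repD(1)[OF R] and Rm = mat_repD(2)[OF R]
  have "mat_trace (\<rho> (x \<otimes> g \<otimes> inv x)) = mat_trace (\<rho> (x \<otimes> g) * \<rho> (inv x))"
    using x g by (simp add: Rm)
  also have "\<dots> = mat_trace (\<rho> (inv x) * \<rho> (x \<otimes> g))"
    by (rule mat_trace_mult_comm[OF Rc Rc]) (use x g in auto)
  also have "\<rho> (inv x) * \<rho> (x \<otimes> g) = \<rho> g"
    using x g by (simp add: Rm[symmetric] m_assoc[symmetric])
  finally show ?thesis using x g by (simp add: character_of_def)
qed

text \<open>A character is a class function, so reindexing by conjugation carries a multiplicity
  along an orbit. This is the part of Clifford's theorem that yields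
  \<open>h \<le> d\<close>.\<close>

lemma char_mult_conj:
  assumes R: "mat_rep G n \<rho>" and x: "x \<in> carrier G" and H: "H \<subseteq> carrier G"
    and bij: "bij_betw (\<lambda>g. x \<otimes> g \<otimes> inv x) H H"
    and \<eta>': "\<And>g. g \<in> H \<Longrightarrow> \<eta>' g = \<eta> (x \<otimes> g \<otimes> inv x)"
  shows "char_mult H \<eta>' (character_of G \<rho>) = char_mult H \<eta> (character_of G \<rho>)"
proof -
  have "(\<Sum>t\<in>H. inverse (\<eta> t) * character_of G \<rho> t) =
      (\<Sum>t\<in>H. inverse (\<eta> (x \<otimes> t \<otimes> inv x)) * character_of G \<rho> (x \<otimes> t \<otimes> inv x))"
    by (rule sum.reindex_bij_betw[OF bij, symmetric])
  also have "\<dots> = (\<Sum>t\<in>H. inverse (\<eta>' t) * character_of G \<rho> t)"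
    by (rule sum.cong) (use \<eta>' character_of_conj[OF R x] H in auto)
  finally show ?thesis by (simp add: char_mult_def)
qed

lemma degree_one_lin_char:
  assumes R: "mat_rep G 1 \<rho>"
  shows "character_of G \<rho> \<in> lin_chars G (carrier G)"
proof -
  have tr: "mat_trace (\<rho> g) = \<rho> g $$ (0, 0)" if "g \<in> carrier G" for g
    using mat_repD(1)[OF R that] by (auto simp: mat_trace_def)
  have mult: "\<rho> (g \<otimes> h) $$ (0, 0) = \<rho> g $$ (0, 0) * \<rho> h $$ (0, 0)"
    if "g \<in> carrier G" "h \<in> carrier G" for g h
    using mat_mult_index[OF mat_repD(1)[OF R that(1)] mat_repD(1)[OF R that(2)], of 0 0]
      mat_repD(2)[OF R that] by simp
  have "\<rho> g $$ (0, 0) \<noteq> 0" if "g \<in> carrier G" for g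
    using mult[OF that inv_closed[OF that]] that mat_repD(3)[OF R] by auto
  then show ?thesis using tr mult by (auto simp: lin_chars_def character_of_def)
qed

text \<open>In degree 1 a nonzero projection is an invertible scalar, which cancels from
  \<open>\<rho> x E = \<eta> x E\<close>.\<close>

lemma char_mult_lin_char:
  assumes fin: "finite (carrier G)" and H: "subgroup H G" and \<eta>: "\<eta> \<in> lin_chars G H"
    and R: "mat_rep G 1 \<rho>" and pos: "char_mult H \<eta> (character_of G \<rho>) > 0"
    and x: "x \<in> H"
  shows "\<eta> x = character_of G \<rho> x"
proof -
  define E where "E = char_proj H \<eta> 1 \<rho>"
  have Ec: "E \<in> carrier_mat 1 1" by (simp add: E_def)
  have xc: "x \<in> carrier G" using subgroup.mem_carrier[OF H x] .
  note rc = mat_repD(1)[OF R xc]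
  have "E \<noteq> 0\<^sub>m 1 1"
    using pos idempotent_rankI[of E 0] mat_trace_zero[of 1]
    unfolding idempotent_rank_char_proj[OF R subgroup.subset[OF H], symmetric] E_def by auto
  have E0: "E $$ (0, 0) \<noteq> 0"
  proof
    assume "E $$ (0, 0) = 0"
    then have "E = 0\<^sub>m 1 1" using Ec by (intro eq_matI) auto
    with \<open>E \<noteq> 0\<^sub>m 1 1\<close> show False by simp
  qed
  have "\<rho> x * E = \<eta> x \<cdot>\<^sub>m E"
    unfolding E_def by (rule rep_char_proj[OF fin R H \<eta> x])
  then have "\<rho> x $$ (0, 0) * E $$ (0, 0) = \<eta> x * E $$ (0, 0)"
    using mat_mult_index[OF rc Ec, of 0 0] Ec by auto
  then show ?thesis using E0 rc xc by (simp add: character_of_def mat_trace_def)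
qed

text \<open>The translates of one vector span an invariant subspace, hence the whole space. The
  bound is crude and serves only to make the set of irreducible characters finite.\<close>

lemma irreducible_degree_le:
  assumes fin: "finite (carrier G)" and irr: "is_irreducible_representation G n \<rho>"
  shows "n \<le> card (carrier G)"
proof -
  have R: "mat_rep G n \<rho>" and n: "n > 0"
    and irrW: "\<And>W. invariant_subspace G n \<rho> W \<Longrightarrow> W = {0\<^sub>v n} \<or> W = carrier_vec n"
    using irr by (auto simp: irreducible_iff)
  note Rc = mat_repD(1)[OF R] and Rm = mat_repD(2)[OF R]
  define a where "a g i = \<rho> g $$ (i, 0)" for g i
  \<comment> \<open>\<open>u c\<close> combines, with coefficients \<open>c\<close>, the images of
    the first unit vector, which are the first columns of the matrices
    \<open>\<rho> g\<close>.\<close>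
  define u where "u c = vec n (\<lambda>i. \<Sum>g\<in>carrier G. c g * a g i)" for c
  define W where "W = range u"
  have "u c \<in> carrier_vec n" for c by (simp add: u_def)
  moreover have "0\<^sub>v n = u (\<lambda>_. 0)" by (intro eq_vecI) (auto simp: u_def)
  moreover have "u c + u d = u (\<lambda>g. c g + d g)" for c d
    by (intro eq_vecI) (auto simp: u_def sum.distrib algebra_simps)
  moreover have "k \<cdot>\<^sub>v u c = u (\<lambda>g. k * c g)" for k c
    by (intro eq_vecI) (auto simp: u_def sum_distrib_left mult.assoc)
  moreover have "\<rho> h *\<^sub>v u c = u (\<lambda>g. c (inv h \<otimes> g))" if h: "h \<in> carrier G" for h c
  proof (rule eq_vecI)
    fix i assume "i < dim_vec (u (\<lambda>g. c (inv h \<otimes> g)))"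
    then have i: "i < n" by (simp add: u_def)
    have "(\<rho> h *\<^sub>v u c) $ i = (\<Sum>l<n. \<rho> h $$ (i, l) * (\<Sum>g\<in>carrier G. c g * a g l))"
      using Rc[OF h] i by (auto simp: u_def scalar_prod_def lessThan_atLeast0 intro!: sum.cong)
    also have "\<dots> = (\<Sum>g\<in>carrier G. c g * (\<Sum>l<n. \<rho> h $$ (i, l) * a g l))"
      by (simp add: sum_distrib_left mult.left_commute sum.swap[of _ "{..<n}"])
    also have "\<dots> = (\<Sum>g\<in>carrier G. c g * a (h \<otimes> g) i)"
      by (rule sum.cong) (use mat_mult_index[OF Rc[OF h] Rc i n] Rm[OF h] in \<open>auto simp: a_def\<close>)
    also have "\<dots> = (\<Sum>g\<in>carrier G. c (inv h \<otimes> (h \<otimes> g)) * a (h \<otimes> g) i)"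
      by (rule sum.cong) (use h in \<open>auto simp: m_assoc[symmetric]\<close>)
    also have "\<dots> = (\<Sum>g\<in>carrier G. c (inv h \<otimes> g) * a g i)"
      by (rule sum.reindex_bij_betw[OF left_mult_bij[OF h subgroup_self]])
    finally show "(\<rho> h *\<^sub>v u c) $ i = u (\<lambda>g. c (inv h \<otimes> g)) $ i" using i by (simp add: u_def)
  qed (use Rc[OF h] in \<open>auto simp: u_def\<close>)
  ultimately have "invariant_subspace G n \<rho> W"
    unfolding invariant_subspace_def W_def by (auto simp: image_iff)
  moreover have "W \<noteq> {0\<^sub>v n}"
  proof -
    have "u (\<lambda>g. if g = \<one> then 1 else 0) $ 0 = (\<Sum>g\<in>carrier G. if g = \<one> then a g 0 else 0)"
      using n by (auto simp: u_def intro!: sum.cong)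
    also have "\<dots> = 1" using fin mat_repD(3)[OF R] n by (simp add: a_def)
    finally have "u (\<lambda>g. if g = \<one> then 1 else 0) \<noteq> 0\<^sub>v n" using n by auto
    then show ?thesis unfolding W_def by blast
  qed
  ultimately have W: "W = carrier_vec n" using irrW by blast
  have "\<exists>c. u c = unit_vec n i" for i
  proof -
    have "unit_vec n i \<in> W" unfolding W by simp
    then show ?thesis unfolding W_def by (metis imageE)
  qed
  then obtain c where c: "\<And>i. u (c i) = unit_vec n i" by metis
  define N where "N = card (carrier G)"
  obtain e where e: "bij_betw e {0..<N} (carrier G)"
    unfolding N_def using ex_bij_betw_nat_finite[OF fin] by blast
  \<comment> \<open>\<open>S\<close> has the spanning vectors as columns and \<open>D\<close>
    expresses the unit vectors in them, so \<open>S D = 1\<close>. Then \<open>D S\<close> is an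
    idempotent of size \<open>N\<close> with trace \<open>n\<close>, whence
    \<open>n \<le> N\<close>.\<close>
  define S where "S = mat n N (\<lambda>(i, j). a (e j) i)"
  define D where "D = mat N n (\<lambda>(j, i). c i (e j))"
  have S: "S \<in> carrier_mat n N" and D: "D \<in> carrier_mat N n" by (simp_all add: S_def D_def)
  have SD: "S * D = 1\<^sub>m n"
  proof (rule eq_matI)
    fix i j assume "i < dim_row (1\<^sub>m n :: complex mat)" "j < dim_col (1\<^sub>m n :: complex mat)"
    then have ij: "i < n" "j < n" by auto
    have "(S * D) $$ (i, j) = (\<Sum>l<N. S $$ (i, l) * D $$ (l, j))"
      by (rule mat_mult_index[OF S D ij])
    also have "\<dots> = (\<Sum>l\<in>{0..<N}. c j (e l) * a (e l) i)"
      using ij by (auto simp: S_def D_def lessThan_atLeast0 intro!: sum.cong)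
    also have "\<dots> = (\<Sum>g\<in>carrier G. c j g * a g i)"
      by (rule sum.reindex_bij_betw[OF e])
    also have "\<dots> = u (c j) $ i" using ij by (simp add: u_def)
    also have "\<dots> = 1\<^sub>m n $$ (i, j)" using ij by (simp add: c)
    finally show "(S * D) $$ (i, j) = 1\<^sub>m n $$ (i, j)" .
  qed (use S D in auto)
  have "D * S * (D * S) = D * (S * (D * S))"
    by (rule assoc_mult_mat[OF D S mult_carrier_mat[OF D S]])
  also have "S * (D * S) = S * D * S" by (rule assoc_mult_mat[OF S D S, symmetric])
  finally have "idempotent_mat N (D * S)" using SD S D by (simp add: idempotent_mat_def)
  moreover have "idempotent_rank (D * S) = n"
    by (rule idempotent_rankI) (simp add: mat_trace_mult_comm[OF D S] SD mat_trace_one)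
  ultimately show ?thesis using idempotent_rank_le N_def by metis
qed

text \<open>On an eigenvector of \<open>\<rho> g\<close> the power \<open>g [^] |G| = \<one>\<close>
  acts both as the identity and as the power of the eigenvalue.\<close>

lemma character_values:
  assumes fin: "finite (carrier G)" and R: "mat_rep G n \<rho>" and g: "g \<in> carrier G"
  obtains es where "length es = n" "mat_trace (\<rho> g) = sum_list es"
    "\<And>e. e \<in> set es \<Longrightarrow> e ^ card (carrier G) = 1"
proof -
  obtain es where es: "length es = n" "mat_trace (\<rho> g) = sum_list es"
    "\<And>e. e \<in> set es \<longleftrightarrow> eigenvalue (\<rho> g) e"
    using mat_trace_eigenvalues[OF mat_repD(1)[OF R g]] by metis
  have "e ^ card (carrier G) = 1" if e: "e \<in> set es" for e
  proof -
    have "eigenvalue (\<rho> g) e" using es(3) e by simp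
    then obtain v where v: "v \<in> carrier_vec n" "v \<noteq> 0\<^sub>v n" "\<rho> g *\<^sub>v v = e \<cdot>\<^sub>v v"
      by (rule eigenvalue_vecE[OF mat_repD(1)[OF R g]])
    have pow: "\<rho> (g [^] k) *\<^sub>v v = e ^ k \<cdot>\<^sub>v v" for k :: nat
    proof (induction k)
      case 0
      then show ?case using mat_repD(3)[OF R] v(1) by simp
    next
      case (Suc k)
      have gk: "g [^] k \<in> carrier G" using g by simp
      have "\<rho> (g [^] Suc k) *\<^sub>v v = (\<rho> (g [^] k) * \<rho> g) *\<^sub>v v"
        using mat_repD(2)[OF R gk g] by simp
      also have "\<dots> = \<rho> (g [^] k) *\<^sub>v (e \<cdot>\<^sub>v v)"
        using assoc_mult_mat_vec[OF mat_repD(1)[OF R gk] mat_repD(1)[OF R g] v(1)] v(3) by simp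
      also have "\<dots> = e \<cdot>\<^sub>v (\<rho> (g [^] k) *\<^sub>v v)"
        by (rule mult_mat_vec[OF mat_repD(1)[OF R gk] v(1)])
      also have "\<dots> = e ^ Suc k \<cdot>\<^sub>v v" using Suc by (simp add: smult_smult_assoc)
      finally show ?case .
    qed
    have "g [^] card (carrier G) = \<one>"
      using pow_order_eq_1[OF g] by (simp add: Coset.order_def)
    then have eq: "v = e ^ card (carrier G) \<cdot>\<^sub>v v"
      using pow[of "card (carrier G)"] mat_repD(3)[OF R] v(1) by simp
    obtain i where i: "i < n" "v $ i \<noteq> 0"
      using v(1,2) by (metis carrier_vecD eq_vecI index_zero_vec)
    have "v $ i = e ^ card (carrier G) * v $ i"
      using arg_cong[OF eq, of "\<lambda>w. w $ i"] i v(1) by simp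
    then show ?thesis using i(2) by simp
  qed
  then show ?thesis using that es(1,2) by blast
qed

text \<open>The values are sums of at most \<open>|G|\<close> roots of unity of order dividing
  \<open>|G|\<close>, so only finitely many functions on the group arise. Finiteness gives
  \<open>card\<close> and sums over \<open>irr_chars G\<close> their intended meaning.\<close>

lemma finite_irr_chars:
  assumes fin: "finite (carrier G)"
  shows "finite (irr_chars G)"
proof -
  define N where "N = card (carrier G)"
  define U where "U = {z :: complex. z ^ N = 1}"
  define V where "V = sum_list ` {es. set es \<subseteq> U \<and> length es \<le> N}"
  have "N > 0" using fin by (auto simp: N_def card_gt_0_iff)
  then have "finite U" unfolding U_def by (intro finite_roots_unity) simp
  then have "finite V" unfolding V_def by (intro finite_imageI finite_lists_length_le)
  then have "finite (PiE (carrier G) (\<lambda>_. V))" using fin by (intro finite_PiE)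
  moreover have "irr_chars G \<subseteq> PiE (carrier G) (\<lambda>_. V)"
  proof
    fix \<chi> assume "\<chi> \<in> irr_chars G"
    then obtain n \<rho> where \<chi>: "\<chi> = character_of G \<rho>" and irr: "is_irreducible_representation G n \<rho>"
      by (auto simp: irr_chars_def)
    have R: "mat_rep G n \<rho>" using irr by (simp add: irreducible_iff)
    have "mat_trace (\<rho> g) \<in> V" if g: "g \<in> carrier G" for g
    proof -
      obtain es where "length es = n" "mat_trace (\<rho> g) = sum_list es"
        "\<And>e. e \<in> set es \<Longrightarrow> e ^ card (carrier G) = 1"
        using character_values[OF fin R g] by metis
      then show ?thesis using irreducible_degree_le[OF fin irr] by (auto simp: V_def U_def N_def)
    qed
    then show "\<chi> \<in> PiE (carrier G) (\<lambda>_. V)" by (auto simp: \<chi> character_of_def)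
  qed
  ultimately show ?thesis by (rule rev_finite_subset)
qed

text \<open>Translation by \<open>x\<close> permutes \<open>H\<close>, so the product of all values
  of \<open>\<gamma>\<close> is unchanged and yet multiplied by \<open>\<gamma> x\<close> to the
  power \<open>|H|\<close>.\<close>

lemma lin_char_pow_card:
  assumes fin: "finite (carrier G)" and H: "subgroup H G" and \<gamma>: "\<gamma> \<in> lin_chars G H" and x: "x \<in> H"
  shows "\<gamma> x ^ card H = 1"
proof -
  have "bij_betw (\<lambda>y. x \<otimes> y) H H" by (rule left_mult_bij[OF x H])
  then have "(\<Prod>y\<in>H. \<gamma> y) = (\<Prod>y\<in>H. \<gamma> (x \<otimes> y))"
    by (rule prod.reindex_bij_betw[symmetric])
  also have "\<dots> = (\<Prod>y\<in>H. \<gamma> x * \<gamma> y)"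
    by (rule prod.cong) (use lin_charsD(2)[OF \<gamma> x] in auto)
  also have "\<dots> = \<gamma> x ^ card H * (\<Prod>y\<in>H. \<gamma> y)"
    by (simp add: prod.distrib)
  finally show ?thesis
    using lin_charsD(1)[OF \<gamma>] finite_subset[OF subgroup.subset[OF H] fin] by (simp add: prod_zero_iff)
qed

lemma finite_lin_chars:
  assumes fin: "finite (carrier G)" and H: "subgroup H G"
  shows "finite (lin_chars G H)"
proof -
  have finH: "finite H" using finite_subset[OF subgroup.subset[OF H] fin] .
  moreover have "card H \<ge> 1"
    using subgroup.one_closed[OF H] finH by (metis One_nat_def Suc_leI card_gt_0_iff empty_iff)
  ultimately have "finite (PiE H (\<lambda>_. {z :: complex. z ^ card H = 1}))"
    by (intro finite_PiE finite_roots_unity)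
  moreover have "lin_chars G H \<subseteq> PiE H (\<lambda>_. {z. z ^ card H = 1})"
    using lin_char_pow_card[OF fin H] lin_charsD(3)[of _ G H] by (auto simp: PiE_iff intro: extensional_arb)
  ultimately show ?thesis by (rule rev_finite_subset)
qed

end

section \<open>Sylow subgroups\<close>

lemma coprime_roots_of_unity:
  fixes z :: complex
  assumes "z ^ a = 1" "z ^ b = 1" "coprime a b" "a \<noteq> 0"
  shows "z = 1"
proof -
  obtain x y where xy: "a * x = b * y + 1"
    using bezout_nat[OF assms(4), of b] assms(3) by auto
  have "z ^ (a * x) = z ^ (b * y) * z" using xy by simp
  then show ?thesis using assms(1,2) by (simp add: power_mult)
qed

context group
begin

lemma card_cosets:
  assumes fin: "finite (carrier G)" and H: "subgroup H G" and K: "subgroup K G" "K \<subseteq> H"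
  shows "card ((\<lambda>x. K #> x) ` H) * card K = card H"
proof -
  interpret H: group "G\<lparr>carrier := H\<rparr>" by (rule subgroup_imp_group[OF H])
  have "rcosets\<^bsub>G\<lparr>carrier := H\<rparr>\<^esub> K = (\<lambda>x. K #> x) ` H"
    by (auto simp: RCOSETS_def r_coset_def)
  then show ?thesis using H.lagrange[OF subgroup_incl[OF K(1) H K(2)]] by (simp add: Coset.order_def)
qed

lemma rcosets_image: "rcosets K = (\<lambda>x. K #> x) ` carrier G"
  by (auto simp: RCOSETS_def)

lemma card_rcosets:
  assumes "finite (carrier G)" "subgroup K G"
  shows "card (rcosets K) * card K = card (carrier G)"
  using card_cosets[OF assms(1) subgroup_self assms(2)] subgroup.subset[OF assms(2)]
  by (simp add: rcosets_image)

lemma subgroup_card_pos: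
  assumes "finite (carrier G)" "subgroup H G"
  shows "card H > 0"
  using finite_subset[OF subgroup.subset[OF assms(2)] assms(1)] subgroup.one_closed[OF assms(2)]
  by (metis card_gt_0_iff empty_iff)

lemma subgroup_pow_card:
  assumes "finite (carrier G)" "subgroup H G" "x \<in> H"
  shows "x [^] card H = \<one>"
proof -
  interpret H: group "G\<lparr>carrier := H\<rparr>" by (rule subgroup_imp_group[OF assms(2)])
  have "x [^]\<^bsub>G\<lparr>carrier := H\<rparr>\<^esub> card H = \<one>"
    using H.pow_order_eq_1[of x] assms(3) by (simp add: Coset.order_def)
  then show ?thesis using nat_pow_consistent by metis
qed

text \<open>The inverse of \<open>x\<close> is the power \<open>|G| - 1\<close> of \<open>x\<close>,
  so closure under products suffices.\<close>

lemma finite_subgroupI: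
  assumes fin: "finite (carrier G)" and H: "H \<subseteq> carrier G" "\<one> \<in> H"
    and m: "\<And>x y. x \<in> H \<Longrightarrow> y \<in> H \<Longrightarrow> x \<otimes> y \<in> H"
  shows "subgroup H G"
proof (rule subgroupI)
  fix x assume x: "x \<in> H"
  then have xc: "x \<in> carrier G" using H by blast
  have pow: "x [^] (k :: nat) \<in> H" for k by (induction k) (use H m x in auto)
  define N where "N = card (carrier G)"
  have "N > 0" using subgroup_card_pos[OF fin subgroup_self] by (simp add: N_def)
  then have "x [^] (N - 1) \<otimes> x = x [^] N"
    by (metis Suc_diff_1 nat_pow_Suc)
  also have "\<dots> = \<one>" unfolding N_def by (rule subgroup_pow_card[OF fin subgroup_self xc])
  finally have "inv x = x [^] (N - 1)" using xc by (intro inv_equality) auto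
  then show "inv x \<in> H" using pow by simp
qed (use assms in auto)

text \<open>The fibres of \<open>g \<mapsto> act g x\<close> are left cosets of the stabilizer. The
  laws are asked only at \<open>x\<close> and on its orbit, since \<open>act\<close> is a total
  function that is an action only on some invariant set.\<close>

lemma card_orbit:
  assumes fin: "finite (carrier G)" and H: "subgroup H G"
    and one: "act \<one> x = x"
    and m: "\<And>g h. g \<in> H \<Longrightarrow> h \<in> H \<Longrightarrow> act (g \<otimes> h) x = act g (act h x)"
    and inj: "\<And>g y z. g \<in> H \<Longrightarrow> y \<in> (\<lambda>g. act g x) ` H \<Longrightarrow> z \<in> (\<lambda>g. act g x) ` H \<Longrightarrow>
      act g y = act g z \<Longrightarrow> y = z"
  shows "card ((\<lambda>g. act g x) ` H) * card {g \<in> H. act g x = x} = card H"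
proof -
  interpret H: subgroup H G by fact
  have finH: "finite H" using finite_subset[OF H.subset fin] .
  have xO: "x \<in> (\<lambda>g. act g x) ` H"
    by (rule image_eqI[of _ _ \<one>]) (use one H.one_closed in simp_all)
  have fib: "card {h \<in> H. act h x = act g x} = card {h \<in> H. act h x = x}" if g: "g \<in> H" for g
  proof -
    have "bij_betw (\<lambda>h. g \<otimes> h) {h \<in> H. act h x = x} {h \<in> H. act h x = act g x}"
    proof (rule bij_betwI[of _ _ _ "\<lambda>h. inv g \<otimes> h"])
      show "(\<lambda>h. g \<otimes> h) \<in> {h \<in> H. act h x = x} \<rightarrow> {h \<in> H. act h x = act g x}"
        using g m by auto
      show "(\<lambda>h. inv g \<otimes> h) \<in> {h \<in> H. act h x = act g x} \<rightarrow> {h \<in> H. act h x = x}"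
      proof
        fix h assume "h \<in> {h \<in> H. act h x = act g x}"
        then have h: "h \<in> H" "act h x = act g x" by auto
        have gh: "inv g \<otimes> h \<in> H" using g h(1) by simp
        have "act g (act (inv g \<otimes> h) x) = act (g \<otimes> (inv g \<otimes> h)) x" using m[OF g gh] by simp
        also have "\<dots> = act g x" using g h by (simp add: m_assoc[symmetric])
        finally have "act (inv g \<otimes> h) x = x" using inj[OF g _ xO] gh by blast
        then show "inv g \<otimes> h \<in> {h \<in> H. act h x = x}" using gh by simp
      qed
    qed (use g in \<open>auto simp: m_assoc[symmetric]\<close>)
    then show ?thesis by (rule bij_betw_same_card[symmetric])
  qed
  have "card H = (\<Sum>y\<in>(\<lambda>g. act g x) ` H. card {h \<in> H. act h x = y})"
    using sum.image_gen[OF finH, of "\<lambda>_. 1::nat" "\<lambda>g. act g x"] by simp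
  also have "\<dots> = (\<Sum>y\<in>(\<lambda>g. act g x) ` H. card {h \<in> H. act h x = x})"
    by (rule sum.cong) (use fib in auto)
  finally show ?thesis by simp
qed

text \<open>The moved points fall into orbits whose sizes divide \<open>p ^ k\<close> and exceed
  1.\<close>

lemma p_group_nonfixed:
  assumes fin: "finite (carrier G)" and H: "subgroup H G" "card H = p ^ k" and p: "Factorial_Ring.prime p"
    and E: "finite E" and act: "\<And>g x. g \<in> H \<Longrightarrow> x \<in> E \<Longrightarrow> act g x \<in> E"
    and one: "\<And>x. x \<in> E \<Longrightarrow> act \<one> x = x"
    and m: "\<And>g h x. g \<in> H \<Longrightarrow> h \<in> H \<Longrightarrow> x \<in> E \<Longrightarrow> act (g \<otimes> h) x = act g (act h x)"
  shows "p dvd card {x \<in> E. \<exists>g\<in>H. act g x \<noteq> x}"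
proof -
  interpret H: subgroup H G by fact
  define N where "N = {x \<in> E. \<exists>g\<in>H. act g x \<noteq> x}"
  define orb where "orb x = (\<lambda>g. act g x) ` H" for x
  have inv: "act (inv g) (act g x) = x" if "g \<in> H" "x \<in> E" for g x
    using m[of "inv g" g x] that one by simp
  have inj: "y = z" if "g \<in> H" "y \<in> E" "z \<in> E" "act g y = act g z" for g y z
    using inv[OF that(1,2)] inv[OF that(1,3)] that(4) by metis
  have orbE: "orb x \<subseteq> E" if "x \<in> E" for x using that act by (auto simp: orb_def)
  have self: "x \<in> orb x" if "x \<in> E" for x
    unfolding orb_def by (rule image_eqI[of _ _ \<one>]) (use one[OF that] H.one_closed in simp_all)
  have orb_eq: "orb y = orb x" if x: "x \<in> E" and y: "y \<in> orb x" for x y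
  proof -
    obtain g where g: "g \<in> H" "y = act g x" using y by (auto simp: orb_def)
    show ?thesis
    proof
      show "orb y \<subseteq> orb x" using g m x by (auto simp: orb_def image_iff) (metis H.m_closed)
      show "orb x \<subseteq> orb y"
      proof
        fix z assume "z \<in> orb x"
        then obtain h where h: "h \<in> H" "z = act h x" by (auto simp: orb_def)
        have "z = act h (act (inv g) y)" using inv[OF g(1) x] g h by simp
        also have "\<dots> = act (h \<otimes> inv g) y"
          using m[of h "inv g" y] h g act x by simp
        finally show "z \<in> orb y" unfolding orb_def using h g by blast
      qed
    qed
  qed
  have orbN: "orb x \<subseteq> N" if x: "x \<in> N" for x
  proof
    fix y assume y: "y \<in> orb x"
    have xE: "x \<in> E" using x by (simp add: N_def)
    show "y \<in> N"
    proof (rule ccontr)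
      assume "y \<notin> N"
      have yE: "y \<in> E" using y orbE[OF xE] by blast
      have "\<forall>g\<in>H. act g y = y" using \<open>y \<notin> N\<close> yE by (auto simp: N_def)
      then have "orb y \<subseteq> {y}" by (auto simp: orb_def)
      then have "orb y = {y}" using self[OF yE] by blast
      then have "orb x = {y}" using orb_eq[OF xE y] by simp
      then have "\<forall>g\<in>H. act g x = x" using self[OF xE] by (auto simp: orb_def)
      then show False using x by (auto simp: N_def)
    qed
  qed
  have "\<Union>(orb ` N) = N" using orbN self by (auto simp: N_def)
  moreover have "p dvd card c" if c: "c \<in> orb ` N" for c
  proof -
    obtain x where x: "x \<in> N" "c = orb x" using c by blast
    have xE: "x \<in> E" using x by (simp add: N_def)
    have "card (orb x) * card {g \<in> H. act g x = x} = card H"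
      unfolding orb_def
      by (rule card_orbit[OF fin H(1) one[OF xE] m[OF _ _ xE]])
        (use inj orbE[OF xE] in \<open>unfold orb_def, blast+\<close>)
    then have "card (orb x) dvd p ^ k" using H(2) by (metis dvd_triv_left)
    then obtain i where i: "card (orb x) = p ^ i"
      using divides_primepow_nat[OF p] by blast
    have "i \<noteq> 0"
    proof
      assume "i = 0"
      then have "card (orb x) = 1" using i by simp
      then obtain y where "orb x = {y}" by (auto simp: card_1_singleton_iff)
      then have "\<forall>g\<in>H. act g x = x" using self[OF xE] by (auto simp: orb_def)
      then show False using x by (auto simp: N_def)
    qed
    then show ?thesis using i x by simp
  qed
  moreover have "c1 \<inter> c2 = {}" if c: "c1 \<in> orb ` N" "c2 \<in> orb ` N" "c1 \<noteq> c2" for c1 c2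
  proof (rule ccontr)
    assume "c1 \<inter> c2 \<noteq> {}"
    then obtain y where y: "y \<in> c1" "y \<in> c2" by blast
    obtain x1 x2 where "x1 \<in> E" "c1 = orb x1" "x2 \<in> E" "c2 = orb x2" using c by (auto simp: N_def)
    then show False using orb_eq y c(3) by metis
  qed
  moreover have "finite N" using E by (simp add: N_def)
  ultimately have "p dvd card (\<Union>(orb ` N))" by (intro dvd_partition) auto
  then show ?thesis using \<open>\<Union>(orb ` N) = N\<close> by (simp add: N_def)
qed

text \<open>\<open>S\<close> acts on the cosets of \<open>P\<close> in \<open>N\<close>, whose
  number is prime to \<open>p\<close>, so it fixes some \<open>P n\<close>; then \<open>n\<close>
  conjugates \<open>S\<close> into \<open>P\<close>. The Frattini argument relies on
  \<open>n\<close> being in \<open>N\<close>.\<close>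

lemma sylow_conj:
  assumes fin: "finite (carrier G)" and p: "Factorial_Ring.prime p"
    and P: "subgroup P G" "\<not> p dvd card (rcosets P)"
    and N: "subgroup N G" "P \<subseteq> N" and S: "subgroup S G" "S \<subseteq> N" "card S = p ^ k"
  obtains n where "n \<in> N" "\<And>s. s \<in> S \<Longrightarrow> n \<otimes> s \<otimes> inv n \<in> P"
proof -
  interpret P: subgroup P G by fact
  interpret N: subgroup N G by fact
  interpret S: subgroup S G by fact
  define E where "E = (\<lambda>x. P #> x) ` N"
  have finE: "finite E" using finite_subset[OF N.subset fin] by (simp add: E_def)
  have "card (rcosets N) * card E * card P = card (rcosets P) * card P"
    using card_cosets[OF fin N(1) P(1) N(2)] card_rcosets[OF fin N(1)] card_rcosets[OF fin P(1)]
    by (simp add: E_def mult.assoc)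
  then have "card (rcosets N) * card E = card (rcosets P)"
    using subgroup_card_pos[OF fin P(1)] by simp
  then have pE: "\<not> p dvd card E" using P(2) by (metis dvd_mult)
  \<comment> \<open>The inverse turns right multiplication into a left action.\<close>
  have "p dvd card {C \<in> E. \<exists>s\<in>S. C #> inv s \<noteq> C}"
  proof (rule p_group_nonfixed[OF fin S(1,3) p finE, of "\<lambda>s C. C #> inv s"])
    show "C #> inv s \<in> E" if s: "s \<in> S" and C: "C \<in> E" for s C
    proof -
      obtain n where n: "n \<in> N" "C = P #> n" using C by (auto simp: E_def)
      have "C #> inv s = P #> (n \<otimes> inv s)" using n s by (simp add: coset_mult_assoc P.subset)
      moreover have "n \<otimes> inv s \<in> N" using n s S(2) by blast
      ultimately show ?thesis by (simp add: E_def)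
    qed
    show "C #> inv \<one> = C" if "C \<in> E" for C
      using that by (auto simp: E_def coset_mult_assoc P.subset)
    show "C #> inv (g \<otimes> h) = C #> inv h #> inv g" if "g \<in> S" "h \<in> S" "C \<in> E" for g h C
      using that by (auto simp: E_def coset_mult_assoc P.subset inv_mult_group m_assoc)
  qed
  then have "{C \<in> E. \<exists>s\<in>S. C #> inv s \<noteq> C} \<noteq> E" using pE by metis
  then obtain C where C: "C \<in> E" "\<And>s. s \<in> S \<Longrightarrow> C #> inv s = C" by blast
  then obtain n where n: "n \<in> N" "C = P #> n" by (auto simp: E_def)
  have "n \<otimes> s \<otimes> inv n \<in> P" if s: "s \<in> S" for s
  proof -
    have "C #> s = C" using C(2)[OF S.m_inv_closed[OF s]] s by simp
    then have "P #> (n \<otimes> s) = P #> n" using n s by (simp add: coset_mult_assoc P.subset)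
    then have "n \<otimes> s \<in> P #> n" using rcos_self[of "n \<otimes> s" P] n s P(1) by simp
    then obtain u where "u \<in> P" "n \<otimes> s = u \<otimes> n" by (auto simp: r_coset_def)
    then show ?thesis using n by (simp add: m_assoc)
  qed
  then show ?thesis using that n by blast
qed

text \<open>Only one inclusion is recorded; for finite \<open>P\<close> it is an equality because
  conjugation is injective.\<close>

definition normalizer_of :: "'a set \<Rightarrow> 'a set" where
  "normalizer_of P = {x \<in> carrier G. \<forall>u\<in>P. x \<otimes> u \<otimes> inv x \<in> P}"

lemma subgroup_normalizer_of:
  assumes fin: "finite (carrier G)" and P: "subgroup P G"
  shows "subgroup (normalizer_of P) G"
proof (rule finite_subgroupI[OF fin])
  interpret P: subgroup P G by fact
  show "\<one> \<in> normalizer_of P" by (auto simp: normalizer_of_def)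
  fix x y assume x: "x \<in> normalizer_of P" and y: "y \<in> normalizer_of P"
  have "x \<otimes> y \<otimes> u \<otimes> inv (x \<otimes> y) \<in> P" if "u \<in> P" for u
  proof -
    have "x \<otimes> (y \<otimes> u \<otimes> inv y) \<otimes> inv x \<in> P" using x y that by (auto simp: normalizer_of_def)
    moreover have "x \<otimes> (y \<otimes> u \<otimes> inv y) \<otimes> inv x = x \<otimes> y \<otimes> u \<otimes> inv (x \<otimes> y)"
      using x y that by (simp add: normalizer_of_def m_assoc inv_mult_group)
    ultimately show ?thesis by simp
  qed
  then show "x \<otimes> y \<in> normalizer_of P" using x y by (auto simp: normalizer_of_def)
qed (auto simp: normalizer_of_def)

text \<open>Frattini argument for the kernel of \<open>l\<close>.\<close>

lemma lin_char_trivial_on_normalizer: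
  assumes fin: "finite (carrier G)" and p: "Factorial_Ring.prime p"
    and P: "subgroup P G" "\<not> p dvd card (rcosets P)" "card P = p ^ k"
    and l: "l \<in> lin_chars G (carrier G)" and triv: "\<And>x. x \<in> normalizer_of P \<Longrightarrow> l x = 1"
    and g: "g \<in> carrier G"
  shows "l g = 1"
proof -
  interpret P: subgroup P G by fact
  have lm: "l (x \<otimes> y) = l x * l y" if "x \<in> carrier G" "y \<in> carrier G" for x y
    using lin_charsD(2)[OF l that] .
  have li: "l (inv x) = inverse (l x)" if "x \<in> carrier G" for x
    using lin_char_inv[OF l subgroup_self that] .
  have l1: "l \<one> = 1" by (rule lin_char_one[OF l subgroup_self])
  define N where "N = {x \<in> carrier G. l x = 1}"
  have N: "subgroup N G"
    by (rule finite_subgroupI[OF fin]) (auto simp: N_def lm l1)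
  have PN: "P \<subseteq> N" using triv by (auto simp: N_def normalizer_of_def)
  \<comment> \<open>The conjugate of \<open>P\<close> by \<open>g\<close> lies in the kernel
    \<open>N\<close>, since the values of \<open>l\<close> are invariant under conjugation.
    Conjugating it back into \<open>P\<close> by some \<open>n\<close> in \<open>N\<close> puts
    \<open>n \<otimes> g\<close> into the normalizer, where \<open>l\<close> is trivial.\<close>
  define S where "S = (\<lambda>u. g \<otimes> u \<otimes> inv g) ` P"
  have S: "subgroup S G"
  proof (rule finite_subgroupI[OF fin])
    show "S \<subseteq> carrier G" using g by (auto simp: S_def)
    show "\<one> \<in> S" unfolding S_def using g P.one_closed by (intro image_eqI[of _ _ \<one>]) auto
    fix x y assume "x \<in> S" "y \<in> S"
    then obtain u v where uv: "u \<in> P" "v \<in> P" "x = g \<otimes> u \<otimes> inv g" "y = g \<otimes> v \<otimes> inv g"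
      by (auto simp: S_def)
    have "inv g \<otimes> (g \<otimes> (v \<otimes> inv g)) = v \<otimes> inv g" using g uv(2) by (simp add: m_assoc[symmetric])
    then have "x \<otimes> y = g \<otimes> (u \<otimes> v) \<otimes> inv g" using uv g by (simp add: m_assoc)
    then show "x \<otimes> y \<in> S" using uv by (auto simp: S_def)
  qed
  have "inj_on (\<lambda>u. g \<otimes> u \<otimes> inv g) P" using g by (intro inj_onI) simp
  then have "card S = p ^ k" using P(3) by (simp add: S_def card_image)
  moreover have "S \<subseteq> N"
  proof
    fix x assume "x \<in> S"
    then obtain u where u: "u \<in> P" "x = g \<otimes> u \<otimes> inv g" by (auto simp: S_def)
    have "l u = 1" using u PN by (auto simp: N_def)
    moreover have "l g \<noteq> 0" using lin_charsD(1)[OF l g] .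
    ultimately have "l x = 1" using u g by (simp add: lm li)
    then show "x \<in> N" using u g by (simp add: N_def)
  qed
  ultimately obtain n where n: "n \<in> N" "\<And>s. s \<in> S \<Longrightarrow> n \<otimes> s \<otimes> inv n \<in> P"
    using sylow_conj[OF fin p P(1,2) N PN S] by metis
  have nc: "n \<in> carrier G" using n by (simp add: N_def)
  have "n \<otimes> g \<in> normalizer_of P"
    unfolding normalizer_of_def
  proof (safe)
    fix u assume u: "u \<in> P"
    have "n \<otimes> (g \<otimes> u \<otimes> inv g) \<otimes> inv n \<in> P" using n(2) u by (auto simp: S_def)
    moreover have "n \<otimes> (g \<otimes> u \<otimes> inv g) \<otimes> inv n = n \<otimes> g \<otimes> u \<otimes> inv (n \<otimes> g)"
      using nc g u by (simp add: m_assoc inv_mult_group)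
    ultimately show "n \<otimes> g \<otimes> u \<otimes> inv (n \<otimes> g) \<in> P" by simp
  qed (use nc g in auto)
  then have "l (n \<otimes> g) = 1" by (rule triv)
  then show ?thesis using n nc g by (simp add: lm N_def)
qed

end

section \<open>Transfer\<close>

context group
begin

text \<open>Transfer maps are products of this form. The representative is chosen by
  \<open>SOME\<close>; the value does not depend on it when \<open>F\<close> is constant on the
  cosets of \<open>K\<close>.\<close>

definition coset_prod :: "'a set \<Rightarrow> 'a set \<Rightarrow> ('a \<Rightarrow> complex) \<Rightarrow> complex" where
  "coset_prod H K F = (\<Prod>C\<in>(\<lambda>x. K #> x) ` H. F (SOME x. x \<in> C))"

lemma coset_rep:
  assumes K: "subgroup K G" and x: "x \<in> carrier G"
  obtains u where "u \<in> K" "(SOME y. y \<in> K #> x) = u \<otimes> x"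
proof -
  have "(SOME y. y \<in> K #> x) \<in> K #> x" using rcos_self[OF x K] by (rule someI)
  then show ?thesis using that by (auto simp: r_coset_def)
qed

lemma coset_prod_cong:
  assumes H: "subgroup H G" and K: "subgroup K G" "K \<subseteq> H"
    and "\<And>x. x \<in> H \<Longrightarrow> F x = F' x"
  shows "coset_prod H K F = coset_prod H K F'"
  unfolding coset_prod_def
proof (rule prod.cong)
  fix C assume "C \<in> (\<lambda>x. K #> x) ` H"
  then obtain x where x: "x \<in> H" "C = K #> x" by blast
  obtain u where u: "u \<in> K" "(SOME y. y \<in> C) = u \<otimes> x"
    using coset_rep[OF K(1) subgroup.mem_carrier[OF H x(1)]] x(2) by metis
  have "u \<otimes> x \<in> H" using u x K H by (auto intro: subgroup.m_closed)
  then show "F (SOME y. y \<in> C) = F' (SOME y. y \<in> C)" using u assms(4) by simp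
qed simp

text \<open>Right multiplication by \<open>h\<close> permutes the cosets of \<open>K\<close> in
  \<open>H\<close>, and \<open>F\<close> depends on the coset only.\<close>

lemma coset_prod_shift:
  assumes H: "subgroup H G" and K: "subgroup K G" "K \<subseteq> H"
    and F: "\<And>u x. u \<in> K \<Longrightarrow> x \<in> H \<Longrightarrow> F (u \<otimes> x) = F x" and h: "h \<in> H"
  shows "coset_prod H K (\<lambda>x. F (x \<otimes> h)) = coset_prod H K F"
proof -
  interpret H: subgroup H G by fact
  interpret K: subgroup K G by fact
  let ?E = "(\<lambda>x. K #> x) ` H"
  have rep: "F (SOME y. y \<in> K #> x) = F x" if x: "x \<in> H" for x
  proof -
    obtain u where "u \<in> K" "(SOME y. y \<in> K #> x) = u \<otimes> x"
      using coset_rep[OF K(1), of x] x by auto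
    then show ?thesis using F x by simp
  qed
  have bij: "bij_betw (\<lambda>C. C #> h) ?E ?E"
  proof (rule bij_betwI[of _ _ _ "\<lambda>C. C #> inv h"])
    show "(\<lambda>C. C #> h) \<in> ?E \<rightarrow> ?E" using h by (auto simp: coset_mult_assoc K.subset)
    show "(\<lambda>C. C #> inv h) \<in> ?E \<rightarrow> ?E" using h by (auto simp: coset_mult_assoc K.subset)
  qed (use h in \<open>auto simp: coset_mult_assoc K.subset m_assoc\<close>)
  have "coset_prod H K F = (\<Prod>C\<in>?E. F (SOME y. y \<in> C #> h))"
    unfolding coset_prod_def by (rule prod.reindex_bij_betw[OF bij, symmetric])
  also have "\<dots> = (\<Prod>C\<in>?E. F ((SOME y. y \<in> C) \<otimes> h))"
  proof (rule prod.cong)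
    fix C assume "C \<in> ?E"
    then obtain x where x: "x \<in> H" "C = K #> x" by blast
    obtain u where u: "u \<in> K" "(SOME y. y \<in> C) = u \<otimes> x"
      using coset_rep[OF K(1), of x] x by auto
    have "C #> h = K #> (x \<otimes> h)" using x h by (simp add: coset_mult_assoc K.subset)
    then have "F (SOME y. y \<in> C #> h) = F (x \<otimes> h)" using rep x h by simp
    also have "\<dots> = F (u \<otimes> (x \<otimes> h))" using F u x h by simp
    also have "u \<otimes> (x \<otimes> h) = (SOME y. y \<in> C) \<otimes> h" using u x h by (simp add: m_assoc)
    finally show "F (SOME y. y \<in> C #> h) = F ((SOME y. y \<in> C) \<otimes> h)" .
  qed simp
  finally show ?thesis by (simp add: coset_prod_def)
qed

lemma coset_prod_mult: "coset_prod H K (\<lambda>x. F x * F' x) = coset_prod H K F * coset_prod H K F'"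
  by (simp add: coset_prod_def prod.distrib)

lemma coset_prod_const: "coset_prod H K (\<lambda>x. c) = c ^ card ((\<lambda>x. K #> x) ` H)"
  by (simp add: coset_prod_def)

lemma coset_prod_power: "coset_prod H K F ^ n = coset_prod H K (\<lambda>x. F x ^ n)"
  by (simp add: coset_prod_def prod_power_distrib)

lemma coset_prod_nonzero:
  assumes fin: "finite (carrier G)" and H: "subgroup H G" and K: "subgroup K G" "K \<subseteq> H"
    and nz: "\<And>x. x \<in> H \<Longrightarrow> F x \<noteq> 0"
  shows "coset_prod H K F \<noteq> 0"
proof -
  have "coset_prod H K F = coset_prod H K (\<lambda>x. if F x = 0 then 1 else F x)"
    by (rule coset_prod_cong[OF H K]) (use nz in auto)
  moreover have "finite H" using finite_subset[OF subgroup.subset[OF H] fin] .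
  ultimately show ?thesis by (simp add: coset_prod_def prod_zero_iff)
qed

section \<open>The subgroup \<open>O\<^sup>p(G)\<close> and its index\<close>

lemma lin_char_pow:
  assumes \<gamma>: "\<gamma> \<in> lin_chars G H" and H: "subgroup H G" and x: "x \<in> H"
  shows "\<gamma> (x [^] (n :: nat)) = \<gamma> x ^ n"
proof (induction n)
  case 0
  then show ?case using lin_char_one[OF \<gamma> H] by simp
next
  case (Suc n)
  have "x [^] n \<in> H"
    by (induction n) (use subgroup.one_closed[OF H] subgroup.m_closed[OF H _ x] in simp_all)
  then show ?case using lin_charsD(2)[OF \<gamma> _ x] Suc by (simp add: mult.commute)
qed

definition p_residual :: "nat \<Rightarrow> 'a set" where
  "p_residual p = generate G {x \<in> carrier G. \<exists>n. coprime n p \<and> x [^] (n :: nat) = \<one>}"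

lemma normal_p_residual: "p_residual p \<lhd> G"
  unfolding p_residual_def
proof (rule normal_generateI)
  fix h g assume h: "h \<in> {x \<in> carrier G. \<exists>n. coprime n p \<and> x [^] (n :: nat) = \<one>}" and g: "g \<in> carrier G"
  then obtain n where n: "coprime n p" "h [^] (n :: nat) = \<one>" "h \<in> carrier G" by auto
  have "(g \<otimes> h \<otimes> inv g) [^] k = g \<otimes> h [^] k \<otimes> inv g" for k :: nat
  proof (induction k)
    case (Suc k)
    have "inv g \<otimes> (g \<otimes> (h \<otimes> inv g)) = h \<otimes> inv g" using g n(3) by (simp add: m_assoc[symmetric])
    with Suc show ?case using g n(3) by (simp add: m_assoc)
  qed (use g in simp)
  then have "(g \<otimes> h \<otimes> inv g) [^] n = \<one>" using n g by simp
  then show "g \<otimes> h \<otimes> inv g \<in> {x \<in> carrier G. \<exists>n. coprime n p \<and> x [^] (n :: nat) = \<one>}"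
    using n g by auto
qed auto

text \<open>On a product of elements of order prime to \<open>p\<close> the value is a root of unity
  of order prime to \<open>p\<close>. If it is also a root of unity of \<open>p\<close>-power order,
  it is 1.\<close>

lemma p_residual_lin_char:
  assumes H: "subgroup H G" "p_residual p \<subseteq> H" and \<gamma>: "\<gamma> \<in> lin_chars G H"
    and x: "x \<in> p_residual p" "\<gamma> x ^ p ^ k = 1" and p: "Factorial_Ring.prime p"
  shows "\<gamma> x = 1"
proof -
  have "\<exists>n. coprime n p \<and> \<gamma> y ^ n = 1" if "y \<in> p_residual p" for y
    using that unfolding p_residual_def
  proof (induction rule: generate.induct)
    case one
    then show ?case using lin_char_one[OF \<gamma> H(1)] by (intro exI[of _ 1]) simp
  next
    case (incl h)
    have "h \<in> p_residual p" unfolding p_residual_def by (rule generate.incl[OF incl])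
    then have "h \<in> H" using H(2) by blast
    moreover obtain n where "coprime n p" "h [^] (n :: nat) = \<one>" using incl by auto
    ultimately show ?case
      using lin_char_pow[OF \<gamma> H(1), of h n] lin_char_one[OF \<gamma> H(1)] by auto
  next
    case (inv h)
    have "h \<in> p_residual p" unfolding p_residual_def by (rule generate.incl[OF inv])
    then have h: "h \<in> H" using H(2) by blast
    moreover obtain n where n: "coprime n p" "h [^] (n :: nat) = \<one>" using inv by auto
    ultimately have "\<gamma> h ^ n = 1"
      using lin_char_pow[OF \<gamma> H(1), of h n] lin_char_one[OF \<gamma> H(1)] by auto
    then show ?case using n lin_char_inv[OF \<gamma> H(1) h] by (auto simp: power_inverse)
  next
    case (eng h1 h2)
    then obtain n1 n2 where n: "coprime n1 p" "\<gamma> h1 ^ n1 = 1" "coprime n2 p" "\<gamma> h2 ^ n2 = 1" by auto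
    have "h1 \<in> H" "h2 \<in> H" using eng H(2) unfolding p_residual_def by auto
    then have "\<gamma> (h1 \<otimes> h2) ^ (n1 * n2) = (\<gamma> h1 ^ n1) ^ n2 * (\<gamma> h2 ^ n2) ^ n1"
      using lin_charsD(2)[OF \<gamma>] by (simp add: power_mult_distrib power_mult[symmetric] mult.commute)
    then show ?case using n by (intro exI[of _ "n1 * n2"]) simp
  qed
  then obtain n where n: "coprime n p" "\<gamma> x ^ n = 1" using x(1) by blast
  have "n \<noteq> 0" using n(1) p by (metis coprime_0_left_iff not_prime_unit)
  then show ?thesis using coprime_roots_of_unity[OF n(2) x(2)] n(1) by simp
qed

text \<open>For a prime \<open>q\<close> other than \<open>p\<close>, a Sylow
  \<open>q\<close>-subgroup consists of generators and so lies in the residual; hence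
  \<open>q\<close> does not divide the index.\<close>

lemma p_residual_index:
  assumes fin: "finite (carrier G)" and p: "Factorial_Ring.prime p"
  obtains b where "card (rcosets (p_residual p)) = p ^ b"
proof -
  define M where "M = p_residual p"
  have M: "subgroup M G" unfolding M_def using normal_p_residual by (rule normal_imp_subgroup)
  define c where "c = card (rcosets M)"
  have cM: "c * card M = card (carrier G)" unfolding c_def by (rule card_rcosets[OF fin M])
  have N0: "card (carrier G) > 0" by (rule subgroup_card_pos[OF fin subgroup_self])
  have c0: "c \<noteq> 0" using cM N0 by (metis less_irrefl mult_0)
  have q: "q = p" if q: "Factorial_Ring.prime q" "q dvd c" for q
  proof (rule ccontr)
    assume neq: "q \<noteq> p"
    obtain a m where am: "card (carrier G) = q ^ a * m" "\<not> q dvd m"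
      using multiplicity_decompose'[of "card (carrier G)" q] N0 q(1) by (metis not_prime_unit less_irrefl)
    obtain S where S: "subgroup S G" "card S = q ^ a"
      using sylow_thm[OF q(1) is_group _ fin, of a m] am(1) by (auto simp: Coset.order_def)
    have "S \<subseteq> M"
    proof
      fix x assume x: "x \<in> S"
      have "x [^] (q ^ a) = \<one>" using subgroup_pow_card[OF fin S(1) x] S(2) by simp
      moreover have "coprime (q ^ a) p" using primes_coprime[OF q(1) p neq] by simp
      ultimately show "x \<in> M"
        unfolding M_def p_residual_def using subgroup.mem_carrier[OF S(1) x]
        by (intro generate.incl CollectI conjI exI[of _ "q ^ a"])
    qed
    then have "card ((\<lambda>x. S #> x) ` M) * q ^ a = card M" using card_cosets[OF fin M S(1)] S(2) by simp
    then have "q ^ a dvd card M" using dvd_triv_right[of "q ^ a"] by metis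
    then have "q * q ^ a dvd q ^ a * m" using mult_dvd_mono[OF q(2)] cM am(1) by metis
    moreover have "q \<noteq> 0" using q(1) by auto
    ultimately have "q dvd m" by (simp add: mult.commute[of q])
    with am(2) show False by simp
  qed
  obtain b m where bm: "c = p ^ b * m" "\<not> p dvd m"
    using multiplicity_decompose'[of c p] c0 p by (metis not_prime_unit)
  have "m = 1"
  proof (rule ccontr)
    assume "m \<noteq> 1"
    then obtain r where "Factorial_Ring.prime r" "r dvd m" using prime_factor_nat by blast
    then show False using q[of r] bm by auto
  qed
  then show ?thesis using that bm(1) by (simp add: c_def M_def)
qed

text \<open>The index of \<open>M P\<close> divides a power of \<open>p\<close> and also
  \<open>|G : P|\<close>, so it is 1.\<close>

lemma normal_sylow_supplement:
  assumes fin: "finite (carrier G)" and p: "Factorial_Ring.prime p"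
    and P: "subgroup P G" "\<not> p dvd card (rcosets P)"
    and M: "M \<lhd> G" "card (rcosets M) = p ^ b" and t: "t \<in> carrier G"
  obtains u where "u \<in> P" "t \<otimes> inv u \<in> M"
proof -
  interpret P: subgroup P G by fact
  interpret M: normal M G by fact
  define K where "K = {m \<otimes> u | m u. m \<in> M \<and> u \<in> P}"
  have KI: "m \<otimes> u \<in> K" if "m \<in> M" "u \<in> P" for m u using that by (auto simp: K_def)
  have K: "subgroup K G"
  proof (rule finite_subgroupI[OF fin])
    show "K \<subseteq> carrier G" by (auto simp: K_def)
    show "\<one> \<in> K" using KI[OF M.one_closed P.one_closed] by simp
    fix x y assume "x \<in> K" "y \<in> K"
    then obtain m u m' u' where *: "m \<in> M" "u \<in> P" "x = m \<otimes> u" "m' \<in> M" "u' \<in> P" "y = m' \<otimes> u'"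
      by (auto simp: K_def)
    have "inv u \<otimes> (u \<otimes> u') = u'" using * by (simp add: m_assoc[symmetric])
    then have "x \<otimes> y = m \<otimes> (u \<otimes> m' \<otimes> inv u) \<otimes> (u \<otimes> u')" using * by (simp add: m_assoc)
    moreover have "u \<otimes> m' \<otimes> inv u \<in> M" using * by (intro M.inv_op_closed2) auto
    ultimately show "x \<otimes> y \<in> K" using * by (simp add: KI)
  qed
  have sub: "M \<subseteq> K" "P \<subseteq> K"
  proof -
    show "M \<subseteq> K"
    proof
      fix m assume "m \<in> M"
      then show "m \<in> K" using KI[OF _ P.one_closed, of m] by simp
    qed
    show "P \<subseteq> K"
    proof
      fix u assume "u \<in> P"
      then show "u \<in> K" using KI[OF M.one_closed, of u] by simp
    qed
  qed
  have "card (rcosets K) dvd card (rcosets L)" if L: "subgroup L G" "L \<subseteq> K" for L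
  proof -
    have "card (rcosets K) * card ((\<lambda>x. L #> x) ` K) * card L = card (rcosets L) * card L"
      using card_cosets[OF fin K L] card_rcosets[OF fin K] card_rcosets[OF fin L(1)]
      by (simp add: mult.assoc)
    then show ?thesis using subgroup_card_pos[OF fin L(1)] by (metis dvd_triv_left less_irrefl mult_cancel2)
  qed
  then have "card (rcosets K) dvd p ^ b" "card (rcosets K) dvd card (rcosets P)"
    using sub M(2) P(1) M.subgroup_axioms by (metis, blast)
  moreover have "coprime (p ^ b) (card (rcosets P))" using P(2) p by (simp add: prime_imp_coprime)
  ultimately have "card (rcosets K) = 1" by (metis coprime_common_divisor_nat)
  then have "card K = card (carrier G)" using card_rcosets[OF fin K] by simp
  then have "K = carrier G" using subgroup.subset[OF K] fin by (intro card_subset_eq) auto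
  then have "t \<in> K" using t by simp
  then obtain m u where "m \<in> M" "u \<in> P" "t = m \<otimes> u" unfolding K_def by blast
  then show ?thesis using that[of u] by (simp add: m_assoc)
qed

text \<open>A maximal \<open>P\<close>-invariant proper subgroup \<open>K\<close> of \<open>Q\<close> has cyclic quotient \<open>Q/K\<close>, on which
  \<open>P\<close> acts trivially; \<open>\<theta>\<close> is a faithful character of that quotient.\<close>

lemma exists_invariant_lin_char:
  assumes fin: "finite (carrier G)" and p: "Factorial_Ring.prime p"
    and P: "subgroup P G" "card P = p ^ a" and Q: "subgroup Q G" "Q \<subseteq> P" "Q \<noteq> {\<one>}"
    and inv: "\<And>u q. u \<in> P \<Longrightarrow> q \<in> Q \<Longrightarrow> u \<otimes> q \<otimes> inv u \<in> Q"
  obtains \<theta> where "\<theta> \<in> lin_chars G Q" "\<And>u q. u \<in> P \<Longrightarrow> q \<in> Q \<Longrightarrow> \<theta> (u \<otimes> q \<otimes> inv u) = \<theta> q"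
    "\<exists>q\<in>Q. \<theta> q \<noteq> 1"
proof -
  interpret P: subgroup P G by fact
  interpret Q: subgroup Q G by fact
  have finQ: "finite Q" using finite_subset[OF Q.subset fin] .
  define \<K> where "\<K> = {K. subgroup K G \<and> K \<subseteq> Q \<and> K \<noteq> Q \<and> (\<forall>u\<in>P. \<forall>k\<in>K. u \<otimes> k \<otimes> inv u \<in> K)}"
  have "{\<one>} \<in> \<K>" using triv_subgroup Q(3) by (auto simp: \<K>_def)
  moreover have "finite \<K>" using finite_subset[of \<K> "Pow Q"] finQ by (auto simp: \<K>_def)
  ultimately obtain K where K: "K \<in> \<K>" and max: "\<And>L. L \<in> \<K> \<Longrightarrow> card L \<le> card K"
    using Max_in[of "card ` \<K>"] Max_ge[of "card ` \<K>"] by (metis (no_types, lifting) empty_iff finite_imageI image_iff)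
  have KD: "subgroup K G" "K \<subseteq> Q" "K \<noteq> Q" "\<And>u k. u \<in> P \<Longrightarrow> k \<in> K \<Longrightarrow> u \<otimes> k \<otimes> inv u \<in> K"
    using K by (auto simp: \<K>_def)
  interpret K: subgroup K G by (rule KD(1))
  define E where "E = (\<lambda>x. K #> x) ` Q"
  have finE: "finite E" using finQ by (simp add: E_def)
  have EK: "card E * card K = card Q"
    unfolding E_def by (rule card_cosets[OF fin Q(1) KD(1,2)])
  have "card Q dvd p ^ a"
    using card_cosets[OF fin P(1) Q(1,2)] P(2) by (metis dvd_triv_right)
  then have "card E dvd p ^ a" using EK by (metis dvd_triv_left dvd_trans)
  then obtain i where i: "card E = p ^ i" using divides_primepow_nat[OF p] by blast
  have "card K < card Q" using KD(2,3) finQ by (intro psubset_card_mono) auto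
  then have "card E \<noteq> 1" using EK by auto
  then have "i \<noteq> 0" using i by (metis power_0)
  then have pE: "p dvd card E" using i by simp
  define act where "act u C = (\<lambda>x. u \<otimes> x \<otimes> inv u) ` C" for u and C :: "'a set"
  have act_coset: "act u (K #> x) = K #> (u \<otimes> x \<otimes> inv u)" if u: "u \<in> P" and x: "x \<in> Q" for u x
  proof
    show "act u (K #> x) \<subseteq> K #> (u \<otimes> x \<otimes> inv u)"
    proof
      fix y assume "y \<in> act u (K #> x)"
      then obtain k where k: "k \<in> K" "y = u \<otimes> (k \<otimes> x) \<otimes> inv u" by (auto simp: act_def r_coset_def)
      have "inv u \<otimes> (u \<otimes> (x \<otimes> inv u)) = x \<otimes> inv u" using u x by (simp add: m_assoc[symmetric])
      then have "y = (u \<otimes> k \<otimes> inv u) \<otimes> (u \<otimes> x \<otimes> inv u)" using k u x by (simp add: m_assoc)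
      then show "y \<in> K #> (u \<otimes> x \<otimes> inv u)" using KD(4)[OF u k(1)] by (auto simp: r_coset_def)
    qed
    show "K #> (u \<otimes> x \<otimes> inv u) \<subseteq> act u (K #> x)"
    proof
      fix y assume "y \<in> K #> (u \<otimes> x \<otimes> inv u)"
      then obtain k where k: "k \<in> K" "y = k \<otimes> (u \<otimes> x \<otimes> inv u)" by (auto simp: r_coset_def)
      have "inv u \<otimes> k \<otimes> inv (inv u) \<in> K" using KD(4) u k(1) by blast
      moreover have "y = u \<otimes> ((inv u \<otimes> k \<otimes> inv (inv u)) \<otimes> x) \<otimes> inv u"
      proof -
        have "u \<otimes> (inv u \<otimes> (k \<otimes> (u \<otimes> (x \<otimes> inv u)))) = k \<otimes> (u \<otimes> (x \<otimes> inv u))"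
          using u x k by (simp add: m_assoc[symmetric])
        then show ?thesis using u x k by (simp add: m_assoc)
      qed
      ultimately show "y \<in> act u (K #> x)" unfolding act_def r_coset_def by blast
    qed
  qed
  have NF: "p dvd card {C \<in> E. \<exists>u\<in>P. act u C \<noteq> C}"
  proof (rule p_group_nonfixed[OF fin P p finE])
    show "act u C \<in> E" if "u \<in> P" "C \<in> E" for u C
      using that act_coset inv by (auto simp: E_def)
    show "act \<one> C = C" if "C \<in> E" for C
      using that act_coset[OF P.one_closed] by (auto simp: E_def)
    show "act (g \<otimes> h) C = act g (act h C)" if g: "g \<in> P" and h: "h \<in> P" and C: "C \<in> E" for g h C
    proof -
      obtain x where x: "x \<in> Q" "C = K #> x" using C by (auto simp: E_def)
      have "g \<otimes> h \<otimes> x \<otimes> inv (g \<otimes> h) = g \<otimes> (h \<otimes> x \<otimes> inv h) \<otimes> inv g"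
        using g h x by (simp add: m_assoc inv_mult_group)
      then show ?thesis using act_coset g h x inv by simp
    qed
  qed
  \<comment> \<open>Since \<open>|E|\<close> and the number of moved cosets are divisible by
    \<open>p\<close>, so is the number of fixed ones. The coset \<open>K\<close> is fixed, hence so
    is another coset \<open>K c\<close>.\<close>
  have "card E = card {C \<in> E. \<exists>u\<in>P. act u C \<noteq> C} + card {C \<in> E. \<forall>u\<in>P. act u C = C}"
    using finE by (subst card_Un_disjoint[symmetric]) (auto intro!: arg_cong[of _ _ card])
  then have pF: "p dvd card {C \<in> E. \<forall>u\<in>P. act u C = C}"
    using pE dvd_add_right_iff[OF NF] by simp
  have "K \<in> {C \<in> E. \<forall>u\<in>P. act u C = C}"
  proof -
    have K1: "K = K #> \<one>" by (simp add: K.subset)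
    then have "K \<in> E" unfolding E_def using Q.one_closed by blast
    moreover have "act u K = K" if "u \<in> P" for u
      using act_coset[OF that Q.one_closed] K1[symmetric] that by (simp add: K1[symmetric])
    ultimately show ?thesis by blast
  qed
  moreover have "{C \<in> E. \<forall>u\<in>P. act u C = C} \<noteq> {K}"
    using pF p by (metis is_singletonI is_singleton_altdef not_prime_1 nat_dvd_1_iff_1)
  ultimately obtain C where "C \<in> E" "C \<noteq> K" "\<forall>u\<in>P. act u C = C" by blast
  then obtain c where c: "c \<in> Q" "K #> c \<noteq> K" "\<And>u. u \<in> P \<Longrightarrow> act u (K #> c) = K #> c"
    by (auto simp: E_def)
  have cP: "c \<in> P" using c(1) Q(2) by blast
  have cc: "c \<in> carrier G" using c(1) by simp
  have cK: "c \<notin> K" using c(2) K.rcos_const[of c] by auto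
  have conj_c: "\<exists>k\<in>K. u \<otimes> c \<otimes> inv u = k \<otimes> c" if u: "u \<in> P" for u
  proof -
    have "u \<otimes> c \<otimes> inv u \<in> K #> (u \<otimes> c \<otimes> inv u)" using u cc KD(1) by (intro rcos_self) auto
    also have "\<dots> = K #> c" using act_coset[OF u c(1)] c(3)[OF u] by simp
    finally show ?thesis by (auto simp: r_coset_def)
  qed
  have cpow: "c [^] (n :: nat) \<in> Q" for n
    by (induction n) (use c(1) in auto)
  have cpow_conj: "c [^] (n :: nat) \<otimes> k \<otimes> inv (c [^] n) \<in> K" if "k \<in> K" for n k
    using KD(4)[OF _ that] cpow Q(2) by blast
  have conj_pow: "\<exists>k\<in>K. u \<otimes> c [^] (n :: nat) \<otimes> inv u = k \<otimes> c [^] n" if u: "u \<in> P" for u n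
  proof (induction n)
    case 0
    show ?case using u K.one_closed by (intro bexI[of _ \<one>]) auto
  next
    case (Suc n)
    then obtain k where k: "k \<in> K" "u \<otimes> c [^] n \<otimes> inv u = k \<otimes> c [^] n" by blast
    obtain k' where k': "k' \<in> K" "u \<otimes> c \<otimes> inv u = k' \<otimes> c" using conj_c[OF u] by blast
    have 1: "inv u \<otimes> (u \<otimes> (c \<otimes> inv u)) = c \<otimes> inv u" using u cc by (simp add: m_assoc[symmetric])
    have 2: "inv (c [^] n) \<otimes> (c [^] n \<otimes> c) = c" using cc by (simp add: m_assoc[symmetric])
    have "u \<otimes> c [^] Suc n \<otimes> inv u = (u \<otimes> c [^] n \<otimes> inv u) \<otimes> (u \<otimes> c \<otimes> inv u)"
      using u cc 1 by (simp add: m_assoc)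
    also have "\<dots> = k \<otimes> c [^] n \<otimes> (k' \<otimes> c)" using k k' by simp
    also have "\<dots> = k \<otimes> (c [^] n \<otimes> k' \<otimes> inv (c [^] n)) \<otimes> c [^] Suc n"
      using k k' cc 2 by (simp add: m_assoc)
    finally show ?case using k cpow_conj[OF k'(1), of n] by blast
  qed
  \<comment> \<open>\<open>L\<close> is \<open>K\<close> times the powers of \<open>c\<close>. It is
    invariant under \<open>P\<close> and larger than \<open>K\<close>, so maximality makes it all of
    \<open>Q\<close>.\<close>
  define L where "L = {k \<otimes> c [^] (n :: nat) | k n. k \<in> K}"
  have LQ: "L \<subseteq> Q" using KD(2) cpow by (auto simp: L_def)
  have L: "subgroup L G"
  proof (rule finite_subgroupI[OF fin])
    show "L \<subseteq> carrier G" using LQ by auto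
    show "\<one> \<in> L" unfolding L_def using K.one_closed by (intro CollectI exI[of _ \<one>] exI[of _ "0::nat"]) simp
    fix x y assume "x \<in> L" "y \<in> L"
    then obtain k m k' n where *: "k \<in> K" "x = k \<otimes> c [^] (m::nat)" "k' \<in> K" "y = k' \<otimes> c [^] (n::nat)"
      by (auto simp: L_def)
    have "inv (c [^] m) \<otimes> (c [^] m \<otimes> c [^] n) = c [^] n" using cc by (simp add: m_assoc[symmetric])
    then have "x \<otimes> y = k \<otimes> (c [^] m \<otimes> k' \<otimes> inv (c [^] m)) \<otimes> c [^] (m + n)"
      using * cc by (simp add: m_assoc nat_pow_mult[symmetric])
    then show "x \<otimes> y \<in> L" unfolding L_def using cpow_conj[OF *(3), of m] *(1) by blast
  qed
  have Lconj: "u \<otimes> x \<otimes> inv u \<in> L" if u: "u \<in> P" and x: "x \<in> L" for u x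
  proof -
    obtain k n where k: "k \<in> K" "x = k \<otimes> c [^] (n::nat)" using x by (auto simp: L_def)
    obtain k' where k': "k' \<in> K" "u \<otimes> c [^] n \<otimes> inv u = k' \<otimes> c [^] n" using conj_pow[OF u] by blast
    have "inv u \<otimes> (u \<otimes> (c [^] n \<otimes> inv u)) = c [^] n \<otimes> inv u" using u cc by (simp add: m_assoc[symmetric])
    then have "u \<otimes> x \<otimes> inv u = (u \<otimes> k \<otimes> inv u) \<otimes> (u \<otimes> c [^] n \<otimes> inv u)"
      using u k cc by (simp add: m_assoc)
    also have "\<dots> = (u \<otimes> k \<otimes> inv u) \<otimes> k' \<otimes> c [^] n" using k' k u cc by (simp add: m_assoc)
    finally show ?thesis unfolding L_def using KD(4)[OF u k(1)] k' by blast
  qed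
  have KL: "K \<subset> L"
  proof -
    have "k \<in> L" if "k \<in> K" for k unfolding L_def using that
      by (intro CollectI exI[of _ k] exI[of _ "0::nat"]) simp
    moreover have "c \<in> L" unfolding L_def using K.one_closed cc
      by (intro CollectI exI[of _ \<one>] exI[of _ "1::nat"]) simp
    ultimately show ?thesis using cK by blast
  qed
  have "L = Q"
  proof (rule ccontr)
    assume "L \<noteq> Q"
    then have "L \<in> \<K>" using L LQ Lconj by (auto simp: \<K>_def)
    then have "card L \<le> card K" by (rule max)
    moreover have "card K < card L" using KL finite_subset[OF LQ finQ] by (rule psubset_card_mono[rotated])
    ultimately show False by simp
  qed
  have "c [^] card Q \<in> K"
    using subgroup_pow_card[OF fin Q(1) c(1)] by simp
  moreover have "card Q > 0" by (rule subgroup_card_pos[OF fin Q(1)])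
  ultimately have ex_o: "\<exists>n::nat. 0 < n \<and> c [^] n \<in> K" by blast
  \<comment> \<open>The order of \<open>c\<close> modulo \<open>K\<close>, which is the order of the
    cyclic quotient.\<close>
  define d where "d = (LEAST n::nat. 0 < n \<and> c [^] n \<in> K)"
  have d: "0 < d" "c [^] d \<in> K" using LeastI_ex[OF ex_o] by (auto simp: d_def)
  have d_least: "d \<le> n" if "0 < n" "c [^] n \<in> K" for n :: nat
    unfolding d_def using that by (intro Least_le) simp
  have d_dvd: "d dvd n" if n: "c [^] n \<in> K" for n :: nat
  proof -
    have dm: "c [^] (d * m) \<in> K" for m :: nat
      by (induction m) (use d cc in \<open>auto simp: nat_pow_mult[symmetric]\<close>)
    have "c [^] n = c [^] (d * (n div d)) \<otimes> c [^] (n mod d)" using cc by (simp add: nat_pow_mult)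
    then have "c [^] (n mod d) = inv (c [^] (d * (n div d))) \<otimes> c [^] n"
      using cc by (simp add: m_assoc[symmetric])
    then have "c [^] (n mod d) \<in> K" using dm n by simp
    then have "n mod d = 0" using d_least[of "n mod d"] d(1) by (metis gr0I leD mod_less_divisor)
    then show ?thesis by auto
  qed
  define w where "w = cis (2 * pi / real d)"
  have wd: "w ^ d = 1" using d(1) by (simp add: w_def DeMoivre)
  have "d \<noteq> 1" using d(2) cK cc by auto
  have w1: "w \<noteq> 1"
  proof
    assume "w = 1"
    then have "cos (2 * pi / real d) = 1" by (simp add: w_def complex_eq_iff)
    then obtain m :: int where "2 * pi / real d = real_of_int m * 2 * pi" by (auto simp: cos_one_2pi_int)
    then have "(2 * pi) * (1 / real d) = (2 * pi) * real_of_int m" by simp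
    moreover have "2 * pi \<noteq> 0" by simp
    ultimately have "1 / real d = real_of_int m" by (metis mult_left_cancel)
    moreover have "0 < 1 / real d" "1 / real d < 1" using d(1) \<open>d \<noteq> 1\<close> by auto
    ultimately have "0 < m \<and> m < 1" by (metis of_int_0_less_iff of_int_less_1_iff)
    then show False by linarith
  qed
  have w0: "w \<noteq> 0" by (simp add: w_def)
  have w_dvd: "w ^ n = 1" if "d dvd n" for n using that wd by (auto simp: power_mult)
  \<comment> \<open>The exponent of \<open>c\<close> in \<open>k \<otimes> c [^] m\<close> is
    determined modulo \<open>d\<close>, so \<open>w ^ m\<close> depends only on the element and
    \<open>\<theta>\<close> is well defined.\<close>
  have w_eq: "w ^ m = w ^ n" if m: "x = k \<otimes> c [^] m" "k \<in> K" and n: "x = k' \<otimes> c [^] n" "k' \<in> K"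
    for x k k' and m n :: nat
  proof -
    have *: "w ^ m = w ^ n" if le: "m \<le> n" and eq: "k \<otimes> c [^] m = k' \<otimes> c [^] n" "k \<in> K" "k' \<in> K"
      for k k' and m n :: nat
    proof -
      have "k \<otimes> c [^] m = k' \<otimes> c [^] (n - m) \<otimes> c [^] m"
        using eq le cc by (simp add: m_assoc nat_pow_mult)
      then have "k = k' \<otimes> c [^] (n - m)" using eq cc by simp
      then have "c [^] (n - m) = inv k' \<otimes> k" using eq cc by (simp add: m_assoc[symmetric])
      then have "c [^] (n - m) \<in> K" using eq by simp
      then have "w ^ (n - m) = 1" using d_dvd w_dvd by blast
      then have "w ^ (m + (n - m)) = w ^ m" by (simp add: power_add)
      then show ?thesis using le by simp
    qed
    show ?thesis using *[of m n k k'] *[of n m k' k] m n by (metis nat_le_linear)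
  qed
  define e where "e x = (SOME n::nat. \<exists>k\<in>K. x = k \<otimes> c [^] n)" for x
  define \<theta> where "\<theta> = restrict (\<lambda>x. w ^ e x) Q"
  have \<theta>: "\<theta> x = w ^ n" if "k \<in> K" "x = k \<otimes> c [^] n" for x k and n :: nat
  proof -
    have "\<exists>k\<in>K. x = k \<otimes> c [^] e x"
      unfolding e_def by (rule someI[of _ n]) (use that in blast)
    then obtain k' where "k' \<in> K" "x = k' \<otimes> c [^] e x" by blast
    then have "w ^ e x = w ^ n" using w_eq that by metis
    moreover have "x \<in> Q" using that \<open>L = Q\<close> by (auto simp: L_def)
    ultimately show ?thesis by (simp add: \<theta>_def)
  qed
  have "\<theta> \<in> lin_chars G Q"
    unfolding lin_chars_def
  proof (intro CollectI conjI ballI)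
    fix x assume "x \<in> Q"
    then obtain k n where k: "k \<in> K" "x = k \<otimes> c [^] (n::nat)" unfolding \<open>L = Q\<close>[symmetric] L_def by blast
    then show "\<theta> x \<noteq> 0" using \<theta> w0 by simp
    fix y assume "y \<in> Q"
    then obtain k' m where k': "k' \<in> K" "y = k' \<otimes> c [^] (m::nat)" unfolding \<open>L = Q\<close>[symmetric] L_def by blast
    have "inv (c [^] n) \<otimes> (c [^] n \<otimes> c [^] m) = c [^] m" using cc by (simp add: m_assoc[symmetric])
    then have "x \<otimes> y = k \<otimes> (c [^] n \<otimes> k' \<otimes> inv (c [^] n)) \<otimes> c [^] (n + m)"
      using k k' cc by (simp add: m_assoc nat_pow_mult[symmetric])
    then have "\<theta> (x \<otimes> y) = w ^ (n + m)" using \<theta> cpow_conj[OF k'(1), of n] k(1) by blast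
    then show "\<theta> (x \<otimes> y) = \<theta> x * \<theta> y" using \<theta>[OF k] \<theta>[OF k'] by (simp add: power_add)
  qed (simp add: \<theta>_def)
  moreover have "\<theta> (u \<otimes> x \<otimes> inv u) = \<theta> x" if u: "u \<in> P" and x: "x \<in> Q" for u x
  proof -
    obtain k n where k: "k \<in> K" "x = k \<otimes> c [^] (n::nat)" using x unfolding \<open>L = Q\<close>[symmetric] L_def by blast
    obtain k' where k': "k' \<in> K" "u \<otimes> c [^] n \<otimes> inv u = k' \<otimes> c [^] n" using conj_pow[OF u] by blast
    have "inv u \<otimes> (u \<otimes> (c [^] n \<otimes> inv u)) = c [^] n \<otimes> inv u" using u cc by (simp add: m_assoc[symmetric])
    then have "u \<otimes> x \<otimes> inv u = (u \<otimes> k \<otimes> inv u) \<otimes> (u \<otimes> c [^] n \<otimes> inv u)"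
      using u k cc by (simp add: m_assoc)
    also have "\<dots> = (u \<otimes> k \<otimes> inv u) \<otimes> k' \<otimes> c [^] n" using k' k u cc by (simp add: m_assoc)
    finally have "\<theta> (u \<otimes> x \<otimes> inv u) = w ^ n"
      using \<theta> KD(4)[OF u k(1)] k' by blast
    then show ?thesis using \<theta>[OF k] by simp
  qed
  moreover have "\<theta> c \<noteq> 1" using \<theta>[of \<one> c 1] cc w1 by simp
  ultimately show ?thesis using that c(1) by blast
qed

text \<open>A transfer argument for Tate's theorem. If \<open>P\<close> meets \<open>O\<^sup>p(G)\<close>, which is
  \<open>p_residual p\<close>, in a nontrivial group \<open>Q\<close>, pick a \<open>P\<close>-invariant character \<open>\<theta> \<noteq> 1\<close> of \<open>Q\<close> and a left \<open>P\<close>-equivariant map \<open>\<sigma> : G \<rightarrow> P\<close>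
  that is the identity modulo \<open>O\<^sup>p(G)\<close>. The product of \<open>\<theta> (\<sigma> x)\<^sup>-\<^sup>1 (\<sigma> (x g))\<close> over the cosets
  \<open>P x\<close> is a character of \<open>O\<^sup>p(G)\<close>, hence trivial, so twisting by \<open>u\<^sup>-\<^sup>1\<close> for \<open>u \<in> P\<close> gives a
  character of \<open>P\<close> that restricts to \<open>\<theta>\<close> to the power \<open>- |G : P|\<close>.\<close>

lemma tate:
  assumes fin: "finite (carrier G)" and p: "Factorial_Ring.prime p"
    and P: "subgroup P G" "card P = p ^ a" "\<not> p dvd card (rcosets P)"
    and not_nilp: "\<not> p_nilpotent p G"
  obtains \<mu> q where "\<mu> \<in> lin_chars G P" "q \<in> P" "\<mu> q \<noteq> 1"
    "\<And>l. l \<in> lin_chars G (carrier G) \<Longrightarrow> l q = 1"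
proof -
  interpret P: subgroup P G by fact
  define M where "M = p_residual p"
  have Mn: "M \<lhd> G" unfolding M_def by (rule normal_p_residual)
  interpret M: normal M G by (rule Mn)
  have Msub: "subgroup M G" by (rule M.subgroup_axioms)
  obtain b where b: "card (rcosets M) = p ^ b"
    unfolding M_def using p_residual_index[OF fin p] by metis
  note supp = normal_sylow_supplement[OF fin p P(1,3) Mn b]
  define Q where "Q = P \<inter> M"
  have Q: "subgroup Q G" unfolding Q_def by (rule subgroups_Inter_pair[OF P(1) Msub])
  interpret Q: subgroup Q G by (rule Q)
  \<comment> \<open>If \<open>P\<close> met \<open>M\<close> trivially, every element would factor
    uniquely as \<open>m \<otimes> u\<close>; then \<open>|M| = |G : P|\<close> would be prime to
    \<open>p\<close> and \<open>M\<close> a normal \<open>p\<close>-complement.\<close>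
  have "Q \<noteq> {\<one>}"
  proof
    assume Q1: "Q = {\<one>}"
    have "bij_betw (\<lambda>(m, u). m \<otimes> u) (M \<times> P) (carrier G)"
      unfolding bij_betw_def
    proof
      show "inj_on (\<lambda>(m, u). m \<otimes> u) (M \<times> P)"
      proof (rule inj_onI, clarify)
        fix m u m' u' assume *: "m \<in> M" "u \<in> P" "m' \<in> M" "u' \<in> P" "m \<otimes> u = m' \<otimes> u'"
        have eq: "inv m' \<otimes> m = u' \<otimes> inv u"
        proof -
          have "u' = inv m' \<otimes> (m' \<otimes> u')" using *(1-4) by (simp add: m_assoc[symmetric])
          also have "\<dots> = inv m' \<otimes> m \<otimes> u" using *(1-4) by (simp add: *(5)[symmetric] m_assoc)
          finally have "u' \<otimes> inv u = inv m' \<otimes> m \<otimes> u \<otimes> inv u" by simp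
          then show ?thesis using *(1-4) by (simp add: m_assoc)
        qed
        moreover have "inv m' \<otimes> m \<in> M" "u' \<otimes> inv u \<in> P" using *(1-4) by auto
        ultimately have "u' \<otimes> inv u \<in> Q" by (simp add: Q_def)
        then have 1: "u' \<otimes> inv u = \<one>" using Q1 by simp
        have "u' = u' \<otimes> inv u \<otimes> u" using *(1-4) by (simp add: m_assoc)
        also have "\<dots> = u" using *(1-4) by (simp add: 1)
        finally have u: "u' = u" .
        have "m = m' \<otimes> (inv m' \<otimes> m)" using *(1-4) by (simp add: m_assoc[symmetric])
        also have "\<dots> = m'" using *(1-4) by (simp add: eq 1)
        finally show "m = m' \<and> u = u'" using u by simp
      qed
      show "(\<lambda>(m, u). m \<otimes> u) ` (M \<times> P) = carrier G"
      proof
        show "carrier G \<subseteq> (\<lambda>(m, u). m \<otimes> u) ` (M \<times> P)"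
        proof
          fix t assume t: "t \<in> carrier G"
          obtain u where u: "u \<in> P" "t \<otimes> inv u \<in> M" using supp[OF t] by blast
          have "t = (t \<otimes> inv u) \<otimes> u" using t u by (simp add: m_assoc)
          then show "t \<in> (\<lambda>(m, u). m \<otimes> u) ` (M \<times> P)" using u by force
        qed
      qed auto
    qed
    then have "card M * card P = card (carrier G)"
      using bij_betw_same_card by (fastforce simp: card_cartesian_product)
    then have "card M = card (rcosets P)"
      using card_rcosets[OF fin P(1)] subgroup_card_pos[OF fin P(1)]
      by (metis less_irrefl mult_cancel2)
    then have "coprime (card M) p" using P(3) p by (simp add: prime_imp_coprime coprime_commute)
    then show False using not_nilp Mn b unfolding p_nilpotent_def by blast
  qed
  moreover have QP: "Q \<subseteq> P" by (simp add: Q_def)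
  moreover have Qconj: "u \<otimes> q \<otimes> inv u \<in> Q" if "u \<in> P" "q \<in> Q" for u q
    using that M.inv_op_closed2[of u q] by (auto simp: Q_def)
  ultimately obtain \<theta> where \<theta>: "\<theta> \<in> lin_chars G Q"
    "\<And>u q. u \<in> P \<Longrightarrow> q \<in> Q \<Longrightarrow> \<theta> (u \<otimes> q \<otimes> inv u) = \<theta> q" "\<exists>q\<in>Q. \<theta> q \<noteq> 1"
    using exists_invariant_lin_char[OF fin p P(1,2) Q] by metis
  note \<theta>m = lin_charsD(2)[OF \<theta>(1)] and \<theta>nz = lin_charsD(1)[OF \<theta>(1)]
  have "\<exists>s. \<forall>t\<in>carrier G. s t \<in> P \<and> t \<otimes> inv (s t) \<in> M"
    using supp by (intro bchoice) blast
  then obtain s where s: "\<And>t. t \<in> carrier G \<Longrightarrow> s t \<in> P" "\<And>t. t \<in> carrier G \<Longrightarrow> t \<otimes> inv (s t) \<in> M"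
    by blast
  define rep where "rep x = (SOME y. y \<in> P #> x)" for x
  have rep: "rep x \<in> carrier G" "x \<otimes> inv (rep x) \<in> P" if x: "x \<in> carrier G" for x
  proof -
    obtain u where u: "u \<in> P" "rep x = u \<otimes> x" unfolding rep_def using coset_rep[OF P(1) x] by metis
    then show "rep x \<in> carrier G" using x by simp
    have "x \<otimes> inv (rep x) = inv u" using u x by (simp add: inv_mult_group m_assoc[symmetric])
    then show "x \<otimes> inv (rep x) \<in> P" using u by simp
  qed
  have rep_P: "rep (u \<otimes> x) = rep x" if "u \<in> P" "x \<in> carrier G" for u x
  proof -
    have "P #> (u \<otimes> x) = P #> u #> x" using that by (simp add: coset_mult_assoc P.subset)
    also have "P #> u = P" using that P.rcos_const by simp
    finally show ?thesis by (simp add: rep_def)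
  qed
  \<comment> \<open>\<open>rep x\<close> depends only on the coset \<open>P x\<close>, and
    \<open>s t\<close> is an element of \<open>P\<close> congruent to \<open>t\<close> modulo
    \<open>M\<close>. Hence \<open>x \<otimes> inv (rep x)\<close> carries the equivariance, and
    replacing \<open>rep x\<close> by \<open>s (rep x)\<close> lands in \<open>P\<close> without
    changing the class modulo \<open>M\<close>.\<close>
  define \<sigma> where "\<sigma> x = x \<otimes> inv (rep x) \<otimes> s (rep x)" for x
  have \<sigma>P: "\<sigma> x \<in> P" if "x \<in> carrier G" for x
    using rep[OF that] s(1) by (simp add: \<sigma>_def)
  have \<sigma>_mult: "\<sigma> (u \<otimes> x) = u \<otimes> \<sigma> x" if "u \<in> P" "x \<in> carrier G" for u x
    using that rep s(1) P.mem_carrier by (simp add: \<sigma>_def rep_P m_assoc)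
  have \<sigma>M: "\<sigma> x \<otimes> inv x \<in> M" if x: "x \<in> carrier G" for x
  proof -
    define t where "t = rep x"
    have t: "t \<in> carrier G" "s t \<in> P" "t \<otimes> inv (s t) \<in> M" using rep(1)[OF x] s by (auto simp: t_def)
    have "inv t \<otimes> (inv (t \<otimes> inv (s t))) \<otimes> inv (inv t) \<in> M"
      by (intro M.inv_op_closed2 M.m_inv_closed t inv_closed)
    moreover have "inv t \<otimes> (inv (t \<otimes> inv (s t))) \<otimes> inv (inv t) = inv t \<otimes> s t"
      using t P.mem_carrier[OF t(2)] by (simp add: inv_mult_group m_assoc)
    ultimately have "x \<otimes> (inv t \<otimes> s t) \<otimes> inv x \<in> M" using M.inv_op_closed2[OF x] by simp
    then show ?thesis using t P.mem_carrier[OF t(2)] x by (simp add: \<sigma>_def t_def[symmetric] m_assoc)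
  qed
  have \<sigma>c [simp]: "\<sigma> x \<in> carrier G" if "x \<in> carrier G" for x using \<sigma>P[OF that] by simp
  \<comment> \<open>The factor of the transfer. It depends on \<open>P x\<close> only, satisfies the
    cocycle identity \<open>D_mult\<close> and is congruent to \<open>g\<close> modulo
    \<open>M\<close>. So it lies in \<open>Q\<close> for \<open>g\<close> in \<open>M\<close>, and
    \<open>inv u \<otimes> D x u\<close> lies in \<open>Q\<close> for \<open>u\<close> in
    \<open>P\<close>.\<close>
  define D where "D x g = inv (\<sigma> x) \<otimes> \<sigma> (x \<otimes> g)" for x g
  have DP: "D x g \<in> P" if "x \<in> carrier G" "g \<in> carrier G" for x g
    using that \<sigma>P by (simp add: D_def)
  have Dc [simp]: "D x g \<in> carrier G" if "x \<in> carrier G" "g \<in> carrier G" for x g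
    using DP[OF that] by simp
  have D_P: "D (u \<otimes> x) g = D x g" if "u \<in> P" "x \<in> carrier G" "g \<in> carrier G" for u x g
  proof -
    have "D (u \<otimes> x) g = inv (\<sigma> x) \<otimes> (inv u \<otimes> (u \<otimes> \<sigma> (x \<otimes> g)))"
      using that by (simp add: D_def \<sigma>_mult m_assoc inv_mult_group)
    also have "inv u \<otimes> (u \<otimes> \<sigma> (x \<otimes> g)) = \<sigma> (x \<otimes> g)"
      using that by (simp add: m_assoc[symmetric])
    finally show ?thesis by (simp add: D_def)
  qed
  have D_mult: "D x (g \<otimes> h) = D x g \<otimes> D (x \<otimes> g) h"
    if "x \<in> carrier G" "g \<in> carrier G" "h \<in> carrier G" for x g h
  proof -
    have "\<sigma> (x \<otimes> g) \<otimes> (inv (\<sigma> (x \<otimes> g)) \<otimes> \<sigma> (x \<otimes> g \<otimes> h)) = \<sigma> (x \<otimes> g \<otimes> h)"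
      using that by (simp add: m_assoc[symmetric])
    then show ?thesis using that by (simp add: D_def m_assoc)
  qed
  have DM: "D x g \<otimes> inv g \<in> M" if xg: "x \<in> carrier G" "g \<in> carrier G" for x g
  proof -
    have "inv (\<sigma> x \<otimes> inv x) \<otimes> (\<sigma> (x \<otimes> g) \<otimes> inv (x \<otimes> g)) \<in> M"
      using \<sigma>M xg by simp
    then have "inv x \<otimes> (inv (\<sigma> x \<otimes> inv x) \<otimes> (\<sigma> (x \<otimes> g) \<otimes> inv (x \<otimes> g))) \<otimes> inv (inv x) \<in> M"
      using xg by (intro M.inv_op_closed2) auto
    moreover have "inv x \<otimes> (inv (\<sigma> x \<otimes> inv x) \<otimes> (\<sigma> (x \<otimes> g) \<otimes> inv (x \<otimes> g))) \<otimes> inv (inv x) = D x g \<otimes> inv g"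
    proof -
      have "inv x \<otimes> (x \<otimes> (inv (\<sigma> x) \<otimes> (\<sigma> (x \<otimes> g) \<otimes> inv g))) = inv (\<sigma> x) \<otimes> (\<sigma> (x \<otimes> g) \<otimes> inv g)"
        using xg by (simp add: m_assoc[symmetric])
      then show ?thesis using xg by (simp add: D_def inv_mult_group m_assoc)
    qed
    ultimately show ?thesis by simp
  qed
  have DQ: "D x g \<in> Q" if x: "x \<in> carrier G" and g: "g \<in> M" for x g
  proof -
    have "D x g \<otimes> inv g \<otimes> g \<in> M" using DM[OF x] g by simp
    then show ?thesis using DP[OF x] x g by (simp add: Q_def m_assoc)
  qed
  have uDQ: "inv u \<otimes> D x u \<in> Q" if x: "x \<in> carrier G" and u: "u \<in> P" for x u
  proof -
    have "inv u \<otimes> (D x u \<otimes> inv u) \<otimes> inv (inv u) \<in> M"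
      using DM[OF x] u by (intro M.inv_op_closed2) auto
    then show ?thesis using DP[OF x] x u by (simp add: Q_def m_assoc)
  qed
  note cong = coset_prod_cong[OF subgroup_self P(1) P.subset]
    and shift = coset_prod_shift[OF subgroup_self P(1) P.subset]
    and nonzero = coset_prod_nonzero[OF fin subgroup_self P(1) P.subset]
  let ?prod = "coset_prod (carrier G) P"
  define \<Theta> where "\<Theta> = restrict (\<lambda>g. ?prod (\<lambda>x. \<theta> (D x g))) M"
  have "\<Theta> \<in> lin_chars G M"
    unfolding lin_chars_def
  proof (intro CollectI conjI ballI)
    fix g assume g: "g \<in> M"
    show "\<Theta> g \<noteq> 0" using g DQ \<theta>nz nonzero by (simp add: \<Theta>_def)
    fix h assume h: "h \<in> M"
    have "?prod (\<lambda>x. \<theta> (D x (g \<otimes> h))) = ?prod (\<lambda>x. \<theta> (D x g) * \<theta> (D (x \<otimes> g) h))"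
      by (rule cong) (use g h in \<open>simp add: D_mult \<theta>m DQ\<close>)
    also have "\<dots> = ?prod (\<lambda>x. \<theta> (D x g)) * ?prod (\<lambda>x. \<theta> (D (x \<otimes> g) h))"
      by (rule coset_prod_mult)
    also have "?prod (\<lambda>x. \<theta> (D (x \<otimes> g) h)) = ?prod (\<lambda>x. \<theta> (D x h))"
      by (rule shift) (use g h in \<open>auto simp: D_P\<close>)
    finally show "\<Theta> (g \<otimes> h) = \<Theta> g * \<Theta> h" using g h by (simp add: \<Theta>_def)
  qed (simp add: \<Theta>_def)
  have "card Q dvd p ^ a"
    using card_cosets[OF fin P(1) Q QP] P(2) by (metis dvd_triv_right)
  then obtain e where e: "p ^ a = card Q * e" by blast
  have \<theta>pow: "\<theta> q ^ p ^ a = 1" if "q \<in> Q" for q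
    using lin_char_pow_card[OF fin Q \<theta>(1) that] by (simp add: e power_mult)
  have \<Theta>1: "\<Theta> g = 1" if g: "g \<in> M" for g
  proof (rule p_residual_lin_char[OF Msub _ \<open>\<Theta> \<in> lin_chars G M\<close> _ _ p])
    have "\<Theta> g ^ p ^ a = ?prod (\<lambda>x. \<theta> (D x g) ^ p ^ a)" using g by (simp add: \<Theta>_def coset_prod_power)
    also have "\<dots> = ?prod (\<lambda>x. 1)" by (rule cong) (use g DQ \<theta>pow in auto)
    finally show "\<Theta> g ^ p ^ a = 1" by (simp add: coset_prod_const)
  qed (use g in \<open>auto simp: M_def\<close>)
  define \<mu> where "\<mu> = restrict (\<lambda>u. ?prod (\<lambda>x. \<theta> (inv u \<otimes> D x u))) P"
  have "\<mu> \<in> lin_chars G P"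
    unfolding lin_chars_def
  proof (intro CollectI conjI ballI)
    fix u assume u: "u \<in> P"
    show "\<mu> u \<noteq> 0" using u uDQ \<theta>nz nonzero by (simp add: \<mu>_def)
    fix v assume v: "v \<in> P"
    have "?prod (\<lambda>x. \<theta> (inv (u \<otimes> v) \<otimes> D x (u \<otimes> v))) =
        ?prod (\<lambda>x. \<theta> (inv u \<otimes> D x u) * \<theta> (inv v \<otimes> D (x \<otimes> u) v))"
    proof (rule cong)
      fix x assume x: "x \<in> carrier G"
      define q where "q = inv u \<otimes> D x u"
      define r where "r = inv v \<otimes> D (x \<otimes> u) v"
      have q: "q \<in> Q" unfolding q_def by (rule uDQ[OF x u])
      have r: "r \<in> Q" unfolding r_def by (rule uDQ) (use x u v in auto)
      have "v \<otimes> (inv v \<otimes> D (x \<otimes> u) v) = D (x \<otimes> u) v" using x u v by (simp add: m_assoc[symmetric])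
      \<comment> \<open>The correction for \<open>u\<close> reappears conjugated by
        \<open>inv v\<close>; invariance of \<open>\<theta>\<close> under \<open>P\<close> removes
        the conjugation.\<close>
      then have "inv (u \<otimes> v) \<otimes> D x (u \<otimes> v) = (inv v \<otimes> q \<otimes> inv (inv v)) \<otimes> r"
        using x u v by (simp add: q_def r_def D_mult inv_mult_group m_assoc)
      moreover have "inv v \<otimes> q \<otimes> inv (inv v) \<in> Q" by (rule Qconj[OF P.m_inv_closed[OF v] q])
      ultimately have "\<theta> (inv (u \<otimes> v) \<otimes> D x (u \<otimes> v)) = \<theta> (inv v \<otimes> q \<otimes> inv (inv v)) * \<theta> r"
        using \<theta>m r by simp
      also have "\<theta> (inv v \<otimes> q \<otimes> inv (inv v)) = \<theta> q" by (rule \<theta>(2)[OF P.m_inv_closed[OF v] q])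
      finally show "\<theta> (inv (u \<otimes> v) \<otimes> D x (u \<otimes> v)) = \<theta> (inv u \<otimes> D x u) * \<theta> (inv v \<otimes> D (x \<otimes> u) v)"
        by (simp add: q_def r_def)
    qed
    also have "\<dots> = ?prod (\<lambda>x. \<theta> (inv u \<otimes> D x u)) * ?prod (\<lambda>x. \<theta> (inv v \<otimes> D (x \<otimes> u) v))"
      by (rule coset_prod_mult)
    also have "?prod (\<lambda>x. \<theta> (inv v \<otimes> D (x \<otimes> u) v)) = ?prod (\<lambda>x. \<theta> (inv v \<otimes> D x v))"
      by (rule shift) (use u v in \<open>auto simp: D_P\<close>)
    finally show "\<mu> (u \<otimes> v) = \<mu> u * \<mu> v" using u v by (simp add: \<mu>_def)
  qed (simp add: \<mu>_def)
  obtain q where q: "q \<in> Q" "\<theta> q \<noteq> 1" using \<theta>(3) by blast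
  have qP: "q \<in> P" and qM: "q \<in> M" using q by (auto simp: Q_def)
  define m where "m = card (rcosets P)"
  have "\<mu> q = ?prod (\<lambda>x. \<theta> (inv q) * \<theta> (D x q))"
    unfolding \<mu>_def using qP qM q by (simp, intro cong) (simp add: \<theta>m DQ)
  also have "\<dots> = ?prod (\<lambda>x. \<theta> (inv q)) * ?prod (\<lambda>x. \<theta> (D x q))" by (rule coset_prod_mult)
  also have "?prod (\<lambda>x. \<theta> (D x q)) = 1" using \<Theta>1[OF qM] qM by (simp add: \<Theta>_def)
  also have "?prod (\<lambda>x. \<theta> (inv q)) = inverse (\<theta> q) ^ m"
    using lin_char_inv[OF \<theta>(1) Q q(1)] by (simp add: coset_prod_const m_def rcosets_image)
  finally have \<mu>q: "\<mu> q = inverse (\<theta> q) ^ m" by simp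
  \<comment> \<open>\<open>\<theta> q\<close> is nontrivial of \<open>p\<close>-power order and
    \<open>m\<close> is prime to \<open>p\<close>.\<close>
  have "\<mu> q \<noteq> 1"
  proof
    assume "\<mu> q = 1"
    then have "\<theta> q ^ m = 1" using \<mu>q by (simp add: power_inverse)
    moreover have "coprime (p ^ a) m" using P(3) p by (simp add: m_def prime_imp_coprime)
    moreover have "p ^ a \<noteq> 0" using p by auto
    ultimately show False using coprime_roots_of_unity[OF \<theta>pow[OF q(1)]] q(2) by blast
  qed
  moreover have "l q = 1" if l: "l \<in> lin_chars G (carrier G)" for l
  proof (rule p_residual_lin_char[OF subgroup_self _ l _ _ p])
    have "l q ^ p ^ a = l (q [^] (p ^ a))" using lin_char_pow[OF l subgroup_self] qP by simp
    also have "q [^] (p ^ a) = \<one>" using subgroup_pow_card[OF fin P(1) qP] P(2) by simp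
    finally show "l q ^ p ^ a = 1" using lin_char_one[OF l subgroup_self] by simp
  qed (use qM M.subset in \<open>auto simp: M_def\<close>)
  ultimately show ?thesis using that \<open>\<mu> \<in> lin_chars G P\<close> qP by blast
qed

end

section \<open>Extension and counting of linear characters\<close>

context group
begin

lemma lin_chars_restrict:
  assumes "\<gamma> \<in> lin_chars G H" "subgroup K G" "K \<subseteq> H"
  shows "restrict \<gamma> K \<in> lin_chars G K"
  using assms subgroup.m_closed[OF assms(2)] by (auto simp: lin_chars_def subset_iff)

lemma lin_chars_mult:
  assumes "\<gamma> \<in> lin_chars G H" "\<delta> \<in> lin_chars G H" "subgroup H G"
  shows "restrict (\<lambda>x. \<gamma> x * \<delta> x) H \<in> lin_chars G H"
  using assms subgroup.m_closed[OF assms(3)] by (auto simp: lin_chars_def)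

lemma lin_chars_divide:
  assumes "\<gamma> \<in> lin_chars G H" "\<delta> \<in> lin_chars G H" "subgroup H G"
  shows "restrict (\<lambda>x. \<gamma> x / \<delta> x) H \<in> lin_chars G H"
  using assms subgroup.m_closed[OF assms(3)] by (auto simp: lin_chars_def)

lemma lin_chars_power:
  assumes "\<gamma> \<in> lin_chars G H" "subgroup H G"
  shows "restrict (\<lambda>x. \<gamma> x ^ n) H \<in> lin_chars G H"
  using assms subgroup.m_closed[OF assms(2)] by (auto simp: lin_chars_def power_mult_distrib)

lemma lin_chars_eqI:
  assumes "\<gamma> \<in> lin_chars G H" "\<delta> \<in> lin_chars G H" "\<And>x. x \<in> H \<Longrightarrow> \<gamma> x = \<delta> x"
  shows "\<gamma> = \<delta>"
  using lin_charsD(3)[OF assms(1)] lin_charsD(3)[OF assms(2)] assms(3) by (rule extensionalityI)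

lemma card_cosets_dvd:
  assumes fin: "finite (carrier G)" and H: "subgroup H G" and K: "subgroup K G" "K \<subseteq> H"
  shows "card (rcosets H) * card ((\<lambda>x. K #> x) ` H) = card (rcosets K)"
proof -
  have "card (rcosets H) * card ((\<lambda>x. K #> x) ` H) * card K = card (rcosets K) * card K"
    using card_cosets[OF fin H K] card_rcosets[OF fin H] card_rcosets[OF fin K(1)]
    by (simp add: mult.assoc)
  then show ?thesis using subgroup_card_pos[OF fin K(1)] by simp
qed

text \<open>The transfer of \<open>\<mu>\<close> from \<open>P\<close> to \<open>T\<close> restricts on \<open>R\<close> to \<open>\<mu>\<close> to the power \<open>|T : P|\<close>,
  which is prime to the order of \<open>\<mu>\<close>.\<close>

lemma extend_lin_char:
  assumes fin: "finite (carrier G)" and p: "Factorial_Ring.prime p"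
    and P: "subgroup P G" "card P = p ^ a" "\<not> p dvd card (rcosets P)"
    and T: "subgroup T G" "P \<subseteq> T" and \<mu>: "\<mu> \<in> lin_chars G P" and R: "R \<subseteq> P"
    and inv: "\<And>t r. t \<in> T \<Longrightarrow> r \<in> R \<Longrightarrow> t \<otimes> r \<otimes> inv t \<in> P \<and> \<mu> (t \<otimes> r \<otimes> inv t) = \<mu> r"
  obtains \<gamma> where "\<gamma> \<in> lin_chars G T" "\<And>r. r \<in> R \<Longrightarrow> \<gamma> r = \<mu> r"
proof -
  interpret P: subgroup P G by fact
  interpret T: subgroup T G by fact
  have \<mu>m: "\<mu> (u \<otimes> v) = \<mu> u * \<mu> v" if "u \<in> P" "v \<in> P" for u v using lin_charsD(2)[OF \<mu> that] .
  have \<mu>0: "\<mu> u \<noteq> 0" if "u \<in> P" for u using lin_charsD(1)[OF \<mu> that] .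
  define rep where "rep x = (SOME y. y \<in> P #> x)" for x
  have rep: "rep x \<in> carrier G" "x \<otimes> inv (rep x) \<in> P" if x: "x \<in> T" for x
  proof -
    have xc: "x \<in> carrier G" using x by simp
    obtain u where u: "u \<in> P" "rep x = u \<otimes> x" unfolding rep_def using coset_rep[OF P(1) xc] by metis
    then show "rep x \<in> carrier G" using x by simp
    have "x \<otimes> inv (rep x) = inv u" using u x by (simp add: inv_mult_group m_assoc[symmetric])
    then show "x \<otimes> inv (rep x) \<in> P" using u by simp
  qed
  have rep_P: "rep (u \<otimes> x) = rep x" if "u \<in> P" "x \<in> T" for u x
  proof -
    have "P #> (u \<otimes> x) = P #> u #> x" using that by (simp add: coset_mult_assoc P.subset)
    also have "P #> u = P" using that P.rcos_const by simp
    finally show ?thesis by (simp add: rep_def)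
  qed
  \<comment> \<open>\<open>\<mu>\<close> spread along the cosets, with
    \<open>f (u \<otimes> x) = \<mu> u * f x\<close>. The quotient
    \<open>f (x \<otimes> g) / f x\<close> is then constant on cosets, and its product over them is
    the transfer.\<close>
  define f where "f x = \<mu> (x \<otimes> inv (rep x))" for x
  have f0: "f x \<noteq> 0" if "x \<in> T" for x using \<mu>0 rep(2)[OF that] by (simp add: f_def)
  have f_P: "f (u \<otimes> x) = \<mu> u * f x" if "u \<in> P" "x \<in> T" for u x
    using that rep by (simp add: f_def rep_P m_assoc \<mu>m[symmetric])
  note cong = coset_prod_cong[OF T(1) P(1) T(2)] and shift = coset_prod_shift[OF T(1) P(1) T(2)]
    and nonzero = coset_prod_nonzero[OF fin T(1) P(1) T(2)]
  let ?prod = "coset_prod T P"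
  define \<tau> where "\<tau> = restrict (\<lambda>g. ?prod (\<lambda>x. f (x \<otimes> g) / f x)) T"
  have uT: "u \<otimes> x \<in> T" if "u \<in> P" "x \<in> T" for u x using that T(2) by blast
  have \<tau>: "\<tau> \<in> lin_chars G T"
    unfolding lin_chars_def
  proof (intro CollectI conjI ballI)
    fix g assume g: "g \<in> T"
    show "\<tau> g \<noteq> 0" using g f0 nonzero by (simp add: \<tau>_def)
    fix h assume h: "h \<in> T"
    have "?prod (\<lambda>x. f (x \<otimes> (g \<otimes> h)) / f x) = ?prod (\<lambda>x. (f (x \<otimes> g) / f x) * (f (x \<otimes> g \<otimes> h) / f (x \<otimes> g)))"
      by (rule cong) (use g h f0 in \<open>simp add: m_assoc\<close>)
    also have "\<dots> = ?prod (\<lambda>x. f (x \<otimes> g) / f x) * ?prod (\<lambda>x. f (x \<otimes> g \<otimes> h) / f (x \<otimes> g))"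
      by (rule coset_prod_mult)
    also have "?prod (\<lambda>x. f (x \<otimes> g \<otimes> h) / f (x \<otimes> g)) = ?prod (\<lambda>x. f (x \<otimes> h) / f x)"
    proof (rule shift[of "\<lambda>x. f (x \<otimes> h) / f x", OF _ g])
      fix u x assume ux: "u \<in> P" "x \<in> T"
      have "f (u \<otimes> x \<otimes> h) = \<mu> u * f (x \<otimes> h)" using f_P[of u "x \<otimes> h"] ux h by (simp add: m_assoc)
      then show "f (u \<otimes> x \<otimes> h) / f (u \<otimes> x) = f (x \<otimes> h) / f x"
        using f_P[OF ux] \<mu>0[OF ux(1)] by simp
    qed
    finally show "\<tau> (g \<otimes> h) = \<tau> g * \<tau> h" using g h by (simp add: \<tau>_def)
  qed (simp add: \<tau>_def)
  define m where "m = card ((\<lambda>x. P #> x) ` T)"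
  have \<tau>R: "\<tau> r = \<mu> r ^ m" if r: "r \<in> R" for r
  proof -
    have rP: "r \<in> P" using r R by blast
    then have rT: "r \<in> T" using T(2) by blast
    have "\<tau> r = ?prod (\<lambda>x. \<mu> r)"
      unfolding \<tau>_def restrict_apply'[OF rT]
    proof (rule cong)
      fix x assume x: "x \<in> T"
      \<comment> \<open>With the conjugate of \<open>r\<close> moved to the left, invariance of
        \<open>\<mu>\<close> shows that every factor of the transfer equals
        \<open>\<mu> r\<close>.\<close>
      have "x \<otimes> r = (x \<otimes> r \<otimes> inv x) \<otimes> x" using x rT by (simp add: m_assoc)
      then have "f (x \<otimes> r) = \<mu> r * f x" using f_P[of "x \<otimes> r \<otimes> inv x" x] inv[OF x r] x by simp
      then show "f (x \<otimes> r) / f x = \<mu> r" using f0[OF x] by simp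
    qed
    then show ?thesis by (simp add: coset_prod_const m_def)
  qed
  have "m dvd card (rcosets P)"
    unfolding m_def using card_cosets_dvd[OF fin T(1) P(1) T(2)] by (metis dvd_triv_right)
  then have "\<not> p dvd m" using P(3) dvd_trans by blast
  then have "coprime m (p ^ a)"
    using prime_imp_coprime[OF p \<open>\<not> p dvd m\<close>] by (simp add: coprime_commute)
  moreover have "m \<noteq> 0" using \<open>\<not> p dvd m\<close> by (metis dvd_0_right)
  \<comment> \<open>\<open>j\<close> inverts \<open>m\<close> modulo \<open>p ^ a\<close>, so the
    power \<open>j\<close> of the transfer restores \<open>\<mu>\<close> on
    \<open>R\<close>.\<close>
  ultimately obtain j y where jy: "m * j = p ^ a * y + 1"
    using bezout_nat[of m "p ^ a"] by auto
  define \<gamma> where "\<gamma> = restrict (\<lambda>x. \<tau> x ^ j) T"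
  have "\<gamma> \<in> lin_chars G T" unfolding \<gamma>_def by (rule lin_chars_power[OF \<tau> T(1)])
  moreover have "\<gamma> r = \<mu> r" if r: "r \<in> R" for r
  proof -
    have rP: "r \<in> P" using r R by blast
    have "\<gamma> r = \<mu> r ^ (m * j)" using \<tau>R[OF r] rP T(2) by (auto simp: \<gamma>_def power_mult)
    also have "\<dots> = (\<mu> r ^ p ^ a) ^ y * \<mu> r" by (simp add: jy power_mult)
    also have "\<mu> r ^ p ^ a = 1" using lin_char_pow_card[OF fin P(1) \<mu> rP] P(2) by simp
    finally show ?thesis by simp
  qed
  ultimately show ?thesis using that by blast
qed

text \<open>The values are roots of unity, hence of absolute value 1.\<close>

lemma lin_char_cnj:
  assumes fin: "finite (carrier G)" and H: "subgroup H G" and \<gamma>: "\<gamma> \<in> lin_chars G H" and x: "x \<in> H"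
  shows "cnj (\<gamma> x) = inverse (\<gamma> x)"
proof -
  have "norm (\<gamma> x) ^ card H = 1"
    using lin_char_pow_card[OF fin H \<gamma> x] by (metis norm_one norm_power)
  then have "norm (\<gamma> x) = 1"
    using power_eq_imp_eq_base[of "norm (\<gamma> x)" "card H" 1] subgroup_card_pos[OF fin H] by simp
  then have "\<gamma> x * cnj (\<gamma> x) = 1" by (simp add: complex_norm_square[symmetric])
  then show ?thesis by (rule inverse_unique[symmetric])
qed

text \<open>Evaluate the square norm of \<open>\<Sum>\<^sub>l\<^sub>\<in>\<^sub>K l\<close> over \<open>H\<close> by orthogonality, and bound it from below by the
  contribution of \<open>T\<close>.\<close>

lemma card_lin_chars_trivial_on:
  assumes fin: "finite (carrier G)" and H: "subgroup H G" and T: "subgroup T G" "T \<subseteq> H"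
    and K: "finite K" "K \<subseteq> lin_chars G H" "\<And>l x. l \<in> K \<Longrightarrow> x \<in> T \<Longrightarrow> l x = 1"
  shows "card K * card T \<le> card H"
proof (cases "card K = 0")
  case False
  interpret H: subgroup H G by fact
  have finH: "finite H" using finite_subset[OF H.subset fin] .
  have orth: "(\<Sum>x\<in>H. l x * cnj (l' x)) = (if l = l' then of_nat (card H) else 0)"
    if l: "l \<in> K" and l': "l' \<in> K" for l l'
  proof -
    define m where "m = restrict (\<lambda>x. l x / l' x) H"
    have L: "l \<in> lin_chars G H" "l' \<in> lin_chars G H" using l l' K(2) by auto
    have m: "m \<in> lin_chars G H" unfolding m_def by (rule lin_chars_divide[OF L H])
    have "(\<Sum>x\<in>H. l x * cnj (l' x)) = (\<Sum>x\<in>H. m x)"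
      by (rule sum.cong) (use lin_char_cnj[OF fin H L(2)] in \<open>auto simp: m_def divide_inverse\<close>)
    also have "\<dots> = (if l = l' then of_nat (card H) else 0)"
    proof (cases "l = l'")
      case True
      then show ?thesis using lin_charsD(1)[OF L(2)] by (simp add: m_def)
    next
      case False
      then obtain y where y: "y \<in> H" "l y \<noteq> l' y" using lin_chars_eqI[OF L] by blast
      then have my: "m y \<noteq> 1" using lin_charsD(1)[OF L(2) y(1)] by (simp add: m_def)
      have "(\<Sum>x\<in>H. m x) = (\<Sum>x\<in>H. m (y \<otimes> x))"
        by (rule sum.reindex_bij_betw[OF left_mult_bij[OF y(1) H], symmetric])
      also have "\<dots> = m y * (\<Sum>x\<in>H. m x)"
        using lin_charsD(2)[OF m y(1)] by (simp add: sum_distrib_left)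
      finally have "(m y - 1) * (\<Sum>x\<in>H. m x) = 0" by (simp add: algebra_simps)
      then show ?thesis using my False by simp
    qed
    finally show ?thesis .
  qed
  define S where "S x = (\<Sum>l\<in>K. l x)" for x
  have "(\<Sum>x\<in>H. S x * cnj (S x)) = (\<Sum>x\<in>H. \<Sum>l\<in>K. \<Sum>l'\<in>K. l x * cnj (l' x))"
    by (simp add: S_def sum_product)
  also have "\<dots> = (\<Sum>l\<in>K. \<Sum>x\<in>H. \<Sum>l'\<in>K. l x * cnj (l' x))" by (rule sum.swap)
  also have "\<dots> = (\<Sum>l\<in>K. \<Sum>l'\<in>K. \<Sum>x\<in>H. l x * cnj (l' x))"
    by (rule sum.cong[OF refl]) (rule sum.swap)
  also have "\<dots> = (\<Sum>l\<in>K. \<Sum>l'\<in>K. if l = l' then of_nat (card H) else 0)"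
    by (intro sum.cong refl) (use orth in auto)
  also have "\<dots> = of_nat (card K * card H)" using K(1) by simp
  finally have "complex_of_real (\<Sum>x\<in>H. (norm (S x))\<^sup>2) = of_nat (card K * card H)"
    by (simp only: of_real_sum complex_norm_square)
  then have eq: "(\<Sum>x\<in>H. (norm (S x))\<^sup>2) = real (card K * card H)"
    by (metis of_real_eq_iff of_real_of_nat_eq)
  have "S x = of_nat (card K)" if "x \<in> T" for x
  proof -
    have "S x = (\<Sum>l\<in>K. 1)" unfolding S_def by (rule sum.cong) (use K(3) that in auto)
    then show ?thesis by simp
  qed
  then have "real (card T) * (real (card K))\<^sup>2 = (\<Sum>x\<in>T. (norm (S x))\<^sup>2)" by simp
  also have "\<dots> \<le> (\<Sum>x\<in>H. (norm (S x))\<^sup>2)" by (rule sum_mono2[OF finH T(2)]) simp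
  finally have "real (card K) * (real (card K) * real (card T)) \<le> real (card K) * real (card H)"
    unfolding eq by (simp add: power2_eq_square mult_ac)
  then have "real (card K) * real (card T) \<le> real (card H)" using False by simp
  then show ?thesis by (metis of_nat_le_iff of_nat_mult)
qed simp

text \<open>The fibres of restriction to \<open>T\<close> are no larger than the set
  \<open>K\<close> of characters trivial on \<open>T\<close>. By the Frattini argument
  \<open>K\<close> injects into the characters of the normalizer, where orthogonality gives
  \<open>|K| \<le> |N : T|\<close>.\<close>

lemma card_restrict_lin_chars:
  assumes fin: "finite (carrier G)" and p: "Factorial_Ring.prime p"
    and P: "subgroup P G" "card P = p ^ a" "\<not> p dvd card (rcosets P)"
    and T: "subgroup T G" "T \<subseteq> normalizer_of P"
  shows "card (lin_chars G (carrier G)) * card T \<le>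
    card ((\<lambda>l. restrict l T) ` lin_chars G (carrier G)) * card (normalizer_of P)"
proof -
  define L where "L = lin_chars G (carrier G)"
  define V where "V = normalizer_of P"
  have V: "subgroup V G" unfolding V_def by (rule subgroup_normalizer_of[OF fin P(1)])
  have Xc: "V \<subseteq> carrier G" by (rule subgroup.subset[OF V])
  have finL: "finite L" unfolding L_def by (rule finite_lin_chars[OF fin subgroup_self])
  define K where "K = {l \<in> L. \<forall>x\<in>T. l x = 1}"
  have inj: "l = l'" if "l \<in> L" "l' \<in> L" "\<And>x. x \<in> V \<Longrightarrow> l x = l' x" for l l'
  proof (rule lin_chars_eqI)
    show l: "l \<in> lin_chars G (carrier G)" "l' \<in> lin_chars G (carrier G)" using that by (auto simp: L_def)
    fix g assume g: "g \<in> carrier G"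
    have "restrict (\<lambda>x. l x / l' x) (carrier G) g = 1"
    proof (rule lin_char_trivial_on_normalizer[OF fin p P(1,3,2) lin_chars_divide[OF l subgroup_self] _ g])
      fix x assume "x \<in> normalizer_of P"
      then have x: "x \<in> V" "x \<in> carrier G" using Xc by (auto simp: V_def)
      then show "restrict (\<lambda>x. l x / l' x) (carrier G) x = 1"
        using that(3)[OF x(1)] lin_charsD(1)[OF l(2) x(2)] by simp
    qed
    then show "l g = l' g" using g lin_charsD(1)[OF l(2) g] by simp
  qed
  have "inj_on (\<lambda>l. restrict l V) K"
  proof (rule inj_onI)
    fix l l' assume l: "l \<in> K" "l' \<in> K" "restrict l V = restrict l' V"
    have "l x = l' x" if "x \<in> V" for x using fun_cong[OF l(3), of x] that by simp
    then show "l = l'" using inj[of l l'] l(1,2) by (simp add: K_def)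
  qed
  then have "card K = card ((\<lambda>l. restrict l V) ` K)" by (simp add: card_image)
  also have "card ((\<lambda>l. restrict l V) ` K) * card T \<le> card V"
    by (rule card_lin_chars_trivial_on[OF fin V T(1)])
      (use T(2) finL lin_chars_restrict[OF _ V Xc] in \<open>auto simp: V_def K_def L_def\<close>)
  finally have KT: "card K * card T \<le> card V" by simp
  have fib: "card {l \<in> L. restrict l T = \<beta>} \<le> card K" if \<beta>: "\<beta> \<in> (\<lambda>l. restrict l T) ` L" for \<beta>
  proof -
    obtain l0 where l0: "l0 \<in> L" "\<beta> = restrict l0 T" using \<beta> by blast
    let ?f = "\<lambda>l. restrict (\<lambda>x. l x / l0 x) (carrier G)"
    have l00: "l0 x \<noteq> 0" if "x \<in> carrier G" for x using l0 that lin_charsD(1)[of l0 G "carrier G" x] by (simp add: L_def)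
    show ?thesis
    proof (rule card_inj_on_le[of ?f])
      show "inj_on ?f {l \<in> L. restrict l T = \<beta>}"
      proof (rule inj_onI)
        fix l l' assume l: "l \<in> {l \<in> L. restrict l T = \<beta>}" "l' \<in> {l \<in> L. restrict l T = \<beta>}"
          and eq: "?f l = ?f l'"
        show "l = l'"
        proof (rule lin_chars_eqI)
          fix x assume x: "x \<in> carrier G"
          then show "l x = l' x" using fun_cong[OF eq, of x] l00 by simp
        qed (use l in \<open>auto simp: L_def\<close>)
      qed
      show "?f ` {l \<in> L. restrict l T = \<beta>} \<subseteq> K"
      proof (rule image_subsetI)
        fix l assume "l \<in> {l \<in> L. restrict l T = \<beta>}"
        then have l: "l \<in> L" "restrict l T = \<beta>" by auto
        have "?f l \<in> L" using lin_chars_divide[OF _ _ subgroup_self] l(1) l0(1) by (simp add: L_def)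
        moreover have "?f l x = 1" if x: "x \<in> T" for x
        proof -
          have xc: "x \<in> carrier G" using subgroup.mem_carrier[OF T(1) x] .
          have "l x = l0 x" using l(2) l0(2) x by (metis restrict_apply')
          then show ?thesis using l00[OF xc] xc by simp
        qed
        ultimately show "?f l \<in> K" by (simp add: K_def)
      qed
      show "finite K" using finL by (simp add: K_def)
    qed
  qed
  have "card L = (\<Sum>\<beta>\<in>(\<lambda>l. restrict l T) ` L. card {l \<in> L. restrict l T = \<beta>})"
    using sum.image_gen[OF finL, of "\<lambda>_. 1::nat" "\<lambda>l. restrict l T"] by simp
  also have "\<dots> \<le> (\<Sum>\<beta>\<in>(\<lambda>l. restrict l T) ` L. card K)" by (rule sum_mono) (rule fib)
  finally have "card L \<le> card ((\<lambda>l. restrict l T) ` L) * card K" by simp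
  then have "card L * card T \<le> card ((\<lambda>l. restrict l T) ` L) * (card K * card T)"
    by (metis mult.assoc mult_le_mono1)
  also have "\<dots> \<le> card ((\<lambda>l. restrict l T) ` L) * card V" using KT by simp
  finally show ?thesis by (simp add: L_def V_def)
qed

end

section \<open>The average degree\<close>

text \<open>Let \<open>w(d)\<close> be the right-hand side. For \<open>2 \<le> h \<le> p - 1\<close>
  the difference \<open>w(d) - h d\<close> grows with \<open>d\<close> and is
  \<open>(h - 2) (p + 1 - h)\<close> at \<open>d = h\<close>, which vanishes for
  \<open>h = 2\<close>. For \<open>h = 1\<close> the bound \<open>d \<ge> 2\<close> is used instead.
  For \<open>h \<ge> p\<close> the difference \<open>w(d) - (p - 1) d\<close> is
  \<open>4 d - 2 (p + 1)\<close>, and \<open>d \<ge> p\<close>.\<close>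

lemma weight_bound:
  assumes "p \<ge> 2" "1 \<le> h" "h \<le> d" "2 \<le> d"
  shows "min (real h) (real p - 1) * real d \<le> (real p + 3) * real d - 2 * (real p + 1)"
proof (cases "real h \<le> real p - 1")
  case True
  show ?thesis
  proof (cases "h = 1")
    case True
    have "(real p + 2) * 2 \<le> (real p + 2) * real d" using assms(4) by (intro mult_left_mono) auto
    then show ?thesis using True \<open>real h \<le> real p - 1\<close> by (simp add: algebra_simps)
  next
    case False
    then have "2 \<le> real h" using assms(2) by linarith
    then have "0 \<le> (real h - 2) * (real p + 1 - real h)" using True by (intro mult_nonneg_nonneg) auto
    moreover have "(real p + 3 - real h) * real h \<le> (real p + 3 - real h) * real d"
      using assms(3) True by (intro mult_left_mono) auto
    ultimately show ?thesis using True by (simp add: algebra_simps)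
  qed
next
  case False
  have "2 * (real p + 1) \<le> 4 * real d"
  proof (cases "p = 2")
    case True
    then show ?thesis using assms(4) by simp
  next
    case False
    then have "3 \<le> p" using assms(1) by simp
    moreover have "p \<le> d" using \<open>\<not> real h \<le> real p - 1\<close> assms(3) by linarith
    ultimately have "3 \<le> real p" "real p \<le> real d" by simp_all
    then show ?thesis by simp
  qed
  then show ?thesis using False by (simp add: algebra_simps)
qed

text \<open>The pair count: \<open>claim1\<close> bounds what one character can absorb,
  \<open>claim2\<close> supplies a character for every pair, and \<open>claim3\<close> deals with
  the orbit lengths. That \<open>C\<close> is nonempty keeps the average from being a division by
  zero.\<close>

lemma (in group) sum_weights_lower_bound:
  fixes p :: nat
  assumes fin: "finite (carrier G)" and p: "Factorial_Ring.prime p" and not_nilp: "\<not> p_nilpotent p G"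
  defines "C \<equiv> {\<chi> \<in> irr_chars_p' p G. char_degree G \<chi> \<noteq> 1}"
  shows "(real p - 1) * real (card (lin_chars G (carrier G))) \<le>
      (\<Sum>\<chi>\<in>C. (real p + 3) * real (char_degree G \<chi>) - 2 * (real p + 1))"
    and "C \<noteq> {}"
proof -
  have p2: "p \<ge> 2" using p by (rule prime_ge_2_nat)
  have N0: "card (carrier G) > 0" by (rule subgroup_card_pos[OF fin subgroup_self])
  obtain a m where am: "card (carrier G) = p ^ a * m" "\<not> p dvd m"
    using multiplicity_decompose'[of "card (carrier G)" p] N0 p by (metis not_prime_unit less_irrefl)
  obtain P where P: "subgroup P G" "card P = p ^ a"
    using sylow_thm[OF p is_group _ fin, of a m] am(1) by (auto simp: Coset.order_def)
  have pP: "\<not> p dvd card (rcosets P)"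
  proof -
    have "card (rcosets P) * p ^ a = m * p ^ a"
      using card_rcosets[OF fin P(1)] P(2) am(1) by (simp add: mult.commute)
    moreover have "p ^ a \<noteq> 0" using p2 by simp
    ultimately show ?thesis using am(2) by (metis mult_cancel2)
  qed
  interpret P: subgroup P G by (rule P(1))
  obtain \<mu>0 q0 where \<mu>0: "\<mu>0 \<in> lin_chars G P" "q0 \<in> P" "\<mu>0 q0 \<noteq> 1"
    and q0: "\<And>l. l \<in> lin_chars G (carrier G) \<Longrightarrow> l q0 = 1"
    using tate[OF fin p P pP not_nilp] by metis
  define L where "L = lin_chars G (carrier G)"
  have finL: "finite L" unfolding L_def by (rule finite_lin_chars[OF fin subgroup_self])
  have Lm: "l (x \<otimes> y) = l x * l y" if "l \<in> L" "x \<in> carrier G" "y \<in> carrier G" for l x y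
    using lin_charsD(2)[of l G "carrier G" x y] that by (simp add: L_def)
  have L0: "l x \<noteq> 0" if "l \<in> L" "x \<in> carrier G" for l x
    using lin_charsD(1)[of l G "carrier G" x] that by (simp add: L_def)
  have L1: "l \<one> = 1" if "l \<in> L" for l
    using lin_char_one[OF _ subgroup_self] that by (simp add: L_def)
  have Li: "l (inv x) = inverse (l x)" if "l \<in> L" "x \<in> carrier G" for l x
    using lin_char_inv[OF _ subgroup_self] that by (simp add: L_def)
  define V where "V = normalizer_of P"
  have V: "subgroup V G" unfolding V_def by (rule subgroup_normalizer_of[OF fin P(1)])
  interpret V: subgroup V G by (rule V)
  have Vconj: "x \<otimes> u \<otimes> inv x \<in> P" if "x \<in> V" "u \<in> P" for x u
    using that unfolding V_def normalizer_of_def by blast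
  have PV: "P \<subseteq> V" unfolding V_def normalizer_of_def by auto
  define R where "R = {u \<in> P. \<forall>l\<in>L. l u = 1}"
  have RP: "R \<subseteq> P" by (auto simp: R_def)
  have R: "subgroup R G"
    by (rule finite_subgroupI[OF fin]) (auto simp: R_def L1 Lm)
  interpret R: subgroup R G by (rule R)
  have Rconj: "x \<otimes> r \<otimes> inv x \<in> R" if "x \<in> V" "r \<in> R" for x r
  proof -
    have "l (x \<otimes> r \<otimes> inv x) = 1" if l: "l \<in> L" for l
    proof -
      have "l r = 1" using l \<open>r \<in> R\<close> by (simp add: R_def)
      moreover have "l x \<noteq> 0" using L0[OF l] \<open>x \<in> V\<close> by simp
      ultimately show ?thesis using l \<open>x \<in> V\<close> \<open>r \<in> R\<close> by (simp add: Lm Li)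
    qed
    then show ?thesis using that Vconj RP by (auto simp: R_def)
  qed
  have Rconj': "inv x \<otimes> r \<otimes> x \<in> R" if "x \<in> V" "r \<in> R" for x r
    using Rconj[of "inv x" r] that by simp
  have Pconj': "inv x \<otimes> u \<otimes> x \<in> P" if "x \<in> V" "u \<in> P" for x u
    using Vconj[of "inv x" u] that by simp
  \<comment> \<open>Only restrictions of characters of \<open>P\<close> are taken: these are
    invariant under \<open>P\<close>, so that the stabilizers contain \<open>P\<close>, and transfer
    extends them to the stabilizers.\<close>
  define \<Omega> where "\<Omega> = (\<lambda>\<mu>. restrict \<mu> R) ` lin_chars G P - {restrict (\<lambda>_. 1) R}"
  have \<Omega>L: "\<eta> \<in> lin_chars G R" if "\<eta> \<in> \<Omega>" for \<eta>
    using that lin_chars_restrict[OF _ R RP] by (auto simp: \<Omega>_def)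
  have fin\<Omega>: "finite \<Omega>" using finite_lin_chars[OF fin P(1)] by (simp add: \<Omega>_def)
  have \<Omega>1: "\<exists>r\<in>R. \<eta> r \<noteq> 1" if "\<eta> \<in> \<Omega>" for \<eta>
  proof (rule ccontr)
    assume "\<not> ?thesis"
    then have "\<eta> = restrict (\<lambda>_. 1) R"
      using lin_charsD(3)[OF \<Omega>L[OF that]] by (intro extensionalityI[of _ R]) auto
    then show False using that by (simp add: \<Omega>_def)
  qed
  have \<Omega>eqI: "\<eta> = \<eta>'" if "\<eta> \<in> \<Omega>" "\<eta>' \<in> \<Omega>" "\<And>r. r \<in> R \<Longrightarrow> \<eta> r = \<eta>' r" for \<eta> \<eta>'
    by (rule lin_chars_eqI[OF \<Omega>L[OF that(1)] \<Omega>L[OF that(2)] that(3)])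
  \<comment> \<open>The value \<open>z\<close> of \<open>\<mu>0\<close> at \<open>q0\<close> is
    nontrivial of \<open>p\<close>-power order, so the powers \<open>\<mu>0 ^ i\<close> with
    \<open>0 < i < p\<close> are distinct and nontrivial at \<open>q0\<close>, a point of
    \<open>R\<close>.\<close>
  have card\<Omega>: "p - 1 \<le> card \<Omega>"
  proof -
    have q0R: "q0 \<in> R" using \<mu>0(2) q0 by (simp add: R_def L_def)
    define z where "z = \<mu>0 q0"
    have zp: "z ^ p ^ a = 1" using lin_char_pow_card[OF fin P(1) \<mu>0(1,2)] P(2) by (simp add: z_def)
    have z1: "z ^ i \<noteq> 1" if i: "0 < i" "i < p" for i
    proof
      assume zi: "z ^ i = 1"
      have "\<not> p dvd i" using i by (auto dest: dvd_imp_le)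
      then have "coprime i (p ^ a)" using prime_imp_coprime[OF p] by (simp add: coprime_commute)
      then show False using coprime_roots_of_unity[OF zi zp] i \<mu>0(3) by (simp add: z_def)
    qed
    have z0: "z \<noteq> 0" unfolding z_def by (rule lin_charsD(1)[OF \<mu>0(1,2)])
    define f where "f i = restrict (\<lambda>u. \<mu>0 u ^ i) R" for i :: nat
    have f: "f i q0 = z ^ i" for i using q0R by (simp add: f_def z_def)
    have "inj_on f {1..<p}"
    proof (rule linorder_inj_onI')
      fix i j assume ij: "i \<in> {1..<p}" "j \<in> {1..<p}" "i < j"
      show "f i \<noteq> f j"
      proof
        assume "f i = f j"
        then have "z ^ i = z ^ i * z ^ (j - i)" using f ij by (metis le_add_diff_inverse less_imp_le_nat power_add)
        then show False using z1[of "j - i"] z0 ij by (simp add: less_imp_diff_less)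
      qed
    qed
    moreover have "f ` {1..<p} \<subseteq> \<Omega>"
    proof
      fix \<eta> assume "\<eta> \<in> f ` {1..<p}"
      then obtain i where "i \<in> {1..<p}" "\<eta> = f i" by blast
      then have i: "0 < i" "i < p" "\<eta> = f i" by auto
      have "f i = restrict (restrict (\<lambda>u. \<mu>0 u ^ i) P) R"
        using RP by (intro ext) (auto simp: f_def restrict_def)
      moreover have "f i \<noteq> restrict (\<lambda>_. 1) R" using f[of i] z1[OF i(1,2)] q0R by auto
      ultimately show "\<eta> \<in> \<Omega>" unfolding \<Omega>_def i(3)
        using lin_chars_power[OF \<mu>0(1) P(1), of i] by blast
    qed
    ultimately show ?thesis using card_inj_on_le[OF _ _ fin\<Omega>, of f "{1..<p}"] by simp
  qed
  \<comment> \<open>The inverse on the left makes this a left action, and restriction to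
    \<open>R\<close> keeps the functions extensional.\<close>
  define act where "act g \<eta> = restrict (\<lambda>r. \<eta> (inv g \<otimes> r \<otimes> g)) R" for g and \<eta> :: "'a \<Rightarrow> complex"
  have act: "act g \<eta> r = \<eta> (inv g \<otimes> r \<otimes> g)" if "r \<in> R" for g \<eta> r using that by (simp add: act_def)
  have act_conj: "act g \<eta> (g \<otimes> r \<otimes> inv g) = \<eta> r" if "g \<in> V" "r \<in> R" for g \<eta> r
  proof -
    have "inv g \<otimes> (g \<otimes> r \<otimes> inv g) \<otimes> g = r"
      using that by (simp add: m_assoc) (simp add: m_assoc[symmetric])
    then show ?thesis using act[OF Rconj[OF that]] by simp
  qed
  have act\<Omega>: "act g \<eta> \<in> \<Omega>" if g: "g \<in> V" and \<eta>: "\<eta> \<in> \<Omega>" for g \<eta>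
  proof -
    obtain \<mu> where \<mu>: "\<mu> \<in> lin_chars G P" "\<eta> = restrict \<mu> R" using \<eta> by (auto simp: \<Omega>_def)
    define \<nu> where "\<nu> = restrict (\<lambda>u. \<mu> (inv g \<otimes> u \<otimes> g)) P"
    have "\<nu> \<in> lin_chars G P"
      unfolding lin_chars_def
    proof (intro CollectI conjI ballI)
      fix u assume u: "u \<in> P"
      show "\<nu> u \<noteq> 0" using lin_charsD(1)[OF \<mu>(1) Pconj'[OF g u]] u by (simp add: \<nu>_def)
      fix v assume v: "v \<in> P"
      have "g \<otimes> (inv g \<otimes> (v \<otimes> g)) = v \<otimes> g" using g v by (simp add: m_assoc[symmetric])
      then have "inv g \<otimes> (u \<otimes> v) \<otimes> g = (inv g \<otimes> u \<otimes> g) \<otimes> (inv g \<otimes> v \<otimes> g)"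
        using g u v by (simp add: m_assoc)
      then show "\<nu> (u \<otimes> v) = \<nu> u * \<nu> v"
        using lin_charsD(2)[OF \<mu>(1) Pconj'[OF g u] Pconj'[OF g v]] u v by (simp add: \<nu>_def)
    qed (simp add: \<nu>_def)
    moreover have "act g \<eta> = restrict \<nu> R"
      using Rconj'[OF g] RP by (intro ext) (auto simp: act_def \<nu>_def \<mu>(2) restrict_def)
    moreover have "act g \<eta> \<noteq> restrict (\<lambda>_. 1) R"
    proof
      assume eq: "act g \<eta> = restrict (\<lambda>_. 1) R"
      obtain r where r: "r \<in> R" "\<eta> r \<noteq> 1" using \<Omega>1[OF \<eta>] by blast
      then show False using act_conj[OF g r(1), of \<eta>] Rconj[OF g r(1)] eq by simp
    qed
    ultimately show ?thesis unfolding \<Omega>_def by blast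
  qed
  have act_one: "act \<one> \<eta> = \<eta>" if "\<eta> \<in> \<Omega>" for \<eta>
    by (rule \<Omega>eqI[OF act\<Omega>[OF V.one_closed that] that]) (simp add: act)
  have act_mult: "act (g \<otimes> h) \<eta> = act g (act h \<eta>)" if g: "g \<in> V" and h: "h \<in> V" and \<eta>: "\<eta> \<in> \<Omega>" for g h \<eta>
  proof (rule \<Omega>eqI)
    fix r assume r: "r \<in> R"
    have "inv (g \<otimes> h) \<otimes> r \<otimes> (g \<otimes> h) = inv h \<otimes> (inv g \<otimes> r \<otimes> g) \<otimes> h"
      using g h r by (simp add: m_assoc inv_mult_group)
    then show "act (g \<otimes> h) \<eta> r = act g (act h \<eta>) r"
      using act[OF r] act[OF Rconj'[OF g r]] by simp
  qed (use g h \<eta> act\<Omega> in auto)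
  have act_inj: "\<eta> = \<eta>'" if g: "g \<in> V" and \<eta>: "\<eta> \<in> \<Omega>" "\<eta>' \<in> \<Omega>" and eq: "act g \<eta> = act g \<eta>'" for g \<eta> \<eta>'
  proof (rule \<Omega>eqI[OF \<eta>])
    fix r assume r: "r \<in> R"
    show "\<eta> r = \<eta>' r" using act_conj[OF g r, of \<eta>] act_conj[OF g r, of \<eta>'] eq by simp
  qed
  define orb where "orb \<eta> = (\<lambda>g. act g \<eta>) ` V" for \<eta>
  define T where "T \<eta> = {g \<in> V. act g \<eta> = \<eta>}" for \<eta>
  define h where "h \<eta> = card (orb \<eta>)" for \<eta>
  have orb\<Omega>: "orb \<eta> \<subseteq> \<Omega>" if "\<eta> \<in> \<Omega>" for \<eta> using act\<Omega> that by (auto simp: orb_def)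
  have fin_orb: "finite (orb \<eta>)" if "\<eta> \<in> \<Omega>" for \<eta> using finite_subset[OF orb\<Omega>[OF that] fin\<Omega>] .
  have orb_self: "\<eta> \<in> orb \<eta>" if "\<eta> \<in> \<Omega>" for \<eta>
    unfolding orb_def by (rule image_eqI[of _ _ \<one>]) (use act_one that in simp_all)
  have h1: "1 \<le> h \<eta>" if "\<eta> \<in> \<Omega>" for \<eta>
    using orb_self[OF that] fin_orb[OF that] unfolding h_def by (metis One_nat_def Suc_leI card_gt_0_iff empty_iff)
  have orb_eq: "orb \<eta>' = orb \<eta>" if \<eta>: "\<eta> \<in> \<Omega>" and \<eta>': "\<eta>' \<in> orb \<eta>" for \<eta> \<eta>'
  proof -
    obtain g where g: "g \<in> V" "\<eta>' = act g \<eta>" using \<eta>' by (auto simp: orb_def)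
    have "act k \<eta>' \<in> orb \<eta>" if "k \<in> V" for k
      using act_mult[OF that g(1) \<eta>] g that unfolding orb_def by (metis V.m_closed imageI)
    moreover have "act k \<eta> \<in> orb \<eta>'" if k: "k \<in> V" for k
    proof -
      have "act (k \<otimes> inv g) \<eta>' = act (k \<otimes> inv g \<otimes> g) \<eta>"
        using act_mult[of "k \<otimes> inv g" g \<eta>] k g \<eta> by simp
      also have "k \<otimes> inv g \<otimes> g = k" using k g by (simp add: m_assoc)
      finally show ?thesis unfolding orb_def using k g(1) by (metis V.m_closed V.m_inv_closed imageI)
    qed
    ultimately show ?thesis by (auto simp: orb_def)
  qed
  have hT: "h \<eta> * card (T \<eta>) = card V" if \<eta>: "\<eta> \<in> \<Omega>" for \<eta>
    unfolding h_def orb_def T_def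
    by (rule card_orbit[OF fin V act_one[OF \<eta>] act_mult[OF _ _ \<eta>]])
      (use act_inj orb\<Omega>[OF \<eta>] in \<open>unfold orb_def, blast+\<close>)
  have T: "subgroup (T \<eta>) G" if \<eta>: "\<eta> \<in> \<Omega>" for \<eta>
    by (rule finite_subgroupI[OF fin]) (use act_one[OF \<eta>] act_mult[OF _ _ \<eta>] in \<open>auto simp: T_def\<close>)
  have TV: "T \<eta> \<subseteq> V" for \<eta> by (auto simp: T_def)
  have PT: "P \<subseteq> T \<eta>" if \<eta>: "\<eta> \<in> \<Omega>" for \<eta>
  proof
    fix u assume u: "u \<in> P"
    obtain \<mu> where \<mu>: "\<mu> \<in> lin_chars G P" "\<eta> = restrict \<mu> R" using \<eta> by (auto simp: \<Omega>_def)
    have uV: "u \<in> V" using u PV by blast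
    have "act u \<eta> = \<eta>"
    proof (rule \<Omega>eqI[OF act\<Omega>[OF uV \<eta>] \<eta>])
      fix r assume r: "r \<in> R"
      then have rP: "r \<in> P" using RP by blast
      have "\<mu> (inv u \<otimes> r \<otimes> u) = \<mu> r"
        using lin_charsD(1)[OF \<mu>(1) u] u rP
        by (simp add: lin_charsD(2)[OF \<mu>(1)] lin_char_inv[OF \<mu>(1) P(1)])
      then show "act u \<eta> r = \<eta> r" using r Rconj'[OF uV r] by (simp add: act \<mu>(2))
    qed
    then show "u \<in> T \<eta>" using uV by (simp add: T_def)
  qed
  have RT: "R \<subseteq> T \<eta>" if "\<eta> \<in> \<Omega>" for \<eta> using RP PT[OF that] by blast
  have "\<exists>\<gamma>\<in>lin_chars G (T \<eta>). \<forall>r\<in>R. \<gamma> r = \<eta> r" if \<eta>: "\<eta> \<in> \<Omega>" for \<eta>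
  proof -
    obtain \<mu> where \<mu>: "\<mu> \<in> lin_chars G P" "\<eta> = restrict \<mu> R" using \<eta> by (auto simp: \<Omega>_def)
    have "t \<otimes> r \<otimes> inv t \<in> P \<and> \<mu> (t \<otimes> r \<otimes> inv t) = \<mu> r" if t: "t \<in> T \<eta>" and r: "r \<in> R" for t r
    proof -
      have tV: "t \<in> V" "act t \<eta> = \<eta>" using t by (auto simp: T_def)
      have "\<eta> (t \<otimes> r \<otimes> inv t) = \<eta> r" using act_conj[OF tV(1) r, of \<eta>] tV(2) by simp
      then show ?thesis using Rconj[OF tV(1) r] r RP by (auto simp: \<mu>(2))
    qed
    then obtain \<gamma> where "\<gamma> \<in> lin_chars G (T \<eta>)" "\<And>r. r \<in> R \<Longrightarrow> \<gamma> r = \<mu> r"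
      using extend_lin_char[OF fin p P pP T[OF \<eta>] PT[OF \<eta>] \<mu>(1) RP] by metis
    then show ?thesis using \<mu>(2) by (intro bexI[of _ \<gamma>]) auto
  qed
  then obtain \<gamma>0 where \<gamma>0: "\<And>\<eta>. \<eta> \<in> \<Omega> \<Longrightarrow> \<gamma>0 \<eta> \<in> lin_chars G (T \<eta>)"
    "\<And>\<eta> r. \<eta> \<in> \<Omega> \<Longrightarrow> r \<in> R \<Longrightarrow> \<gamma>0 \<eta> r = \<eta> r" by metis
  \<comment> \<open>Twists of the extension \<open>\<gamma>0 \<eta>\<close>. Members of
    \<open>L\<close> are 1 on \<open>R\<close>, so every twist still agrees with
    \<open>\<eta>\<close> there.\<close>
  define \<Gamma> where "\<Gamma> \<eta> = (\<lambda>\<beta>. restrict (\<lambda>x. \<gamma>0 \<eta> x * \<beta> x) (T \<eta>)) ` (\<lambda>l. restrict l (T \<eta>)) ` L" for \<eta>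
  have fin\<Gamma>: "finite (\<Gamma> \<eta>)" for \<eta> using finL by (simp add: \<Gamma>_def)
  have \<Gamma>L: "\<gamma> \<in> lin_chars G (T \<eta>)" if "\<eta> \<in> \<Omega>" "\<gamma> \<in> \<Gamma> \<eta>" for \<eta> \<gamma>
    using that lin_chars_mult[OF \<gamma>0(1)[OF that(1)] _ T[OF that(1)]]
      lin_chars_restrict[OF _ T[OF that(1)] subgroup.subset[OF T[OF that(1)]]] by (auto simp: \<Gamma>_def L_def)
  have \<Gamma>R: "\<gamma> r = \<eta> r" if "\<eta> \<in> \<Omega>" "\<gamma> \<in> \<Gamma> \<eta>" "r \<in> R" for \<eta> \<gamma> r
  proof -
    have "r \<in> T \<eta>" using RT that by blast
    then show ?thesis using that \<gamma>0(2) by (auto simp: \<Gamma>_def R_def)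
  qed
  \<comment> \<open>Twisting is injective, so this counts the restrictions of \<open>L\<close> to
    \<open>T \<eta>\<close>, and \<open>h \<eta>\<close> is the index of \<open>T \<eta>\<close> in
    \<open>V\<close>.\<close>
  have card\<Gamma>: "card L \<le> card (\<Gamma> \<eta>) * h \<eta>" if \<eta>: "\<eta> \<in> \<Omega>" for \<eta>
  proof -
    have "inj_on (\<lambda>\<beta>. restrict (\<lambda>x. \<gamma>0 \<eta> x * \<beta> x) (T \<eta>)) ((\<lambda>l. restrict l (T \<eta>)) ` L)"
    proof (rule inj_onI)
      fix \<beta> \<beta>' assume b: "\<beta> \<in> (\<lambda>l. restrict l (T \<eta>)) ` L" "\<beta>' \<in> (\<lambda>l. restrict l (T \<eta>)) ` L"
        and eq: "restrict (\<lambda>x. \<gamma>0 \<eta> x * \<beta> x) (T \<eta>) = restrict (\<lambda>x. \<gamma>0 \<eta> x * \<beta>' x) (T \<eta>)"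
      show "\<beta> = \<beta>'"
      proof (rule extensionalityI)
        show "\<beta> \<in> extensional (T \<eta>)" "\<beta>' \<in> extensional (T \<eta>)" using b by auto
        fix x assume x: "x \<in> T \<eta>"
        then show "\<beta> x = \<beta>' x"
          using fun_cong[OF eq, of x] lin_charsD(1)[OF \<gamma>0(1)[OF \<eta>] x] by simp
      qed
    qed
    then have c: "card (\<Gamma> \<eta>) = card ((\<lambda>l. restrict l (T \<eta>)) ` L)" by (simp add: \<Gamma>_def card_image)
    have "card L * card (T \<eta>) \<le> card (\<Gamma> \<eta>) * card V"
      using card_restrict_lin_chars[OF fin p P pP T[OF \<eta>] TV[of \<eta>, unfolded V_def]] c by (simp add: L_def V_def)
    also have "\<dots> = card (\<Gamma> \<eta>) * h \<eta> * card (T \<eta>)" using hT[OF \<eta>] by (simp add: mult.assoc)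
    finally show ?thesis using subgroup_card_pos[OF fin T[OF \<eta>]] by simp
  qed
  have C: "\<exists>n \<rho>. mat_rep G n \<rho> \<and> \<chi> = character_of G \<rho> \<and> char_degree G \<chi> = n \<and> 0 < n" if "\<chi> \<in> irr_chars G" for \<chi>
    using that char_degree_character by (auto simp: irr_chars_def irreducible_iff)
  have finC: "finite C"
    using finite_irr_chars[OF fin] by (simp add: C_def irr_chars_p'_def)
  define w where "w \<chi> = (real p + 3) * real (char_degree G \<chi>) - 2 * (real p + 1)" for \<chi>
  define c where "c \<eta> = min (real (h \<eta>)) (real p - 1)" for \<eta>
  have c0: "0 \<le> c \<eta>" for \<eta> using p2 by (simp add: c_def)
  define s where "s \<eta> \<chi> = (\<Sum>\<gamma>\<in>\<Gamma> \<eta>. char_mult (T \<eta>) \<gamma> \<chi>)" for \<eta> \<chi>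
  \<comment> \<open>All pairs together occur at most \<open>n\<close> times in
    \<open>\<chi>\<close>, and each \<open>\<eta>\<close> that occurs has
    \<open>c \<eta> n \<le> w \<chi>\<close>. Weighting by the multiplicities, summing and
    cancelling \<open>n\<close> gives the bound.\<close>
  have claim1: "(\<Sum>\<eta>\<in>\<Omega>. c \<eta> * real (s \<eta> \<chi>)) \<le> w \<chi>" if \<chi>: "\<chi> \<in> C" for \<chi>
  proof -
    have "\<chi> \<in> irr_chars G" using \<chi> by (simp add: C_def irr_chars_p'_def)
    then obtain n \<rho> where \<rho>: "mat_rep G n \<rho>" "\<chi> = character_of G \<rho>" "char_degree G \<chi> = n" "0 < n"
      using C by blast
    have n2: "2 \<le> n" using \<chi> \<rho>(3,4) by (simp add: C_def)
    have "(\<Sum>(\<eta>, \<gamma>)\<in>Sigma \<Omega> \<Gamma>. char_mult (T \<eta>) \<gamma> \<chi>) \<le> n"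
      unfolding \<rho>(2) case_prod_beta
    proof (rule sum_char_mult_le[OF fin \<rho>(1)])
      show "finite (Sigma \<Omega> \<Gamma>)" using fin\<Omega> fin\<Gamma> by auto
      show "subgroup (T (fst i)) G" if "i \<in> Sigma \<Omega> \<Gamma>" for i using that T by auto
      show "snd i \<in> lin_chars G (T (fst i))" if "i \<in> Sigma \<Omega> \<Gamma>" for i using that \<Gamma>L by auto
      \<comment> \<open>Pairs over the same \<open>\<eta>\<close> differ on its stabilizer; pairs
        over different ones already differ on \<open>R\<close>, which lies in both groups.\<close>
      show "\<exists>r\<in>T (fst i) \<inter> T (fst j). snd i r \<noteq> snd j r"
        if i: "i \<in> Sigma \<Omega> \<Gamma>" and j: "j \<in> Sigma \<Omega> \<Gamma>" and ij: "i \<noteq> j" for i j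
      proof -
        obtain \<eta> \<gamma> \<eta>' \<gamma>' where e: "i = (\<eta>, \<gamma>)" "j = (\<eta>', \<gamma>')" by (metis surj_pair)
        have m: "\<eta> \<in> \<Omega>" "\<gamma> \<in> \<Gamma> \<eta>" "\<eta>' \<in> \<Omega>" "\<gamma>' \<in> \<Gamma> \<eta>'" using i j e by auto
        show ?thesis
        proof (cases "\<eta> = \<eta>'")
          case True
          then have "\<gamma> \<noteq> \<gamma>'" using ij e by simp
          then obtain x where "x \<in> T \<eta>" "\<gamma> x \<noteq> \<gamma>' x"
            using lin_chars_eqI[OF \<Gamma>L[OF m(1,2)]] \<Gamma>L[OF m(3,4)] True by blast
          then show ?thesis using e True by auto
        next
          case False
          then obtain r where r: "r \<in> R" "\<eta> r \<noteq> \<eta>' r" using \<Omega>eqI[OF m(1,3)] by blast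
          then have "r \<in> T \<eta> \<inter> T \<eta>'" using RT[OF m(1)] RT[OF m(3)] by blast
          moreover have "\<gamma> r \<noteq> \<gamma>' r" using r \<Gamma>R[OF m(1,2) r(1)] \<Gamma>R[OF m(3,4) r(1)] by simp
          ultimately show ?thesis using e by (intro bexI[of _ r]) auto
        qed
      qed
    qed
    then have sum_s: "(\<Sum>\<eta>\<in>\<Omega>. s \<eta> \<chi>) \<le> n"
      using fin\<Omega> fin\<Gamma> by (simp add: s_def sum.Sigma)
    have w: "w \<chi> = (real p + 3) * real n - 2 * (real p + 1)" by (simp add: w_def \<rho>(3))
    have "c \<eta> * real n \<le> w \<chi>" if \<eta>: "\<eta> \<in> \<Omega>" and pos: "s \<eta> \<chi> \<noteq> 0" for \<eta>
    proof -
      obtain \<gamma> where \<gamma>: "\<gamma> \<in> \<Gamma> \<eta>" "char_mult (T \<eta>) \<gamma> \<chi> > 0"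
        using pos fin\<Gamma> by (auto simp: s_def)
      have mR: "char_mult R \<eta> \<chi> > 0"
        using char_mult_restrict_pos[OF fin \<rho>(1) T[OF \<eta>] \<Gamma>L[OF \<eta> \<gamma>(1)] R RT[OF \<eta>] \<Omega>L[OF \<eta>] \<Gamma>R[OF \<eta> \<gamma>(1)]]
          \<gamma>(2) \<rho>(2) by simp
      \<comment> \<open>All conjugates of \<open>\<eta>\<close> under the normalizer occur in
        \<open>\<chi>\<close> with the same multiplicity and have orthogonal projections, so
        \<open>h \<eta> \<le> n\<close>.\<close>
      have mO: "1 \<le> char_mult R \<eta>' \<chi>" if "\<eta>' \<in> orb \<eta>" for \<eta>'
      proof -
        obtain g where g: "g \<in> V" "\<eta>' = act g \<eta>" using \<open>\<eta>' \<in> orb \<eta>\<close> by (auto simp: orb_def)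
        have cancel: "g \<otimes> (inv g \<otimes> y) = y" "inv g \<otimes> (g \<otimes> y) = y" if "y \<in> R" for y
          using g(1) that by (simp_all add: m_assoc[symmetric])
        have "char_mult R \<eta>' \<chi> = char_mult R \<eta> \<chi>"
          unfolding \<rho>(2)
        proof (rule char_mult_conj[OF \<rho>(1), of "inv g"])
          show "bij_betw (\<lambda>r. inv g \<otimes> r \<otimes> inv (inv g)) R R"
            by (rule bij_betwI[of _ _ _ "\<lambda>r. g \<otimes> r \<otimes> inv g"])
              (use g(1) Rconj Rconj' in \<open>auto simp: m_assoc cancel\<close>)
          show "\<eta>' r = \<eta> (inv g \<otimes> r \<otimes> inv (inv g))" if "r \<in> R" for r
            using act[OF that] g by simp
        qed (use g(1) R.subset in auto)
        then show ?thesis using mR by simp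
      qed
      have "h \<eta> = (\<Sum>\<eta>'\<in>orb \<eta>. 1)" by (simp add: h_def)
      also have "\<dots> \<le> (\<Sum>\<eta>'\<in>orb \<eta>. char_mult R \<eta>' \<chi>)" by (rule sum_mono) (rule mO)
      also have "\<dots> \<le> n"
        unfolding \<rho>(2)
      proof (rule sum_char_mult_le[OF fin \<rho>(1) fin_orb[OF \<eta>]])
        show "\<eta>' \<in> lin_chars G R" if "\<eta>' \<in> orb \<eta>" for \<eta>' using \<Omega>L orb\<Omega>[OF \<eta>] that by blast
        show "\<exists>r\<in>R \<inter> R. \<eta>1 r \<noteq> \<eta>2 r" if "\<eta>1 \<in> orb \<eta>" "\<eta>2 \<in> orb \<eta>" "\<eta>1 \<noteq> \<eta>2" for \<eta>1 \<eta>2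
          using \<Omega>eqI[of \<eta>1 \<eta>2] orb\<Omega>[OF \<eta>] that by blast
      qed (rule R)
      finally have "h \<eta> \<le> n" .
      then show ?thesis unfolding c_def w by (intro weight_bound p2 h1[OF \<eta>] n2)
    qed
    then have "c \<eta> * real (s \<eta> \<chi>) * real n \<le> w \<chi> * real (s \<eta> \<chi>)" if "\<eta> \<in> \<Omega>" for \<eta>
      using that mult_right_mono[of "c \<eta> * real n" "w \<chi>" "real (s \<eta> \<chi>)"]
      by (cases "s \<eta> \<chi> = 0") (auto simp: mult_ac)
    then have "(\<Sum>\<eta>\<in>\<Omega>. c \<eta> * real (s \<eta> \<chi>) * real n) \<le> (\<Sum>\<eta>\<in>\<Omega>. w \<chi> * real (s \<eta> \<chi>))"
      by (rule sum_mono)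
    then have "(\<Sum>\<eta>\<in>\<Omega>. c \<eta> * real (s \<eta> \<chi>)) * real n \<le> w \<chi> * real (\<Sum>\<eta>\<in>\<Omega>. s \<eta> \<chi>)"
      by (simp add: sum_distrib_left sum_distrib_right)
    also have "\<dots> \<le> w \<chi> * real n"
    proof (rule mult_left_mono)
      show "real (\<Sum>\<eta>\<in>\<Omega>. s \<eta> \<chi>) \<le> real n" using sum_s by (rule of_nat_mono)
      have "(real p + 3) * 2 \<le> (real p + 3) * real n" using n2 by (intro mult_left_mono) auto
      then show "0 \<le> w \<chi>" unfolding w by simp
    qed
    finally show ?thesis using \<rho>(4) by simp
  qed
  have claim2: "\<exists>\<chi>\<in>C. 1 \<le> char_mult (T \<eta>) \<gamma> \<chi>" if \<eta>: "\<eta> \<in> \<Omega>" and \<gamma>: "\<gamma> \<in> \<Gamma> \<eta>" for \<eta> \<gamma>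
  proof -
    have "card (rcosets (T \<eta>)) dvd card (rcosets P)"
      using card_cosets_dvd[OF fin T[OF \<eta>] P(1) PT[OF \<eta>]] by (metis dvd_triv_left)
    then have "\<not> p dvd card (rcosets (T \<eta>))" using pP dvd_trans by blast
    then obtain \<chi> where \<chi>: "\<chi> \<in> irr_chars_p' p G" "char_mult (T \<eta>) \<gamma> \<chi> > 0"
      using exists_irr_char_over[OF fin T[OF \<eta>] \<Gamma>L[OF \<eta> \<gamma>]] by metis
    then have "\<chi> \<in> irr_chars G" by (simp add: irr_chars_p'_def)
    then obtain n \<rho> where \<rho>: "mat_rep G n \<rho>" "\<chi> = character_of G \<rho>" "char_degree G \<chi> = n" "0 < n"
      using C by blast
    \<comment> \<open>A linear \<open>\<chi>\<close> over \<open>\<gamma>\<close> would agree with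
      \<open>\<eta>\<close> on \<open>R\<close>, where every linear character of \<open>G\<close> is
      1.\<close>
    have "n \<noteq> 1"
    proof
      assume n: "n = 1"
      have mR: "char_mult R \<eta> \<chi> > 0"
        using char_mult_restrict_pos[OF fin \<rho>(1) T[OF \<eta>] \<Gamma>L[OF \<eta> \<gamma>] R RT[OF \<eta>] \<Omega>L[OF \<eta>] \<Gamma>R[OF \<eta> \<gamma>]]
          \<chi>(2) \<rho>(2) by simp
      obtain r where r: "r \<in> R" "\<eta> r \<noteq> 1" using \<Omega>1[OF \<eta>] by blast
      have "\<eta> r = \<chi> r"
        using char_mult_lin_char[OF fin R \<Omega>L[OF \<eta>] \<rho>(1)[unfolded n] _ r(1)] mR \<rho>(2) by simp
      moreover have "\<chi> r = 1"
        using degree_one_lin_char[OF \<rho>(1)[unfolded n]] r(1) \<rho>(2) by (simp add: R_def L_def)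
      ultimately show False using r(2) by simp
    qed
    then have "\<chi> \<in> C" using \<chi>(1) \<rho>(3) by (simp add: C_def)
    then show ?thesis using \<chi>(2) by (intro bexI[of _ \<chi>]) simp_all
  qed
  \<comment> \<open>A single orbit of length \<open>h \<ge> p - 1\<close> already contributes
    \<open>h (p - 1) / h\<close>. If there is none, every term is 1 and the size of
    \<open>\<Omega>\<close> decides.\<close>
  have claim3: "real p - 1 \<le> (\<Sum>\<eta>\<in>\<Omega>. c \<eta> / real (h \<eta>))"
  proof (cases "\<exists>\<eta>\<in>\<Omega>. real p - 1 \<le> real (h \<eta>)")
    case True
    then obtain \<eta> where \<eta>: "\<eta> \<in> \<Omega>" "real p - 1 \<le> real (h \<eta>)" by blast
    have "c \<eta>' / real (h \<eta>') = (real p - 1) / real (h \<eta>)" if "\<eta>' \<in> orb \<eta>" for \<eta>'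
      using orb_eq[OF \<eta>(1) that] \<eta>(2) by (simp add: c_def h_def min_def)
    then have "(\<Sum>\<eta>'\<in>orb \<eta>. c \<eta>' / real (h \<eta>')) = real (h \<eta>) * ((real p - 1) / real (h \<eta>))"
      by (simp add: h_def)
    also have "\<dots> = real p - 1" using h1[OF \<eta>(1)] by simp
    finally have "real p - 1 = (\<Sum>\<eta>'\<in>orb \<eta>. c \<eta>' / real (h \<eta>'))" by simp
    also have "\<dots> \<le> (\<Sum>\<eta>'\<in>\<Omega>. c \<eta>' / real (h \<eta>'))"
      by (rule sum_mono2[OF fin\<Omega> orb\<Omega>[OF \<eta>(1)]]) (use c0 in simp)
    finally show ?thesis .
  next
    case False
    have "c \<eta> / real (h \<eta>) = 1" if "\<eta> \<in> \<Omega>" for \<eta>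
    proof -
      have "real (h \<eta>) < real p - 1" using False that by force
      then have "c \<eta> = real (h \<eta>)" by (simp add: c_def)
      then show ?thesis using h1[OF that] by simp
    qed
    then have "(\<Sum>\<eta>\<in>\<Omega>. c \<eta> / real (h \<eta>)) = (\<Sum>\<eta>\<in>\<Omega>. 1)" by (rule sum.cong[OF refl])
    then have "(\<Sum>\<eta>\<in>\<Omega>. c \<eta> / real (h \<eta>)) = real (card \<Omega>)" by simp
    moreover have "real p - 1 \<le> real (card \<Omega>)" using card\<Omega> p2 by linarith
    ultimately show ?thesis by simp
  qed
  \<comment> \<open>Each \<open>\<eta>\<close> has at least \<open>|L| / h \<eta>\<close>
    extensions, each of which needs a character in \<open>C\<close>; exchanging the sums charges
    them to the characters, where \<open>claim1\<close> applies.\<close>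
  have "(real p - 1) * real (card L) \<le> (\<Sum>\<eta>\<in>\<Omega>. c \<eta> / real (h \<eta>)) * real (card L)"
    by (rule mult_right_mono[OF claim3]) simp
  also have "\<dots> = (\<Sum>\<eta>\<in>\<Omega>. c \<eta> / real (h \<eta>) * real (card L))" by (rule sum_distrib_right)
  also have "\<dots> \<le> (\<Sum>\<eta>\<in>\<Omega>. c \<eta> * real (card (\<Gamma> \<eta>)))"
  proof (rule sum_mono)
    fix \<eta> assume \<eta>: "\<eta> \<in> \<Omega>"
    have "real (card L) \<le> real (card (\<Gamma> \<eta>)) * real (h \<eta>)"
      using card\<Gamma>[OF \<eta>] by (metis of_nat_le_iff of_nat_mult)
    then have "c \<eta> / real (h \<eta>) * real (card L) \<le> c \<eta> / real (h \<eta>) * (real (card (\<Gamma> \<eta>)) * real (h \<eta>))"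
      using c0[of \<eta>] by (intro mult_left_mono) auto
    also have "\<dots> = c \<eta> * real (card (\<Gamma> \<eta>))" using h1[OF \<eta>] by simp
    finally show "c \<eta> / real (h \<eta>) * real (card L) \<le> c \<eta> * real (card (\<Gamma> \<eta>))" .
  qed
  also have "\<dots> \<le> (\<Sum>\<eta>\<in>\<Omega>. c \<eta> * real (\<Sum>\<chi>\<in>C. s \<eta> \<chi>))"
  proof (rule sum_mono, rule mult_left_mono[OF _ c0])
    fix \<eta> assume \<eta>: "\<eta> \<in> \<Omega>"
    have "card (\<Gamma> \<eta>) = (\<Sum>\<gamma>\<in>\<Gamma> \<eta>. 1)" by simp
    also have "\<dots> \<le> (\<Sum>\<gamma>\<in>\<Gamma> \<eta>. \<Sum>\<chi>\<in>C. char_mult (T \<eta>) \<gamma> \<chi>)"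
    proof (rule sum_mono)
      fix \<gamma> assume "\<gamma> \<in> \<Gamma> \<eta>"
      then obtain \<chi> where "\<chi> \<in> C" "1 \<le> char_mult (T \<eta>) \<gamma> \<chi>" using claim2[OF \<eta>] by blast
      then show "1 \<le> (\<Sum>\<chi>\<in>C. char_mult (T \<eta>) \<gamma> \<chi>)"
        using member_le_sum[of \<chi> C "\<lambda>\<chi>. char_mult (T \<eta>) \<gamma> \<chi>"] finC by simp
    qed
    also have "\<dots> = (\<Sum>\<chi>\<in>C. s \<eta> \<chi>)" unfolding s_def by (rule sum.swap)
    finally show "real (card (\<Gamma> \<eta>)) \<le> real (\<Sum>\<chi>\<in>C. s \<eta> \<chi>)" by (rule of_nat_mono)
  qed
  also have "\<dots> = (\<Sum>\<eta>\<in>\<Omega>. \<Sum>\<chi>\<in>C. c \<eta> * real (s \<eta> \<chi>))" by (simp add: sum_distrib_left)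
  also have "\<dots> = (\<Sum>\<chi>\<in>C. \<Sum>\<eta>\<in>\<Omega>. c \<eta> * real (s \<eta> \<chi>))" by (rule sum.swap)
  also have "\<dots> \<le> (\<Sum>\<chi>\<in>C. w \<chi>)" by (rule sum_mono) (rule claim1)
  finally show "(real p - 1) * real (card (lin_chars G (carrier G))) \<le>
      (\<Sum>\<chi>\<in>C. (real p + 3) * real (char_degree G \<chi>) - 2 * (real p + 1))"
    by (simp add: L_def w_def)
  have "\<Omega> \<noteq> {}" using card\<Omega> p2 by auto
  then obtain \<eta> where \<eta>: "\<eta> \<in> \<Omega>" by blast
  have "restrict (\<lambda>_. 1) (carrier G) \<in> L" by (auto simp: L_def lin_chars_def)
  then have "\<Gamma> \<eta> \<noteq> {}" by (auto simp: \<Gamma>_def)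
  then show "C \<noteq> {}" using claim2[OF \<eta>] by blast
qed

theorem corollary1p2:
  fixes G :: "('a, 'b) monoid_scheme" and p :: nat
  assumes "group G" and "finite (carrier G)" and "Factorial_Ring.prime p"
    and "acd_p' p G < 2 * (real p + 1) / (real p + 3)"
  shows "p_nilpotent p G"
proof (rule ccontr)
  assume not_nilp: "\<not> p_nilpotent p G"
  interpret group G by fact
  note fin = assms(2)
  define I where "I = irr_chars_p' p G"
  define C where "C = {\<chi> \<in> I. char_degree G \<chi> \<noteq> 1}"
  define D where "D = {\<chi> \<in> I. char_degree G \<chi> = 1}"
  have finI: "finite I" using finite_irr_chars[OF fin] by (simp add: I_def irr_chars_p'_def)
  note bound = sum_weights_lower_bound[OF fin assms(3) not_nilp, folded I_def, folded C_def]
  have "D \<subseteq> lin_chars G (carrier G)"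
  proof
    fix \<chi> assume "\<chi> \<in> D"
    then have "\<chi> \<in> irr_chars G" "char_degree G \<chi> = 1" by (auto simp: D_def I_def irr_chars_p'_def)
    then obtain n \<rho> where "mat_rep G n \<rho>" "\<chi> = character_of G \<rho>" "n = 1"
      using char_degree_character by (auto simp: irr_chars_def irreducible_iff)
    then show "\<chi> \<in> lin_chars G (carrier G)" using degree_one_lin_char by simp
  qed
  then have "card D \<le> card (lin_chars G (carrier G))"
    by (rule card_mono[OF finite_lin_chars[OF fin subgroup_self]])
  then have "(real p - 1) * real (card D) \<le> (real p - 1) * real (card (lin_chars G (carrier G)))"
    using prime_ge_2_nat[OF assms(3)] by (intro mult_left_mono) auto
  also note bound(1)
  finally have 1: "(real p - 1) * real (card D) \<le>
    (\<Sum>\<chi>\<in>C. (real p + 3) * real (char_degree G \<chi>) - 2 * (real p + 1))" .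
  have "(\<Sum>\<chi>\<in>I. (real p + 3) * real (char_degree G \<chi>) - 2 * (real p + 1)) =
    (\<Sum>\<chi>\<in>D. (real p + 3) * real (char_degree G \<chi>) - 2 * (real p + 1)) +
    (\<Sum>\<chi>\<in>C. (real p + 3) * real (char_degree G \<chi>) - 2 * (real p + 1))"
    using finI by (subst sum.union_disjoint[symmetric]) (auto simp: C_def D_def intro!: sum.cong)
  also have "(\<Sum>\<chi>\<in>D. (real p + 3) * real (char_degree G \<chi>) - 2 * (real p + 1)) = - ((real p - 1) * real (card D))"
    by (simp add: D_def algebra_simps)
  finally have "0 \<le> (\<Sum>\<chi>\<in>I. (real p + 3) * real (char_degree G \<chi>) - 2 * (real p + 1))"
    using 1 by simp
  then have "2 * (real p + 1) * real (card I) \<le> (real p + 3) * (\<Sum>\<chi>\<in>I. real (char_degree G \<chi>))"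
    by (simp add: sum_subtractf sum_distrib_left mult.commute)
  \<comment> \<open>Positivity allows division by \<open>card I\<close>; for an empty set
    \<open>acd_p'\<close> would be 0.\<close>
  moreover have "card I > 0" using bound(2) finI by (auto simp: C_def card_gt_0_iff)
  ultimately have "2 * (real p + 1) / (real p + 3) \<le> acd_p' p G"
    by (simp add: acd_p'_def I_def[symmetric] field_simps)
  then show False using assms(4) by simp
qed

end
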